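(* Let $(X_k)_{k\geq -1}$ be an INAR(2) process with autoregressive parameter $(\alpha,\beta)=(1,0)$ and innovations $(\varepsilon_k)_{k\in\mathbb{N}}$. Suppose that $X_0=X_{-1}=0$, $\mathrm{E}(\varepsilon_1^4)<\infty$ and $\mu_\varepsilon>0$. For each $n\in\mathbb{N}$ let $(\widehat\alpha_n,\widehat\beta_n)$ be a CLS estimator of the autoregressive parameter based on a sample of size $n$, and put $\mathbf{X}_n=(X_1,\ldots,X_n)$. Then $$\begin{bmatrix}\sqrt{n}\,(\widehat\alpha_n(\mathbf{X}_n)-1)\\ \sqrt{n}\,\widehat\beta_n(\mathbf{X}_n)\end{bmatrix}\ \longrightarrow\ \frac{2\sigma_\varepsilon}{\sqrt{\mu_\varepsilon^2+4\sigma_\varepsilon^2}}\,Z\begin{bmatrix}-1\\1\end{bmatrix}\qquad\text{in distribution as } n\to\infty,$$ where $Z$ is a standard normally distributed random variable. Hence the limit distribution is a centered normal distribution with covariance matrix $$\frac{4\sigma_\varepsilon^2}{\mu_\varepsilon^2+4\sigma_\varepsilon^2}\begin{bmatrix}1&-1\\-1&1\end{bmatrix}.$$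
   Context: All random variables are defined on a fixed probability space $(\Omega,\mathcal{A},\mathrm{P})$. $\mathbb{N}$ denotes the positive integers. INAR(2) process: let $(\varepsilon_k)_{k\in\mathbb{N}}$ (the innovations) be i.i.d. non-negative integer-valued random variables and $(\alpha,\beta)\in[0,1]^2$ (the autoregressive parameter). An INAR(2) process with autoregressive parameter $(\alpha,\beta)$ and innovations $(\varepsilon_k)_{k\in\mathbb{N}}$ is a process $(X_k)_{k\ge -1}$ with $$X_k=\sum_{j=1}^{X_{k-1}}\xi_{k,j}+\sum_{j=1}^{X_{k-2}}\eta_{k,j}+\varepsilon_k,\qquad k\in\mathbb{N},$$ where for all $k\in\mathbb{N}$, $(\xi_{k,j})_{j\in\mathbb{N}}$ and $(\eta_{k,j})_{j\in\mathbb{N}}$ are sequences of i.i.d. Bernoulli random variables with mean $\alpha$ and $\beta$, respectively, such that these sequences are mutually independent and independent of $(\varepsilon_k)_{k\in\mathbb{N}}$, and $X_0,X_{-1}$ are non-negative integer-valued random variables independent of all the sequences $(\xi_{k,j})_j$, $(\eta_{k,j})_j$, $k\in\mathbb N$, and $(\varepsilon_k)_k$. It is assumed that $\mathrm{E}(\varepsilon_1^2)<\infty$; $\mu_\varepsilon$ and $\sigma_\varepsilon^2$ denote the mean and variance of $\varepsilon_1$, and $\sigma_\varepsilon\ge 0$. CLS (conditional least squares) estimator: for $n\in\mathbb{N}$, $\mathbf{x}_n=(x_1,\ldots,x_n)\in\mathbb{R}^n$ (with the convention $x_{-1}:=x_0:=0$) and $\alpha',\beta'\in\mathbb{R}$ put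 $$Q_n(\mathbf{x}_n;\alpha',\beta'):=\sum_{k=1}^n(x_k-\alpha'x_{k-1}-\beta'x_{k-2}-\mu_\varepsilon)^2 .$$ A CLS estimator of the autoregressive parameter (based on a sample of size $n$) is a measurable function $(\widehat\alpha_n,\widehat\beta_n):\mathbb{R}^n\to\mathbb{R}^2$ such that $Q_n(\mathbf{x}_n;\widehat\alpha_n(\mathbf{x}_n),\widehat\beta_n(\mathbf{x}_n))=\inf_{(\alpha',\beta')\in\mathbb{R}^2}Q_n(\mathbf{x}_n;\alpha',\beta')$ for all $\mathbf{x}_n\in\mathbb{R}^n$. *)

theory Defs
  imports "HOL-Probability.Probability"
begin

definition iid_nat :: "'a measure \<Rightarrow> (nat \<Rightarrow> 'a \<Rightarrow> nat) \<Rightarrow> bool" where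
  "iid_nat M Y \<longleftrightarrow>
     prob_space.indep_vars M (\<lambda>_. count_space UNIV) Y {1..} \<and>
     (\<forall>j\<ge>1. distr M (count_space UNIV) (Y j) = distr M (count_space UNIV) (Y 1))"

definition iid_bernoulli :: "'a measure \<Rightarrow> real \<Rightarrow> (nat \<Rightarrow> 'a \<Rightarrow> nat) \<Rightarrow> bool" where
  "iid_bernoulli M p Y \<longleftrightarrow>
     prob_space.indep_vars M (\<lambda>_. count_space UNIV) Y {1..} \<and>
     (\<forall>j\<ge>1. distr M (count_space UNIV) (Y j) = measure_pmf (map_pmf of_bool (bernoulli_pmf p)))"

text \<open>
  The mutually independent sources of randomness of an INAR(2) process:
  for each \<open>k \<ge> 1\<close> the sequences \<open>(\<xi> k j)\<close> and \<open>(\<eta> k j)\<close>, \<open>j \<ge> 1\<close>, further the whole innovation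
  sequence, and the pair of initial values \<open>(X 0, X (-1))\<close>.  Each is one random element of a
  product space; the pair is indexed by \<open>{0, 1}\<close>, so that the two initial values may depend on
  each other.
\<close>

datatype inar_source = Thin1 nat | Thin2 nat | Innovations | Initial

definition inar_sources :: "inar_source set" where
  "inar_sources = Thin1 ` {1..} \<union> Thin2 ` {1..} \<union> {Innovations, Initial}"

fun source_index :: "inar_source \<Rightarrow> nat set" where
  "source_index Initial = {0, 1}"
| "source_index _ = {1..}"

fun source_component ::
  "(nat \<Rightarrow> nat \<Rightarrow> 'a \<Rightarrow> nat) \<Rightarrow> (nat \<Rightarrow> nat \<Rightarrow> 'a \<Rightarrow> nat) \<Rightarrow> (nat \<Rightarrow> 'a \<Rightarrow> nat) \<Rightarrow> (int \<Rightarrow> 'a \<Rightarrow> nat)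
    \<Rightarrow> inar_source \<Rightarrow> nat \<Rightarrow> 'a \<Rightarrow> nat" where
  "source_component \<xi> \<eta> \<epsilon> X (Thin1 k) j = \<xi> k j"
| "source_component \<xi> \<eta> \<epsilon> X (Thin2 k) j = \<eta> k j"
| "source_component \<xi> \<eta> \<epsilon> X Innovations j = \<epsilon> j"
| "source_component \<xi> \<eta> \<epsilon> X Initial j = X (- int j)"

text \<open>
  Only the indices \<open>k \<ge> -1\<close> of \<open>X\<close> and \<open>k, j \<ge> 1\<close> of \<open>\<epsilon>\<close>, \<open>\<xi>\<close>, \<open>\<eta>\<close> are meaningful.
  Equality of random variables is understood almost surely.
\<close>

definition INAR2 ::
  "'a measure \<Rightarrow> real \<Rightarrow> real \<Rightarrow> (nat \<Rightarrow> 'a \<Rightarrow> nat) \<Rightarrow> (int \<Rightarrow> 'a \<Rightarrow> nat) \<Rightarrow> bool" where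
  "INAR2 M \<alpha> \<beta> \<epsilon> X \<longleftrightarrow>
     \<alpha> \<in> {0..1} \<and> \<beta> \<in> {0..1} \<and> iid_nat M \<epsilon> \<and>
     (\<forall>k\<ge>-1. X k \<in> measurable M (count_space UNIV)) \<and>
     (\<exists>\<xi> \<eta>.
        (\<forall>k\<ge>1. iid_bernoulli M \<alpha> (\<xi> k) \<and> iid_bernoulli M \<beta> (\<eta> k)) \<and>
        prob_space.indep_vars M
          (\<lambda>s. PiM (source_index s) (\<lambda>_. count_space UNIV))
          (\<lambda>s \<omega>. \<lambda>j\<in>source_index s. source_component \<xi> \<eta> \<epsilon> X s j \<omega>)
          inar_sources \<and>
        (\<forall>k\<ge>1. AE \<omega> in M.
           X (int k) \<omega> =
             (\<Sum>j=1..X (int k - 1) \<omega>. \<xi> k j \<omega>) + (\<Sum>j=1..X (int k - 2) \<omega>. \<eta> k j \<omega>) + \<epsilon> k \<omega>))"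

text \<open>
  A sample in \<open>\<real>\<^sup>n\<close> is an element of \<open>space (PiM {1..n} (\<lambda>_. borel))\<close>, i.e. an extensional
  function on \<open>{1..n}\<close>, prolonged by \<open>x\<^sub>0 = x\<^sub>-\<^sub>1 = 0\<close>.
\<close>

definition sample_at :: "(nat \<Rightarrow> real) \<Rightarrow> int \<Rightarrow> real" where
  "sample_at x k = (if k \<le> 0 then 0 else x (nat k))"

definition cls_Q :: "real \<Rightarrow> nat \<Rightarrow> (nat \<Rightarrow> real) \<Rightarrow> real \<Rightarrow> real \<Rightarrow> real" where
  "cls_Q \<mu> n x a b =
     (\<Sum>k=1..n. (sample_at x (int k) - a * sample_at x (int k - 1)
                   - b * sample_at x (int k - 2) - \<mu>)\<^sup>2)"

definition is_CLS_estimator ::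
  "real \<Rightarrow> nat \<Rightarrow> ((nat \<Rightarrow> real) \<Rightarrow> real) \<Rightarrow> ((nat \<Rightarrow> real) \<Rightarrow> real) \<Rightarrow> bool" where
  "is_CLS_estimator \<mu> n a b \<longleftrightarrow>
     (\<lambda>x. (a x, b x)) \<in> borel_measurable (PiM {1..n} (\<lambda>_. borel)) \<and>
     (\<forall>x\<in>space (PiM {1..n} (\<lambda>_. borel :: real measure)).
        cls_Q \<mu> n x (a x) (b x) = (INF p. cls_Q \<mu> n x (fst p) (snd p)))"

definition converges_in_distribution ::
  "'a measure \<Rightarrow> (nat \<Rightarrow> 'a \<Rightarrow> 'c::euclidean_space) \<Rightarrow> 'b measure \<Rightarrow> ('b \<Rightarrow> 'c) \<Rightarrow> bool" where
  "converges_in_distribution M Y N Y' \<longleftrightarrow>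
     (\<forall>n. Y n \<in> borel_measurable M) \<and> Y' \<in> borel_measurable N \<and>
     (\<forall>f :: 'c \<Rightarrow> real. continuous_on UNIV f \<longrightarrow> bounded (range f) \<longrightarrow>
        (\<lambda>n. integral\<^sup>L M (\<lambda>\<omega>. f (Y n \<omega>))) \<longlonglongrightarrow> integral\<^sup>L N (\<lambda>\<omega>. f (Y' \<omega>)))"

text \<open>Normal laws include the degenerate ones, i.e. point masses.\<close>

definition univariate_normal :: "real \<Rightarrow> real \<Rightarrow> real measure" where
  "univariate_normal m s =
     (if s = 0 then return borel m else density lborel (\<lambda>x. ennreal (normal_density m s x)))"

definition is_normal_law :: "(real ^ 'd) measure \<Rightarrow> bool" where
  "is_normal_law \<nu> \<longleftrightarrow>
     sets \<nu> = sets borel \<and>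
     (\<forall>u. \<exists>m s. s \<ge> 0 \<and> distr \<nu> borel (\<lambda>x. u \<bullet> x) = univariate_normal m s)"

definition mean_vector :: "(real ^ 'd) measure \<Rightarrow> real ^ 'd" where
  "mean_vector \<nu> = (\<chi> i. \<integral>x. x $ i \<partial>\<nu>)"

definition covariance_matrix :: "(real ^ 'd) measure \<Rightarrow> real ^ 'd ^ 'd" where
  "covariance_matrix \<nu> =
     (\<chi> i j. \<integral>x. (x $ i - mean_vector \<nu> $ i) * (x $ j - mean_vector \<nu> $ j) \<partial>\<nu>)"

end

theory Submission
  imports Defs "HOL-Real_Asymp.Real_Asymp"
begin

text \<open>
  At the parameter \<open>(1, 0)\<close> the thinning is trivial and the process is the random walk
  \<open>X\<^sub>k = \<epsilon>\<^sub>1 + \<dots> + \<epsilon>\<^sub>k\<close> with drift \<open>\<mu> > 0\<close>.  Let \<open>m\<^sub>k = \<epsilon>\<^sub>k - \<mu>\<close>, \<open>v = \<beta>\<close> and \<open>w = \<alpha> - 1 + \<beta>\<close>.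
  The residual \<open>X\<^sub>k - \<alpha> X\<^sub>k\<^sub>-\<^sub>1 - \<beta> X\<^sub>k\<^sub>-\<^sub>2 - \<mu>\<close> equals \<open>m\<^sub>k - w X\<^sub>k\<^sub>-\<^sub>1 + v \<epsilon>\<^sub>k\<^sub>-\<^sub>1\<close>, so the estimator
  regresses the noise on the level \<open>X\<^sub>k\<^sub>-\<^sub>1\<close>, of order \<open>n\<close>, and on the increment \<open>\<epsilon>\<^sub>k\<^sub>-\<^sub>1\<close>, of order
  \<open>1\<close>.  The normalised sums \<open>n\<^sup>-\<^sup>3 \<Sum> X\<^sub>k\<^sub>-\<^sub>1\<^sup>2\<close>, \<open>n\<^sup>-\<^sup>2 \<Sum> X\<^sub>k\<^sub>-\<^sub>1 \<epsilon>\<^sub>k\<^sub>-\<^sub>1\<close> and \<open>n\<^sup>-\<^sup>1 \<Sum> \<epsilon>\<^sub>k\<^sub>-\<^sub>1\<^sup>2\<close>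
  converge in probability to \<open>\<mu>\<^sup>2 / 3\<close>, \<open>\<mu>\<^sup>2 / 2\<close> and \<open>\<mu>\<^sup>2 + \<sigma>\<^sup>2\<close>, and the limiting determinant
  \<open>\<mu>\<^sup>2 D / 12\<close> with \<open>D = \<mu>\<^sup>2 + 4 \<sigma>\<^sup>2\<close> is positive (\<open>SS_law\<close>, \<open>SE_law\<close>, \<open>EE_law\<close>, \<open>gram_det_law\<close>).

  Cramer's rule (\<open>cls_solution\<close>) then shows that \<open>\<surd>n w\<close> tends to zero
  (\<open>coefficient_sum_negligible\<close>) and that, up to a term that tends to zero in probability,
  \<open>\<surd>n v = n\<^sup>-\<^sup>1\<^sup>/\<^sup>2 \<Sum> D\<^sup>-\<^sup>1 (6 \<mu> k / n - 4 \<mu> - 4 m\<^sub>k) m\<^sub>k\<^sub>+\<^sub>1\<close> (\<open>second_coefficient_expansion\<close>).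
  Consequently \<open>\<surd>n (\<alpha> - 1, \<beta>)\<close> behaves like \<open>\<surd>n v (-1, 1)\<close>, which explains the singular covariance
  matrix.

  The sum is one of martingale differences \<open>(c\<^sub>k + d m\<^sub>k) m\<^sub>k\<^sub>+\<^sub>1\<close>.  Its asymptotic normality is
  proved by a recursion for the characteristic functions \<open>\<phi>\<^sub>k\<close> of the partial sums: expanding the last
  factor to second order gives
  \<open>\<phi>\<^sub>k\<^sub>+\<^sub>1 = (1 - t\<^sup>2 \<sigma>\<^sup>2 (c\<^sub>k\<^sup>2 + d\<^sup>2 \<sigma>\<^sup>2) / (2 n)) \<phi>\<^sub>k\<close> up to an error \<open>O(n\<^sup>-\<^sup>3\<^sup>/\<^sup>2)\<close>
  (\<open>char_psum_step\<close>), and \<open>n\<close> such errors add up to \<open>O(n\<^sup>-\<^sup>1\<^sup>/\<^sup>2)\<close>.  The asymptotic variance is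
  \<open>\<sigma>\<^sup>2 D\<^sup>-\<^sup>2 (\<mu>\<^sup>2 \<integral> (6 t - 4)\<^sup>2 dt + 16 \<sigma>\<^sup>2)\<close>, the integral over the unit interval being \<open>4\<close>, that
  is \<open>4 \<sigma>\<^sup>2 / D\<close> (\<open>lin_variance\<close>).
  The Levy continuity theorem and a Slutsky argument (\<open>Slutsky\<close>) conclude.
\<close>

section \<open>Convergence and boundedness in probability\<close>

definition conv_prob :: "'a measure \<Rightarrow> (nat \<Rightarrow> 'a \<Rightarrow> real) \<Rightarrow> real \<Rightarrow> bool" where
  "conv_prob M Y c \<longleftrightarrow> (\<forall>\<delta>>0. (\<lambda>n. measure M {\<omega>\<in>space M. \<delta> < \<bar>Y n \<omega> - c\<bar>}) \<longlonglongrightarrow> 0)"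

definition bounded_in_prob :: "'a measure \<Rightarrow> (nat \<Rightarrow> 'a \<Rightarrow> real) \<Rightarrow> bool" where
  "bounded_in_prob M Y \<longleftrightarrow>
     (\<forall>\<eta>>0. \<exists>K. \<forall>\<^sub>F n in sequentially. measure M {\<omega>\<in>space M. K < \<bar>Y n \<omega>\<bar>} < \<eta>)"

context prob_space
begin

lemma conv_probD:
  assumes "conv_prob M Y c" "0 < \<delta>" "0 < \<eta>"
  shows "\<forall>\<^sub>F n in sequentially. prob {\<omega>\<in>space M. \<delta> < \<bar>Y n \<omega> - c\<bar>} < \<eta>"
  using assms by (auto simp: conv_prob_def intro: order_tendstoD(2))

lemma conv_probI:
  assumes "\<And>\<delta> \<eta>. 0 < \<delta> \<Longrightarrow> 0 < \<eta> \<Longrightarrow> \<forall>\<^sub>F n in sequentially. prob {\<omega>\<in>space M. \<delta> < \<bar>Y n \<omega> - c\<bar>} < \<eta>"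
  shows "conv_prob M Y c"
  unfolding conv_prob_def
proof (intro allI impI order_tendstoI)
  fix \<delta> a :: real assume "0 < \<delta>" "a < 0"
  then show "\<forall>\<^sub>F n in sequentially. a < prob {\<omega>\<in>space M. \<delta> < \<bar>Y n \<omega> - c\<bar>}"
    by (auto intro: always_eventually less_le_trans[OF _ measure_nonneg])
qed (use assms in auto)

lemma prob_less_of_AE_Un:
  assumes "AE \<omega> in M. P \<omega> \<longrightarrow> Q \<omega> \<or> R \<omega>"
    and [measurable]: "{\<omega>\<in>space M. Q \<omega>} \<in> events" "{\<omega>\<in>space M. R \<omega>} \<in> events"
    and "prob {\<omega>\<in>space M. Q \<omega>} < \<eta> / 2" "prob {\<omega>\<in>space M. R \<omega>} < \<eta> / 2"
  shows "prob {\<omega>\<in>space M. P \<omega>} < \<eta>"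
proof -
  have "prob {\<omega>\<in>space M. P \<omega>} \<le> prob ({\<omega>\<in>space M. Q \<omega>} \<union> {\<omega>\<in>space M. R \<omega>})"
    by (intro finite_measure_mono_AE) (use assms(1) in \<open>auto\<close>)
  also have "\<dots> \<le> prob {\<omega>\<in>space M. Q \<omega>} + prob {\<omega>\<in>space M. R \<omega>}"
    by (intro measure_Un_le) auto
  finally show ?thesis using assms by linarith
qed

lemma conv_prob_AE_le:
  assumes [measurable]: "\<And>n. Z n \<in> borel_measurable M"
    and "conv_prob M Z 0"
    and le: "\<forall>\<^sub>F n in sequentially. AE \<omega> in M. \<bar>Y n \<omega> - c\<bar> \<le> \<bar>Z n \<omega>\<bar>"
  shows "conv_prob M Y c"
proof (rule conv_probI)
  fix \<delta> \<eta> :: real assume *: "0 < \<delta>" "0 < \<eta>"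
  show "\<forall>\<^sub>F n in sequentially. prob {\<omega>\<in>space M. \<delta> < \<bar>Y n \<omega> - c\<bar>} < \<eta>"
    using conv_probD[OF assms(2) *] le
  proof eventually_elim
    case (elim n)
    have "prob {\<omega>\<in>space M. \<delta> < \<bar>Y n \<omega> - c\<bar>} \<le> prob {\<omega>\<in>space M. \<delta> < \<bar>Z n \<omega> - 0\<bar>}"
      by (intro finite_measure_mono_AE) (use elim(2) in auto)
    then show ?case using elim by linarith
  qed
qed

lemma conv_prob_const:
  assumes "x \<longlonglongrightarrow> c"
  shows "conv_prob M (\<lambda>n \<omega>. x n) c"
proof (rule conv_probI)
  fix \<delta> \<eta> :: real assume "0 < \<delta>" "0 < \<eta>"
  have "\<forall>\<^sub>F n in sequentially. dist (x n) c < \<delta>"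
    using assms \<open>0 < \<delta>\<close> by (rule tendstoD)
  then show "\<forall>\<^sub>F n in sequentially. prob {\<omega>\<in>space M. \<delta> < \<bar>x n - c\<bar>} < \<eta>"
    by eventually_elim (use \<open>0 < \<eta>\<close> in \<open>auto simp: dist_real_def\<close>)
qed

text \<open>
  The continuous mapping theorem for a constant limit: closeness of both arguments to \<open>(a, b)\<close>
  forces closeness of the values, so an exceptional event of the image is covered by the two
  exceptional events of the arguments.
\<close>

lemma conv_prob_map2:
  fixes g :: "real \<Rightarrow> real \<Rightarrow> real"
  assumes [measurable]: "\<And>n. Y n \<in> borel_measurable M" "\<And>n. Z n \<in> borel_measurable M"
    and Y: "conv_prob M Y a" and Z: "conv_prob M Z b"
    and g: "isCont (\<lambda>p. g (fst p) (snd p)) (a, b)"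
  shows "conv_prob M (\<lambda>n \<omega>. g (Y n \<omega>) (Z n \<omega>)) (g a b)"
proof (rule conv_probI)
  fix \<delta> \<eta> :: real assume *: "0 < \<delta>" "0 < \<eta>"
  obtain d where d: "0 < d" "\<And>p. dist p (a, b) < d \<Longrightarrow> dist (g (fst p) (snd p)) (g a b) < \<delta>"
    using g \<open>0 < \<delta>\<close> unfolding continuous_at_eps_delta by (metis fst_conv snd_conv)
  have close: "\<bar>g y z - g a b\<bar> < \<delta>" if "\<bar>y - a\<bar> \<le> d / 3" "\<bar>z - b\<bar> \<le> d / 3" for y z
  proof -
    have "dist (y, z) (a, b) \<le> \<bar>y - a\<bar> + \<bar>z - b\<bar>"
      using sqrt_sum_squares_le_sum_abs[of "y - a" "z - b"] by (simp add: dist_Pair_Pair dist_real_def)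
    then show ?thesis using d(1) d(2)[of "(y, z)"] that by (simp add: dist_real_def)
  qed
  have "0 < d / 3" "0 < \<eta> / 2" using d * by auto
  from conv_probD[OF Y this] conv_probD[OF Z this]
  show "\<forall>\<^sub>F n in sequentially. prob {\<omega>\<in>space M. \<delta> < \<bar>g (Y n \<omega>) (Z n \<omega>) - g a b\<bar>} < \<eta>"
  proof eventually_elim
    case (elim n)
    show ?case
    proof (rule prob_less_of_AE_Un[OF _ _ _ elim], rule AE_I2, rule impI)
      fix \<omega> assume "\<delta> < \<bar>g (Y n \<omega>) (Z n \<omega>) - g a b\<bar>"
      then show "d / 3 < \<bar>Y n \<omega> - a\<bar> \<or> d / 3 < \<bar>Z n \<omega> - b\<bar>"
        using close[of "Y n \<omega>" "Z n \<omega>"] by linarith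
    qed measurable
  qed
qed

lemma
  assumes [measurable]: "\<And>n. Y n \<in> borel_measurable M" "\<And>n. Z n \<in> borel_measurable M"
    and "conv_prob M Y a" and "conv_prob M Z b"
  shows conv_prob_add: "conv_prob M (\<lambda>n \<omega>. Y n \<omega> + Z n \<omega>) (a + b)"
    and conv_prob_diff: "conv_prob M (\<lambda>n \<omega>. Y n \<omega> - Z n \<omega>) (a - b)"
    and conv_prob_mult: "conv_prob M (\<lambda>n \<omega>. Y n \<omega> * Z n \<omega>) (a * b)"
    and conv_prob_divide: "b \<noteq> 0 \<Longrightarrow> conv_prob M (\<lambda>n \<omega>. Y n \<omega> / Z n \<omega>) (a / b)"
  by (rule conv_prob_map2[OF assms]; intro continuous_intros; simp)+

lemma bounded_in_prob_add:
  assumes [measurable]: "\<And>n. Y n \<in> borel_measurable M" "\<And>n. Z n \<in> borel_measurable M"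
    and Y: "bounded_in_prob M Y" and Z: "bounded_in_prob M Z"
  shows "bounded_in_prob M (\<lambda>n \<omega>. Y n \<omega> + Z n \<omega>)"
  unfolding bounded_in_prob_def
proof (intro allI impI)
  fix \<eta> :: real assume "0 < \<eta>"
  then have "0 < \<eta> / 2" by simp
  obtain K L where KL: "\<forall>\<^sub>F n in sequentially. prob {\<omega>\<in>space M. K < \<bar>Y n \<omega>\<bar>} < \<eta> / 2"
    "\<forall>\<^sub>F n in sequentially. prob {\<omega>\<in>space M. L < \<bar>Z n \<omega>\<bar>} < \<eta> / 2"
    using Y Z \<open>0 < \<eta> / 2\<close> unfolding bounded_in_prob_def by blast
  then have "\<forall>\<^sub>F n in sequentially. prob {\<omega>\<in>space M. K + L < \<bar>Y n \<omega> + Z n \<omega>\<bar>} < \<eta>"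
  proof eventually_elim
    case (elim n)
    show ?case by (rule prob_less_of_AE_Un[OF _ _ _ elim]) auto
  qed
  then show "\<exists>K. \<forall>\<^sub>F n in sequentially. prob {\<omega>\<in>space M. K < \<bar>Y n \<omega> + Z n \<omega>\<bar>} < \<eta>" ..
qed

text \<open>
  The rule \<open>O\<^sub>P(1) o\<^sub>P(1) = o\<^sub>P(1)\<close>: off an event of small probability the first factor is at
  most some \<open>K\<close>, and then a large product needs a large second factor.
\<close>

lemma conv_prob_bounded_mult:
  assumes [measurable]: "\<And>n. Y n \<in> borel_measurable M" "\<And>n. Z n \<in> borel_measurable M"
    and Y: "bounded_in_prob M Y" and Z: "conv_prob M Z 0"
  shows "conv_prob M (\<lambda>n \<omega>. Y n \<omega> * Z n \<omega>) 0"
proof (rule conv_probI)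
  fix \<delta> \<eta> :: real assume *: "0 < \<delta>" "0 < \<eta>"
  then have "0 < \<eta> / 2" by simp
  obtain K where K: "\<forall>\<^sub>F n in sequentially. prob {\<omega>\<in>space M. K < \<bar>Y n \<omega>\<bar>} < \<eta> / 2"
    using Y \<open>0 < \<eta> / 2\<close> unfolding bounded_in_prob_def by blast
  have "0 < \<delta> / (\<bar>K\<bar> + 1)" using * by simp
  from K conv_probD[OF Z this \<open>0 < \<eta> / 2\<close>]
  show "\<forall>\<^sub>F n in sequentially. prob {\<omega>\<in>space M. \<delta> < \<bar>Y n \<omega> * Z n \<omega> - 0\<bar>} < \<eta>"
  proof eventually_elim
    case (elim n)
    show ?case
    proof (rule prob_less_of_AE_Un[OF _ _ _ elim], rule AE_I2, rule impI, rule ccontr)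
      fix \<omega> assume 1: "\<delta> < \<bar>Y n \<omega> * Z n \<omega> - 0\<bar>"
        and "\<not> (K < \<bar>Y n \<omega>\<bar> \<or> \<delta> / (\<bar>K\<bar> + 1) < \<bar>Z n \<omega> - 0\<bar>)"
      then have "\<bar>Y n \<omega>\<bar> * \<bar>Z n \<omega>\<bar> \<le> (\<bar>K\<bar> + 1) * (\<delta> / (\<bar>K\<bar> + 1))"
        by (intro mult_mono) auto
      then show False using 1 by (simp add: abs_mult)
    qed measurable
  qed
qed

lemma Markov_abs:
  assumes "integrable M Y" "0 < \<delta>" "expectation (\<lambda>\<omega>. \<bar>Y \<omega>\<bar>) \<le> B"
  shows "prob {\<omega>\<in>space M. \<delta> < \<bar>Y \<omega>\<bar>} \<le> B / \<delta>"
proof -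
  have [measurable]: "Y \<in> borel_measurable M" using assms by auto
  have "prob {\<omega>\<in>space M. \<delta> < \<bar>Y \<omega>\<bar>} \<le> prob {\<omega>\<in>space M. \<delta> \<le> \<bar>Y \<omega>\<bar>}"
    by (intro finite_measure_mono) auto
  also have "\<dots> \<le> expectation (\<lambda>\<omega>. \<bar>Y \<omega>\<bar>) / \<delta>"
    by (rule integral_Markov_inequality_measure[where A = "space M"]) (use assms in auto)
  also have "\<dots> \<le> B / \<delta>" using assms by (intro divide_right_mono) auto
  finally show ?thesis .
qed

lemma conv_prob_L1:
  assumes "\<And>n. integrable M (Y n)" "\<And>n. expectation (\<lambda>\<omega>. \<bar>Y n \<omega>\<bar>) \<le> b n" "b \<longlonglongrightarrow> 0"
  shows "conv_prob M Y 0"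
  unfolding conv_prob_def
proof (intro allI impI)
  fix \<delta> :: real assume "0 < \<delta>"
  show "(\<lambda>n. prob {\<omega>\<in>space M. \<delta> < \<bar>Y n \<omega> - 0\<bar>}) \<longlonglongrightarrow> 0"
  proof (rule tendsto_sandwich[where f = "\<lambda>_. 0"])
    show "(\<lambda>n. b n / \<delta>) \<longlonglongrightarrow> 0" using assms(3) \<open>0 < \<delta>\<close> by (auto intro: tendsto_eq_intros)
    show "\<forall>\<^sub>F n in sequentially. prob {\<omega>\<in>space M. \<delta> < \<bar>Y n \<omega> - 0\<bar>} \<le> b n / \<delta>"
      using Markov_abs[OF assms(1) \<open>0 < \<delta>\<close> assms(2)] by simp
  qed auto
qed

lemma bounded_in_prob_L1:
  assumes "\<And>n. integrable M (Y n)" "\<And>n. expectation (\<lambda>\<omega>. \<bar>Y n \<omega>\<bar>) \<le> B"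
  shows "bounded_in_prob M Y"
  unfolding bounded_in_prob_def
proof (intro allI impI exI always_eventually)
  fix \<eta> :: real and n assume "0 < \<eta>"
  have "0 \<le> B" using assms(2)[of 0] by (rule order_trans[rotated]) simp
  \<comment> \<open>With \<open>B + 1\<close> in place of \<open>B\<close> the threshold is positive also for \<open>B = 0\<close>.\<close>
  have "prob {\<omega>\<in>space M. 2 * (B + 1) / \<eta> < \<bar>Y n \<omega>\<bar>} \<le> B / (2 * (B + 1) / \<eta>)"
    by (rule Markov_abs[OF assms(1) _ assms(2)]) (use \<open>0 < \<eta>\<close> \<open>0 \<le> B\<close> in auto)
  also have "\<dots> < \<eta>" using \<open>0 < \<eta>\<close> \<open>0 \<le> B\<close> by (simp add: divide_simps)
  finally show "prob {\<omega>\<in>space M. 2 * (B + 1) / \<eta> < \<bar>Y n \<omega>\<bar>} < \<eta>" .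
qed

lemma conv_prob_L2:
  assumes [measurable]: "\<And>n. Y n \<in> borel_measurable M"
    and "\<And>n. integrable M (\<lambda>\<omega>. (Y n \<omega>)\<^sup>2)" "\<And>n. expectation (\<lambda>\<omega>. (Y n \<omega>)\<^sup>2) \<le> b n" "b \<longlonglongrightarrow> 0"
  shows "conv_prob M Y 0"
proof -
  have squares: "conv_prob M (\<lambda>n \<omega>. (Y n \<omega>)\<^sup>2) 0"
    by (rule conv_prob_L1[OF assms(2) _ assms(4)]) (simp add: assms)
  have "isCont (\<lambda>p. sqrt (fst p)) (0 :: real, 0 :: real)" by (intro continuous_intros)
  then have "conv_prob M (\<lambda>n \<omega>. sqrt ((Y n \<omega>)\<^sup>2)) (sqrt 0)"
    by (rule conv_prob_map2[where g = "\<lambda>x y. sqrt x", OF _ _ squares squares, rotated -1]) measurable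
  then have "conv_prob M (\<lambda>n \<omega>. \<bar>Y n \<omega>\<bar>) 0" by simp
  then show ?thesis by (rule conv_prob_AE_le[rotated]) auto
qed

lemma bounded_in_prob_L2:
  assumes [measurable]: "\<And>n. Y n \<in> borel_measurable M"
    and int: "\<And>n. integrable M (\<lambda>\<omega>. (Y n \<omega>)\<^sup>2)" and B: "\<And>n. expectation (\<lambda>\<omega>. (Y n \<omega>)\<^sup>2) \<le> B"
  shows "bounded_in_prob M Y"
proof (rule bounded_in_prob_L1)
  have le: "\<bar>y\<bar> \<le> 1 + y\<^sup>2" for y :: real
    using zero_le_power2[of "\<bar>y\<bar> - 1"] unfolding power2_diff by simp
  show *: "integrable M (Y n)" for n
    by (rule Bochner_Integration.integrable_bound[where f="\<lambda>\<omega>. 1 + (Y n \<omega>)\<^sup>2"])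
       (use le int in auto)
  show "expectation (\<lambda>\<omega>. \<bar>Y n \<omega>\<bar>) \<le> 1 + B" for n
  proof -
    have "expectation (\<lambda>\<omega>. \<bar>Y n \<omega>\<bar>) \<le> expectation (\<lambda>\<omega>. 1 + (Y n \<omega>)\<^sup>2)"
      by (intro integral_mono) (use le int * in auto)
    also have "\<dots> = 1 + expectation (\<lambda>\<omega>. (Y n \<omega>)\<^sup>2)" using int by (simp add: prob_space)
    finally show ?thesis using B[of n] by simp
  qed
qed

lemma conv_prob_subseq:
  assumes "conv_prob M Y c" "filterlim f sequentially sequentially"
  shows "conv_prob M (\<lambda>n. Y (f n)) c"
  unfolding conv_prob_def
proof (intro allI impI)
  fix \<delta> :: real assume "0 < \<delta>"
  with assms(1) have "(\<lambda>n. prob {\<omega>\<in>space M. \<delta> < \<bar>Y n \<omega> - c\<bar>}) \<longlonglongrightarrow> 0" by (simp add: conv_prob_def)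
  from filterlim_compose[OF this assms(2)]
  show "(\<lambda>n. prob {\<omega>\<in>space M. \<delta> < \<bar>Y (f n) \<omega> - c\<bar>}) \<longlonglongrightarrow> 0" .
qed

text \<open>
  An estimator is known only through normal equations, which determine it where their determinant
  \<open>D\<close> does not vanish.  The event \<open>D = 0\<close> has vanishing probability when \<open>D\<close> has a nonzero limit,
  so on it the values of \<open>Y\<close> may be arbitrary.
\<close>

lemma conv_prob_of_equation:
  assumes [measurable]: "\<And>n. Y n \<in> borel_measurable M" "\<And>n. U n \<in> borel_measurable M" "\<And>n. D n \<in> borel_measurable M"
    and U: "conv_prob M U 0" and D: "conv_prob M D d" "d \<noteq> 0"
    and eq: "\<forall>\<^sub>F n in sequentially. AE \<omega> in M. D n \<omega> \<noteq> 0 \<longrightarrow> Y n \<omega> = U n \<omega>"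
  shows "conv_prob M Y 0"
proof (rule conv_probI)
  fix \<delta> \<eta> :: real assume *: "0 < \<delta>" "0 < \<eta>"
  have "0 < \<bar>d\<bar> / 2" "0 < \<eta> / 2" using D * by auto
  from conv_probD[OF U \<open>0 < \<delta>\<close> this(2)] conv_probD[OF D(1) this] eq
  show "\<forall>\<^sub>F n in sequentially. prob {\<omega>\<in>space M. \<delta> < \<bar>Y n \<omega> - 0\<bar>} < \<eta>"
  proof eventually_elim
    case (elim n)
    have "AE \<omega> in M. \<delta> < \<bar>Y n \<omega> - 0\<bar> \<longrightarrow> \<delta> < \<bar>U n \<omega> - 0\<bar> \<or> \<bar>d\<bar> / 2 < \<bar>D n \<omega> - d\<bar>"
      using elim(3) by eventually_elim (use D(2) in auto)
    then show ?case
      by (rule prob_less_of_AE_Un[OF _ _ _ elim(1,2)]) measurable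
  qed
qed

text \<open>
  The test function \<open>f\<close> is only continuous, not uniformly so; boundedness in probability of \<open>W\<close>
  confines both arguments of \<open>f\<close> to a fixed compact ball outside an event of small probability,
  and there \<open>f\<close> is uniformly continuous.
\<close>

lemma Slutsky:
  fixes Y :: "nat \<Rightarrow> 'a \<Rightarrow> 'c::euclidean_space" and f :: "'c \<Rightarrow> real"
  assumes [measurable]: "\<And>n. Y n \<in> borel_measurable M" "\<And>n. W n \<in> borel_measurable M"
    and W: "bounded_in_prob M W"
    and YW: "conv_prob M (\<lambda>n \<omega>. norm (Y n \<omega> - W n \<omega> *\<^sub>R e)) 0"
    and f: "continuous_on UNIV f" "bounded (range f)"
    and lim: "(\<lambda>n. expectation (\<lambda>\<omega>. f (W n \<omega> *\<^sub>R e))) \<longlonglongrightarrow> L"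
  shows "(\<lambda>n. expectation (\<lambda>\<omega>. f (Y n \<omega>))) \<longlonglongrightarrow> L"
proof -
  have [measurable]: "f \<in> borel_measurable borel"
    using f(1) by (rule borel_measurable_continuous_onI)
  obtain B where B: "0 < B" "\<And>x. \<bar>f x\<bar> \<le> B"
    using f(2) unfolding bounded_pos by auto
  have int: "integrable M (\<lambda>\<omega>. f (Y n \<omega>))" "integrable M (\<lambda>\<omega>. f (W n \<omega> *\<^sub>R e))" for n
    by (rule integrable_const_bound[where B=B]; use B in auto)+
  have "(\<lambda>n. expectation (\<lambda>\<omega>. f (Y n \<omega>)) - expectation (\<lambda>\<omega>. f (W n \<omega> *\<^sub>R e))) \<longlonglongrightarrow> 0"
  proof (rule LIMSEQ_I)
    fix r :: real assume "0 < r"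
    \<comment> \<open>The two exceptional events together cost at most \<open>4 B \<eta> = r / 2\<close>, uniform continuity costs \<open>r / 4\<close>.\<close>
    define \<eta> where "\<eta> = r / (8 * B)"
    have "0 < \<eta>" using \<open>0 < r\<close> B by (simp add: \<eta>_def)
    obtain K where K: "\<forall>\<^sub>F n in sequentially. prob {\<omega>\<in>space M. K < \<bar>W n \<omega>\<bar>} < \<eta>"
      using W \<open>0 < \<eta>\<close> unfolding bounded_in_prob_def by blast
    let ?C = "cball 0 (\<bar>K\<bar> * norm e + 1) :: 'c set"
    have "uniformly_continuous_on ?C f"
      by (intro compact_uniformly_continuous continuous_on_subset[OF f(1)]) auto
    then obtain d where d: "0 < d" "\<And>x y. x \<in> ?C \<Longrightarrow> y \<in> ?C \<Longrightarrow> dist y x < d \<Longrightarrow> dist (f y) (f x) < r / 4"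
      using \<open>0 < r\<close> unfolding uniformly_continuous_on_def by (metis zero_less_divide_iff zero_less_numeral)
    \<comment> \<open>A distance below \<open>1\<close> keeps the perturbed point inside the enlarged ball \<open>?C\<close>.\<close>
    define d' where "d' = min d 1 / 2"
    have d': "0 < d'" "d' < d" "d' < 1" using d by (auto simp: d'_def)
    have close: "\<bar>f y - f (w *\<^sub>R e)\<bar> \<le> r / 4" if "\<bar>w\<bar> \<le> K" "norm (y - w *\<^sub>R e) \<le> d'" for y w
    proof -
      have "norm (w *\<^sub>R e) \<le> \<bar>K\<bar> * norm e"
        using that by (auto intro!: mult_right_mono)
      moreover have "norm y \<le> norm (w *\<^sub>R e) + norm (y - w *\<^sub>R e)"
        using norm_triangle_ineq[of "w *\<^sub>R e" "y - w *\<^sub>R e"] by simp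
      ultimately have "y \<in> ?C" "w *\<^sub>R e \<in> ?C"
        using that d' by auto
      then show ?thesis using d(2)[of "w *\<^sub>R e" y] that d' by (simp add: dist_norm)
    qed
    from K conv_probD[OF YW d'(1) \<open>0 < \<eta>\<close>]
    have "\<forall>\<^sub>F n in sequentially.
      norm (expectation (\<lambda>\<omega>. f (Y n \<omega>)) - expectation (\<lambda>\<omega>. f (W n \<omega> *\<^sub>R e)) - 0) < r"
    proof eventually_elim
      case (elim n)
      let ?A = "{\<omega>\<in>space M. K < \<bar>W n \<omega>\<bar>}"
      let ?D = "{\<omega>\<in>space M. d' < \<bar>norm (Y n \<omega> - W n \<omega> *\<^sub>R e) - 0\<bar>}"
      have [measurable]: "?A \<in> events" "?D \<in> events" by measurable
      have "\<bar>expectation (\<lambda>\<omega>. f (Y n \<omega>)) - expectation (\<lambda>\<omega>. f (W n \<omega> *\<^sub>R e))\<bar>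
          = \<bar>expectation (\<lambda>\<omega>. f (Y n \<omega>) - f (W n \<omega> *\<^sub>R e))\<bar>"
        using int by simp
      also have "\<dots> \<le> expectation (\<lambda>\<omega>. \<bar>f (Y n \<omega>) - f (W n \<omega> *\<^sub>R e)\<bar>)"
        by (rule integral_abs_bound)
      also have "\<dots> \<le> expectation (\<lambda>\<omega>. r / 4 + 2 * B * indicator ?A \<omega> + 2 * B * indicator ?D \<omega>)"
      proof (intro integral_mono)
        fix \<omega> assume \<omega>: "\<omega> \<in> space M"
        have "\<bar>f (Y n \<omega>) - f (W n \<omega> *\<^sub>R e)\<bar> \<le> 2 * B"
          using B(2)[of "Y n \<omega>"] B(2)[of "W n \<omega> *\<^sub>R e"] by linarith
        then show "\<bar>f (Y n \<omega>) - f (W n \<omega> *\<^sub>R e)\<bar> \<le> r / 4 + 2 * B * indicator ?A \<omega> + 2 * B * indicator ?D \<omega>"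
          using close[of "W n \<omega>" "Y n \<omega>"] B(1) \<open>0 < r\<close> \<omega> by (auto simp: indicator_def)
      qed (use int in \<open>auto simp: less_top[symmetric]\<close>)
      also have "\<dots> = r / 4 + 2 * B * prob ?A + 2 * B * prob ?D"
        by (simp add: prob_space less_top[symmetric])
      also have "\<dots> < r / 4 + 2 * B * \<eta> + 2 * B * \<eta>"
        using elim B(1) by (intro add_strict_mono add_strict_left_mono mult_strict_left_mono) auto
      also have "\<dots> < r" using B \<open>0 < r\<close> by (simp add: \<eta>_def field_simps)
      finally show ?case by simp
    qed
    then show "\<exists>no. \<forall>n\<ge>no. norm (expectation (\<lambda>\<omega>. f (Y n \<omega>)) - expectation (\<lambda>\<omega>. f (W n \<omega> *\<^sub>R e)) - 0) < r"
      by (simp add: eventually_sequentially)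
  qed
  from tendsto_add[OF this lim] show ?thesis by simp
qed

text \<open>
  Independent centred variables are orthogonal, so second moments add up.
\<close>

lemma centered_sum_second_moment:
  fixes y :: "nat \<Rightarrow> 'a \<Rightarrow> real"
  assumes ind: "indep_vars (\<lambda>_. borel) y UNIV"
    and int: "\<And>i. integrable M (\<lambda>\<omega>. (y i \<omega>)\<^sup>2)"
    and mean: "\<And>i. expectation (y i) = 0" and C: "\<And>i. expectation (\<lambda>\<omega>. (y i \<omega>)\<^sup>2) \<le> C"
  shows "integrable M (\<lambda>\<omega>. (\<Sum>i<n. y i \<omega>)\<^sup>2)"
    and "expectation (\<lambda>\<omega>. (\<Sum>i<n. y i \<omega>)\<^sup>2) \<le> n * C"
proof -
  have [measurable]: "y i \<in> borel_measurable M" for i using ind by (auto simp: indep_vars_def)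
  have int1: "integrable M (y i)" for i
    using square_integrable_imp_integrable[OF _ int] by simp
  have prod_int: "integrable M (\<lambda>\<omega>. y i \<omega> * y k \<omega>)" if "i \<noteq> k" for i k
    using indep_vars_integrable[OF _ indep_vars_subset[OF ind], of "{i, k}"] int1 that by simp
  have prod_0: "expectation (\<lambda>\<omega>. y i \<omega> * y k \<omega>) = 0" if "i \<noteq> k" for i k
    using indep_vars_lebesgue_integral[OF _ indep_vars_subset[OF ind], of "{i, k}"] int1 that
    by (simp add: mean)
  have "integrable M (\<lambda>\<omega>. (\<Sum>i<n. y i \<omega>)\<^sup>2) \<and> expectation (\<lambda>\<omega>. (\<Sum>i<n. y i \<omega>)\<^sup>2) \<le> n * C"
  proof (induction n)
    case (Suc n)
    have eq: "(\<lambda>\<omega>. (\<Sum>i<Suc n. y i \<omega>)\<^sup>2)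
      = (\<lambda>\<omega>. (\<Sum>i<n. y i \<omega>)\<^sup>2 + 2 * (\<Sum>i<n. y i \<omega> * y n \<omega>) + (y n \<omega>)\<^sup>2)"
      by (auto simp: power2_sum sum_distrib_right)
    have "integrable M (\<lambda>\<omega>. \<Sum>i<n. y i \<omega> * y n \<omega>)"
      by (intro Bochner_Integration.integrable_sum prod_int) auto
    moreover have "expectation (\<lambda>\<omega>. \<Sum>i<n. y i \<omega> * y n \<omega>) = 0"
      by (subst Bochner_Integration.integral_sum) (auto intro!: prod_int sum.neutral prod_0)
    ultimately show ?case
      unfolding eq using Suc int[of n] C[of n] by (auto simp: algebra_simps)
  qed simp
  then show "integrable M (\<lambda>\<omega>. (\<Sum>i<n. y i \<omega>)\<^sup>2)"
    and "expectation (\<lambda>\<omega>. (\<Sum>i<n. y i \<omega>)\<^sup>2) \<le> n * C" by auto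
qed

end

section \<open>Weighted sums of products of consecutive noise variables\<close>

lemma norm_iexp_diff_le: "cmod (iexp a - iexp b) \<le> \<bar>a - b\<bar>"
proof -
  have "iexp a - iexp b = iexp b * (iexp (a - b) - 1)"
    by (simp add: algebra_simps flip: exp_add)
  then have "cmod (iexp a - iexp b) = cmod (iexp (a - b) - 1)"
    by (simp add: norm_mult)
  also have "\<dots> \<le> \<bar>a - b\<bar>" using iexp_approx1[of "a - b" 0] by simp
  finally show ?thesis .
qed

text \<open>
  Independent centred variables \<open>m i\<close> with common variance and bounded third absolute moments.  The
  moment bound is put on \<open>(1 + \<bar>m i\<bar>) ^ 3\<close> because this single quantity dominates every power of
  \<open>\<bar>m i\<bar>\<close> up to the third, so that all integrability questions below reduce to it.
\<close>

locale noise = prob_space M for M :: "'a measure" +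
  fixes m :: "nat \<Rightarrow> 'a \<Rightarrow> real" and s2 H :: real
  assumes indep: "indep_vars (\<lambda>_. borel) m UNIV"
    and mean: "expectation (m i) = 0"
    and var: "expectation (\<lambda>\<omega>. (m i \<omega>)\<^sup>2) = s2"
    and int3: "integrable M (\<lambda>\<omega>. (1 + \<bar>m i \<omega>\<bar>) ^ 3)"
    and third: "expectation (\<lambda>\<omega>. (1 + \<bar>m i \<omega>\<bar>) ^ 3) \<le> H"
begin

lemma noise_measurable [measurable]: "m i \<in> borel_measurable M"
  using indep by (auto simp: indep_vars_def)

text \<open>
  The only way in which independence enters the limit theorem: a variable \<open>m k\<close> is independent of
  every functional of the earlier \<open>m 0, \<dots>, m j\<close>.
\<close>

lemma
  fixes f :: "(nat \<Rightarrow> real) \<Rightarrow> 'b::{real_normed_field, banach, second_countable_topology}"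
    and g :: "real \<Rightarrow> 'b"
  assumes f: "f \<in> borel_measurable (PiM {..j} (\<lambda>_. borel))"
    and g: "g \<in> borel_measurable borel"
    and F: "\<And>\<omega>. F \<omega> = f (\<lambda>i\<in>{..j}. m i \<omega>)" and "j < k"
    and int: "integrable M F" "integrable M (\<lambda>\<omega>. g (m k \<omega>))"
  shows expectation_past_future:
      "expectation (\<lambda>\<omega>. F \<omega> * g (m k \<omega>)) = expectation F * expectation (\<lambda>\<omega>. g (m k \<omega>))"
    and integrable_past_future: "integrable M (\<lambda>\<omega>. F \<omega> * g (m k \<omega>))"
proof -
  have "indep_var (PiM {..j} (\<lambda>_. borel)) (\<lambda>\<omega>. \<lambda>i\<in>{..j}. m i \<omega>)
      (PiM {k} (\<lambda>_. borel)) (\<lambda>\<omega>. \<lambda>i\<in>{k}. m i \<omega>)"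
    by (rule indep_var_restrict[OF indep]) (use \<open>j < k\<close> in auto)
  then have "indep_var borel (f \<circ> (\<lambda>\<omega>. \<lambda>i\<in>{..j}. m i \<omega>))
      borel ((\<lambda>z. g (z k)) \<circ> (\<lambda>\<omega>. \<lambda>i\<in>{k}. m i \<omega>))"
    by (rule indep_var_compose) (use f g in measurable)
  moreover have "f \<circ> (\<lambda>\<omega>. \<lambda>i\<in>{..j}. m i \<omega>) = F" by (auto simp: F)
  moreover have "(\<lambda>z. g (z k)) \<circ> (\<lambda>\<omega>. \<lambda>i\<in>{k}. m i \<omega>) = (\<lambda>\<omega>. g (m k \<omega>))" by auto
  ultimately have ind: "indep_var borel F borel (\<lambda>\<omega>. g (m k \<omega>))" by simp
  show "expectation (\<lambda>\<omega>. F \<omega> * g (m k \<omega>)) = expectation F * expectation (\<lambda>\<omega>. g (m k \<omega>))"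
    by (rule indep_var_lebesgue_integral[OF ind int])
  show "integrable M (\<lambda>\<omega>. F \<omega> * g (m k \<omega>))"
    by (rule indep_var_integrable[OF ind int])
qed

lemma
  fixes F :: "'a \<Rightarrow> 'b::{banach, second_countable_topology}"
  assumes [measurable]: "F \<in> borel_measurable M"
    and F: "\<And>\<omega>. norm (F \<omega>) \<le> C * (1 + \<bar>m i \<omega>\<bar>) ^ 3" and "0 \<le> C"
  shows integrable_dominated1: "integrable M F"
    and expectation_dominated1: "norm (expectation F) \<le> C * H"
proof -
  have int: "integrable M (\<lambda>\<omega>. C * (1 + \<bar>m i \<omega>\<bar>) ^ 3)" using int3 by simp
  show I: "integrable M F"
    by (rule Bochner_Integration.integrable_bound[OF int])
       (auto intro!: order_trans[OF F] simp: \<open>0 \<le> C\<close>)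
  have "norm (expectation F) \<le> expectation (\<lambda>\<omega>. C * (1 + \<bar>m i \<omega>\<bar>) ^ 3)"
    by (rule order_trans[OF integral_norm_bound integral_mono]) (use I int F in auto)
  also have "\<dots> \<le> C * H" using third \<open>0 \<le> C\<close> int3 by (auto intro: mult_left_mono)
  finally show "norm (expectation F) \<le> C * H" .
qed

lemma H_ge_1: "1 \<le> H"
  using expectation_dominated1[of "\<lambda>_. 1 :: real" 1 0] by (simp add: prob_space one_le_power)

lemma
  fixes F :: "'a \<Rightarrow> 'b::{banach, second_countable_topology}"
  assumes [measurable]: "F \<in> borel_measurable M"
    and F: "\<And>\<omega>. norm (F \<omega>) \<le> C * ((1 + \<bar>m i \<omega>\<bar>) ^ 3 * (1 + \<bar>m k \<omega>\<bar>) ^ 3)" and "0 \<le> C" "i < k"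
  shows integrable_dominated2: "integrable M F"
    and expectation_dominated2: "norm (expectation F) \<le> C * H\<^sup>2"
proof -
  have
    eq: "expectation (\<lambda>\<omega>. (1 + \<bar>m i \<omega>\<bar>) ^ 3 * (1 + \<bar>m k \<omega>\<bar>) ^ 3)
      = expectation (\<lambda>\<omega>. (1 + \<bar>m i \<omega>\<bar>) ^ 3) * expectation (\<lambda>\<omega>. (1 + \<bar>m k \<omega>\<bar>) ^ 3)"
    and int0: "integrable M (\<lambda>\<omega>. (1 + \<bar>m i \<omega>\<bar>) ^ 3 * (1 + \<bar>m k \<omega>\<bar>) ^ 3)"
    using expectation_past_future[of "\<lambda>z. (1 + \<bar>z i\<bar>) ^ 3" i "\<lambda>y. (1 + \<bar>y\<bar>) ^ 3" "\<lambda>\<omega>. (1 + \<bar>m i \<omega>\<bar>) ^ 3" k]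
      integrable_past_future[of "\<lambda>z. (1 + \<bar>z i\<bar>) ^ 3" i "\<lambda>y. (1 + \<bar>y\<bar>) ^ 3" "\<lambda>\<omega>. (1 + \<bar>m i \<omega>\<bar>) ^ 3" k]
      int3 \<open>i < k\<close> by auto
  have int: "integrable M (\<lambda>\<omega>. C * ((1 + \<bar>m i \<omega>\<bar>) ^ 3 * (1 + \<bar>m k \<omega>\<bar>) ^ 3))"
    using int0 by simp
  show I: "integrable M F"
    by (rule Bochner_Integration.integrable_bound[OF int])
       (auto intro!: order_trans[OF F] simp: \<open>0 \<le> C\<close>)
  have "norm (expectation F) \<le> expectation (\<lambda>\<omega>. C * ((1 + \<bar>m i \<omega>\<bar>) ^ 3 * (1 + \<bar>m k \<omega>\<bar>) ^ 3))"
    by (rule order_trans[OF integral_norm_bound integral_mono]) (use I int F in auto)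
  also have "\<dots> = C * (expectation (\<lambda>\<omega>. (1 + \<bar>m i \<omega>\<bar>) ^ 3) * expectation (\<lambda>\<omega>. (1 + \<bar>m k \<omega>\<bar>) ^ 3))"
    by (simp add: eq)
  also have "\<dots> \<le> C * (H * H)"
    using third H_ge_1 \<open>0 \<le> C\<close> by (intro mult_left_mono mult_mono) (auto intro!: integral_nonneg)
  finally show "norm (expectation F) \<le> C * H\<^sup>2" by (simp add: power2_eq_square)
qed

lemma integrable_noise: "integrable M (m i)"
  and integrable_noise_sq: "integrable M (\<lambda>\<omega>. (m i \<omega>)\<^sup>2)"
proof -
  have 1: "\<bar>x\<bar> \<le> (1 + \<bar>x\<bar>) ^ 3" for x :: real
    using power_increasing[of 1 3 "1 + \<bar>x\<bar>"] by simp
  have 2: "x\<^sup>2 \<le> (1 + \<bar>x\<bar>) ^ 3" for x :: real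
  proof -
    have "x\<^sup>2 = \<bar>x\<bar>\<^sup>2" by simp
    also have "\<dots> \<le> (1 + \<bar>x\<bar>)\<^sup>2" by (intro power_mono) auto
    also have "\<dots> \<le> (1 + \<bar>x\<bar>) ^ 3" by (intro power_increasing) auto
    finally show ?thesis .
  qed
  show "integrable M (m i)" by (rule integrable_dominated1[where C=1 and i=i]) (use 1 in auto)
  show "integrable M (\<lambda>\<omega>. (m i \<omega>)\<^sup>2)" by (rule integrable_dominated1[where C=1 and i=i]) (use 2 in auto)
qed

lemma s2_nonneg: "0 \<le> s2"
  unfolding var[symmetric, of 0] by simp

text \<open>
  The summands \<open>(c i + d m\<^sub>i) m\<^sub>i\<^sub>+\<^sub>1\<close> form a martingale difference sequence whose conditional
  variance \<open>s2 (c i + d m\<^sub>i)\<^sup>2\<close> is random; it averages out because \<open>m\<^sub>i\<close> is again independent of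
  the sum of all but the last of the preceding summands.
\<close>

definition summand :: "(nat \<Rightarrow> real) \<Rightarrow> real \<Rightarrow> nat \<Rightarrow> 'a \<Rightarrow> real" where
  "summand c d i \<omega> = (c i + d * m i \<omega>) * m (Suc i) \<omega>"

lemma summand_measurable [measurable]: "summand c d i \<in> borel_measurable M"
  unfolding summand_def by measurable

definition psum :: "(nat \<Rightarrow> real) \<Rightarrow> real \<Rightarrow> nat \<Rightarrow> 'a \<Rightarrow> real" where
  "psum c d j \<omega> = (\<Sum>i<j. summand c d i \<omega>)"

lemma psum_measurable [measurable]: "psum c d i \<in> borel_measurable M"
  unfolding psum_def by measurable

text \<open>
  Exhibits \<open>iexp (\<eta> S\<^sub>j) q (m\<^sub>k)\<close>, where \<open>S\<^sub>j\<close> is the partial sum, as a measurable functional of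
  \<open>m 0, \<dots>, m k\<close>, which is what the independence lemma asks for.
\<close>

lemma past_iexp_psum:
  assumes [measurable]: "q \<in> borel_measurable borel" and "j \<le> k"
  shows "(\<lambda>z. iexp (\<eta> * (\<Sum>i<j. (c i + d * z i) * z (Suc i))) * complex_of_real (q (z k)))
      \<in> borel_measurable (PiM {..k} (\<lambda>_. borel :: real measure))"
    and "iexp (\<eta> * psum c d j \<omega>) * complex_of_real (q (m k \<omega>))
      = (\<lambda>z. iexp (\<eta> * (\<Sum>i<j. (c i + d * z i) * z (Suc i))) * complex_of_real (q (z k))) (\<lambda>i\<in>{..k}. m i \<omega>)"
proof -
  have [measurable]: "(\<lambda>z. \<Sum>i<j. (c i + d * z i) * z (Suc i)) \<in> borel_measurable (PiM {..k} (\<lambda>_. borel :: real measure))"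
    by (intro borel_measurable_sum borel_measurable_times borel_measurable_add borel_measurable_const
        measurable_component_singleton) (use \<open>j \<le> k\<close> in auto)
  have [measurable]: "(\<lambda>z. z k) \<in> borel_measurable (PiM {..k} (\<lambda>_. borel :: real measure))"
    by (intro measurable_component_singleton) auto
  show "(\<lambda>z. iexp (\<eta> * (\<Sum>i<j. (c i + d * z i) * z (Suc i))) * complex_of_real (q (z k)))
      \<in> borel_measurable (PiM {..k} (\<lambda>_. borel :: real measure))"
    by measurable
  show "iexp (\<eta> * psum c d j \<omega>) * complex_of_real (q (m k \<omega>))
      = (\<lambda>z. iexp (\<eta> * (\<Sum>i<j. (c i + d * z i) * z (Suc i))) * complex_of_real (q (z k))) (\<lambda>i\<in>{..k}. m i \<omega>)"
    using \<open>j \<le> k\<close> by (simp add: psum_def summand_def)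
qed

context
  fixes c :: "nat \<Rightarrow> real" and d K :: real
  assumes cK: "\<And>i. \<bar>c i\<bar> \<le> K" and dK: "\<bar>d\<bar> \<le> K"
begin

lemma K_nonneg: "0 \<le> K" using dK by linarith

lemma weight_bound: "\<bar>c i + d * m i \<omega>\<bar> \<le> K * (1 + \<bar>m i \<omega>\<bar>)"
proof -
  have "\<bar>c i + d * m i \<omega>\<bar> \<le> \<bar>c i\<bar> + \<bar>d\<bar> * \<bar>m i \<omega>\<bar>" by (simp flip: abs_mult)
  also have "\<dots> \<le> K + K * \<bar>m i \<omega>\<bar>" by (intro add_mono mult_right_mono cK dK) auto
  finally show ?thesis by (simp add: algebra_simps)
qed

lemma weight_sq_bound: "(c i + d * m i \<omega>)\<^sup>2 \<le> K\<^sup>2 * (1 + \<bar>m i \<omega>\<bar>)\<^sup>2"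
  using power_mono[OF weight_bound[of i \<omega>], of 2] by (simp add: power_mult_distrib)

lemma summand_bound: "\<bar>summand c d i \<omega>\<bar> \<le> K * ((1 + \<bar>m i \<omega>\<bar>) * (1 + \<bar>m (Suc i) \<omega>\<bar>))"
proof -
  have "\<bar>summand c d i \<omega>\<bar> \<le> K * (1 + \<bar>m i \<omega>\<bar>) * (1 + \<bar>m (Suc i) \<omega>\<bar>)"
    unfolding summand_def abs_mult by (intro mult_mono weight_bound) (auto simp: K_nonneg)
  then show ?thesis by (simp add: mult.assoc)
qed

lemma expectation_weight_sq:
  shows "integrable M (\<lambda>\<omega>. (c i + d * m i \<omega>)\<^sup>2)"
    and "expectation (\<lambda>\<omega>. (c i + d * m i \<omega>)\<^sup>2) = (c i)\<^sup>2 + d\<^sup>2 * s2"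
    and "(c i)\<^sup>2 + d\<^sup>2 * s2 \<le> K\<^sup>2 * H"
proof -
  have eq: "(\<lambda>\<omega>. (c i + d * m i \<omega>)\<^sup>2) = (\<lambda>\<omega>. (c i)\<^sup>2 + 2 * c i * d * m i \<omega> + d\<^sup>2 * (m i \<omega>)\<^sup>2)"
    by (auto simp: power2_eq_square algebra_simps)
  show "integrable M (\<lambda>\<omega>. (c i + d * m i \<omega>)\<^sup>2)"
    unfolding eq using integrable_noise integrable_noise_sq by simp
  show *: "expectation (\<lambda>\<omega>. (c i + d * m i \<omega>)\<^sup>2) = (c i)\<^sup>2 + d\<^sup>2 * s2"
    unfolding eq using integrable_noise integrable_noise_sq by (simp add: prob_space mean var)
  have "norm (expectation (\<lambda>\<omega>. (c i + d * m i \<omega>)\<^sup>2)) \<le> K\<^sup>2 * H"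
  proof (rule expectation_dominated1)
    fix \<omega>
    have "norm ((c i + d * m i \<omega>)\<^sup>2) \<le> K\<^sup>2 * (1 + \<bar>m i \<omega>\<bar>)\<^sup>2"
      using weight_sq_bound by simp
    also have "\<dots> \<le> K\<^sup>2 * (1 + \<bar>m i \<omega>\<bar>) ^ 3"
      by (intro mult_left_mono power_increasing) auto
    finally show "norm ((c i + d * m i \<omega>)\<^sup>2) \<le> K\<^sup>2 * (1 + \<bar>m i \<omega>\<bar>) ^ 3" .
  qed auto
  then show "(c i)\<^sup>2 + d\<^sup>2 * s2 \<le> K\<^sup>2 * H" unfolding * by simp
qed

text \<open>
  The partial sum \<open>S\<^sub>j\<close> and the weight \<open>c j + d m\<^sub>j\<close> both depend on \<open>m\<^sub>j\<close>, hence are not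
  independent.  Replacing \<open>S\<^sub>j\<close> by \<open>S\<^sub>j\<^sub>-\<^sub>1\<close> restores independence and changes the exponential by at
  most \<open>\<bar>\<eta>\<bar>\<close> times one summand, so the expectation factorises up to an error of order \<open>\<bar>\<eta>\<bar>\<close>.
\<close>

lemma iexp_psum_weight_sq:
  "cmod (expectation (\<lambda>\<omega>. iexp (\<eta> * psum c d j \<omega>) * complex_of_real ((c j + d * m j \<omega>)\<^sup>2))
      - expectation (\<lambda>\<omega>. iexp (\<eta> * psum c d j \<omega>)) * complex_of_real ((c j)\<^sup>2 + d\<^sup>2 * s2))
    \<le> \<bar>\<eta>\<bar> * (K ^ 3 * (1 + H) * H\<^sup>2)"
proof -
  define v where "v = (c j)\<^sup>2 + d\<^sup>2 * s2"
  \<comment> \<open>The centred squared weight: the quantity to be estimated is \<open>E (iexp (\<eta> S\<^sub>j) q (m\<^sub>j))\<close>.\<close>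
  define q where "q = (\<lambda>y. (c j + d * y)\<^sup>2 - v)"
  have [measurable]: "q \<in> borel_measurable borel" by (simp add: q_def)
  have q_int: "integrable M (\<lambda>\<omega>. q (m j \<omega>))"
    unfolding q_def using expectation_weight_sq(1) by simp
  have q_mean: "expectation (\<lambda>\<omega>. q (m j \<omega>)) = 0"
    unfolding q_def v_def using expectation_weight_sq(1,2) by (simp add: prob_space)
  have v: "0 \<le> v" "v \<le> K\<^sup>2 * H"
    using s2_nonneg expectation_weight_sq(3) by (auto simp: v_def)
  have q_bound: "\<bar>q (m j \<omega>)\<bar> \<le> K\<^sup>2 * (1 + H) * (1 + \<bar>m j \<omega>\<bar>)\<^sup>2" for \<omega>
  proof -
    have "\<bar>q (m j \<omega>)\<bar> \<le> (c j + d * m j \<omega>)\<^sup>2 + v"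
      unfolding q_def using v(1) by (simp add: abs_le_iff)
    also have "\<dots> \<le> K\<^sup>2 * (1 + \<bar>m j \<omega>\<bar>)\<^sup>2 + K\<^sup>2 * H * (1 + \<bar>m j \<omega>\<bar>)\<^sup>2"
      using v(2) H_ge_1 mult_left_mono[of 1 "(1 + \<bar>m j \<omega>\<bar>)\<^sup>2" "K\<^sup>2 * H"]
      by (intro add_mono weight_sq_bound) (auto simp: one_le_power)
    finally show ?thesis by (simp add: algebra_simps)
  qed
  have int_iexp: "integrable M (\<lambda>\<omega>. iexp (\<eta> * psum c d j \<omega>))" for j
    by (rule integrable_const_bound[where B=1]) auto
  have int_q: "integrable M (\<lambda>\<omega>. iexp (\<eta> * psum c d i \<omega>) * complex_of_real (q (m j \<omega>)))" for i
    by (rule Bochner_Integration.integrable_bound[OF q_int]) (auto simp: norm_mult)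
  have int_w: "integrable M (\<lambda>\<omega>. iexp (\<eta> * psum c d j \<omega>) * complex_of_real ((c j + d * m j \<omega>)\<^sup>2))"
    by (rule Bochner_Integration.integrable_bound[OF expectation_weight_sq(1)[of j]])
       (auto simp: norm_mult simp del: of_real_power of_real_add of_real_mult)
  have "expectation (\<lambda>\<omega>. iexp (\<eta> * psum c d j \<omega>) * complex_of_real ((c j + d * m j \<omega>)\<^sup>2))
      - expectation (\<lambda>\<omega>. iexp (\<eta> * psum c d j \<omega>)) * complex_of_real v
    = expectation (\<lambda>\<omega>. iexp (\<eta> * psum c d j \<omega>) * complex_of_real ((c j + d * m j \<omega>)\<^sup>2)
      - iexp (\<eta> * psum c d j \<omega>) * complex_of_real v)"
    using int_w int_iexp by simp
  also have "\<dots> = expectation (\<lambda>\<omega>. iexp (\<eta> * psum c d j \<omega>) * complex_of_real (q (m j \<omega>)))"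
    by (simp add: q_def algebra_simps)
  finally have eq: "expectation (\<lambda>\<omega>. iexp (\<eta> * psum c d j \<omega>) * complex_of_real ((c j + d * m j \<omega>)\<^sup>2))
      - expectation (\<lambda>\<omega>. iexp (\<eta> * psum c d j \<omega>)) * complex_of_real v
    = expectation (\<lambda>\<omega>. iexp (\<eta> * psum c d j \<omega>) * complex_of_real (q (m j \<omega>)))" .
  have "cmod (expectation (\<lambda>\<omega>. iexp (\<eta> * psum c d j \<omega>) * complex_of_real (q (m j \<omega>))))
    \<le> \<bar>\<eta>\<bar> * (K ^ 3 * (1 + H) * H\<^sup>2)"
  proof (cases j)
    case 0
    then have "expectation (\<lambda>\<omega>. iexp (\<eta> * psum c d j \<omega>) * complex_of_real (q (m j \<omega>))) = 0"
      using q_mean by (simp add: psum_def)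
    then show ?thesis using K_nonneg H_ge_1 by simp
  next
    case (Suc i)
    have past: "(\<lambda>z. iexp (\<eta> * (\<Sum>l<i. (c l + d * z l) * z (Suc l))))
        \<in> borel_measurable (PiM {..i} (\<lambda>_. borel :: real measure))"
      "iexp (\<eta> * psum c d i \<omega>) = (\<lambda>z. iexp (\<eta> * (\<Sum>l<i. (c l + d * z l) * z (Suc l)))) (\<lambda>l\<in>{..i}. m l \<omega>)" for \<omega>
      using past_iexp_psum[of "\<lambda>_. 1" i i \<eta> c d] by (simp_all only: of_real_1 mult_1_right borel_measurable_const order_refl)
    have g: "integrable M (\<lambda>\<omega>. complex_of_real (q (m j \<omega>)))" "i < j"
      using q_int Suc by simp_all
    have "expectation (\<lambda>\<omega>. iexp (\<eta> * psum c d i \<omega>) * complex_of_real (q (m j \<omega>)))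
      = expectation (\<lambda>\<omega>. iexp (\<eta> * psum c d i \<omega>)) * expectation (\<lambda>\<omega>. complex_of_real (q (m j \<omega>)))"
      by (rule expectation_past_future[where g = "\<lambda>y. complex_of_real (q y)", OF past(1) _ past(2) g(2) int_iexp g(1)])
         measurable
    also have "\<dots> = 0" using q_mean by simp
    finally have "expectation (\<lambda>\<omega>. iexp (\<eta> * psum c d j \<omega>) * complex_of_real (q (m j \<omega>)))
      = expectation (\<lambda>\<omega>. iexp (\<eta> * psum c d j \<omega>) * complex_of_real (q (m j \<omega>))
          - iexp (\<eta> * psum c d i \<omega>) * complex_of_real (q (m j \<omega>)))"
      using int_q by simp
    also have "cmod \<dots> \<le> \<bar>\<eta>\<bar> * (K ^ 3 * (1 + H)) * H\<^sup>2"
    proof (rule expectation_dominated2)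
      fix \<omega>
      have "cmod (iexp (\<eta> * psum c d j \<omega>) * complex_of_real (q (m j \<omega>))
          - iexp (\<eta> * psum c d i \<omega>) * complex_of_real (q (m j \<omega>)))
        = cmod (iexp (\<eta> * psum c d j \<omega>) - iexp (\<eta> * psum c d i \<omega>)) * \<bar>q (m j \<omega>)\<bar>"
        by (metis left_diff_distrib norm_mult norm_of_real)
      also have "\<dots> \<le> \<bar>\<eta> * psum c d j \<omega> - \<eta> * psum c d i \<omega>\<bar> * \<bar>q (m j \<omega>)\<bar>"
        by (intro mult_right_mono norm_iexp_diff_le) auto
      also have "\<eta> * psum c d j \<omega> - \<eta> * psum c d i \<omega> = \<eta> * summand c d i \<omega>"
        by (simp add: psum_def Suc algebra_simps)
      also have "\<bar>\<eta> * summand c d i \<omega>\<bar> * \<bar>q (m j \<omega>)\<bar>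
        \<le> (\<bar>\<eta>\<bar> * (K * ((1 + \<bar>m i \<omega>\<bar>) * (1 + \<bar>m j \<omega>\<bar>)))) * (K\<^sup>2 * (1 + H) * (1 + \<bar>m j \<omega>\<bar>)\<^sup>2)"
        unfolding abs_mult Suc using K_nonneg
        by (intro mult_mono mult_left_mono summand_bound q_bound[unfolded Suc]) auto
      also have "\<dots> = \<bar>\<eta>\<bar> * (K ^ 3 * (1 + H)) * ((1 + \<bar>m i \<omega>\<bar>) ^ 1 * (1 + \<bar>m j \<omega>\<bar>) ^ 3)"
        by (simp add: power2_eq_square power3_eq_cube)
      also have "\<dots> \<le> \<bar>\<eta>\<bar> * (K ^ 3 * (1 + H)) * ((1 + \<bar>m i \<omega>\<bar>) ^ 3 * (1 + \<bar>m j \<omega>\<bar>) ^ 3)"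
        using K_nonneg H_ge_1 by (intro mult_left_mono mult_right_mono power_increasing) auto
      finally show "cmod (iexp (\<eta> * psum c d j \<omega>) * complex_of_real (q (m j \<omega>))
          - iexp (\<eta> * psum c d i \<omega>) * complex_of_real (q (m j \<omega>)))
        \<le> \<bar>\<eta>\<bar> * (K ^ 3 * (1 + H)) * ((1 + \<bar>m i \<omega>\<bar>) ^ 3 * (1 + \<bar>m j \<omega>\<bar>) ^ 3)" .
    qed (use K_nonneg H_ge_1 Suc in auto)
    finally show ?thesis by (simp add: mult.assoc)
  qed
  then show ?thesis unfolding v_def[symmetric] eq .
qed

text \<open>
  One step of the characteristic function.  In the second order Taylor expansion of the new factor
  \<open>iexp (\<eta> x\<^sub>j)\<close> the linear term has mean zero because \<open>m\<^sub>j\<^sub>+\<^sub>1\<close> is centred and independent of the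
  past, the quadratic term is \<open>- \<eta>\<^sup>2 / 2\<close> times \<open>s2\<close> times the expectation treated above, and the remainder is
  controlled by third moments.  The error is of order \<open>\<bar>\<eta>\<bar>\<^sup>3\<close>; with \<open>\<eta>\<close> proportional to \<open>1 / \<surd>n\<close>
  it is still negligible after \<open>n\<close> steps.
\<close>

lemma char_psum_step:
  "cmod (expectation (\<lambda>\<omega>. iexp (\<eta> * psum c d (Suc j) \<omega>))
      - (1 - \<eta>\<^sup>2 * s2 * ((c j)\<^sup>2 + d\<^sup>2 * s2) / 2) * expectation (\<lambda>\<omega>. iexp (\<eta> * psum c d j \<omega>)))
    \<le> \<bar>\<eta>\<bar> ^ 3 * (K ^ 3 * H\<^sup>2 + s2 * (K ^ 3 * (1 + H) * H\<^sup>2))"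
proof -
  define v where "v = (c j)\<^sup>2 + d\<^sup>2 * s2"
  let ?E = "\<lambda>\<omega>. iexp (\<eta> * psum c d j \<omega>)"
  let ?x = "summand c d j"
  let ?w = "\<lambda>\<omega>. c j + d * m j \<omega>"
  let ?T = "\<lambda>y. \<Sum>k\<le>2. (\<i> * complex_of_real y) ^ k / fact k"
  let ?R = "\<lambda>\<omega>. ?E \<omega> * (iexp (\<eta> * ?x \<omega>) - ?T (\<eta> * ?x \<omega>))"
  have x_bound: "\<bar>?x \<omega>\<bar> ^ 3 \<le> K ^ 3 * ((1 + \<bar>m j \<omega>\<bar>) ^ 3 * (1 + \<bar>m (Suc j) \<omega>\<bar>) ^ 3)" for \<omega>
    using power_mono[OF summand_bound[of j \<omega>], of 3] by (simp add: power_mult_distrib)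
  have R_bound: "cmod (?R \<omega>) \<le> \<bar>\<eta>\<bar> ^ 3 * K ^ 3 * ((1 + \<bar>m j \<omega>\<bar>) ^ 3 * (1 + \<bar>m (Suc j) \<omega>\<bar>) ^ 3)" for \<omega>
  proof -
    have "cmod (?R \<omega>) = cmod (iexp (\<eta> * ?x \<omega>) - ?T (\<eta> * ?x \<omega>))" by (simp add: norm_mult)
    also have "\<dots> \<le> \<bar>\<eta> * ?x \<omega>\<bar> ^ Suc 2 / fact (Suc 2)" by (rule iexp_approx1)
    also have "\<dots> \<le> \<bar>\<eta> * ?x \<omega>\<bar> ^ 3"
      using zero_le_power[of "\<bar>\<eta> * ?x \<omega>\<bar>" 3] by (simp add: fact_numeral numeral_3_eq_3[symmetric])
    also have "\<dots> = \<bar>\<eta>\<bar> ^ 3 * \<bar>?x \<omega>\<bar> ^ 3"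
      by (simp add: abs_mult power_mult_distrib)
    also have "\<dots> \<le> \<bar>\<eta>\<bar> ^ 3 * (K ^ 3 * ((1 + \<bar>m j \<omega>\<bar>) ^ 3 * (1 + \<bar>m (Suc j) \<omega>\<bar>) ^ 3))"
      by (intro mult_left_mono x_bound) auto
    finally show ?thesis by (simp add: mult.assoc)
  qed
  have R_meas [measurable]: "?R \<in> borel_measurable M" by measurable
  have R_int: "integrable M ?R"
    by (rule integrable_dominated2[OF R_meas R_bound]) (use K_nonneg in auto)
  have R_exp: "cmod (expectation ?R) \<le> \<bar>\<eta>\<bar> ^ 3 * K ^ 3 * H\<^sup>2"
    by (rule expectation_dominated2[OF R_meas R_bound]) (use K_nonneg in auto)
  have E_int: "integrable M ?E"
    by (rule integrable_const_bound[where B=1]) auto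
  have int1: "integrable M (\<lambda>\<omega>. ?E \<omega> * complex_of_real (?w \<omega>))"
    by (rule Bochner_Integration.integrable_bound[where f="\<lambda>\<omega>. c j + d * m j \<omega>"])
       (auto simp: norm_mult integrable_noise simp flip: of_real_mult of_real_add)
  have int2: "integrable M (\<lambda>\<omega>. ?E \<omega> * complex_of_real ((?w \<omega>)\<^sup>2))"
    by (rule Bochner_Integration.integrable_bound[OF expectation_weight_sq(1)[of j]])
       (auto simp: norm_mult simp del: of_real_power of_real_add of_real_mult)
  have past1: "(\<lambda>z. iexp (\<eta> * (\<Sum>i<j. (c i + d * z i) * z (Suc i))) * complex_of_real (c j + d * z j))
      \<in> borel_measurable (PiM {..j} (\<lambda>_. borel :: real measure))"
    "?E \<omega> * complex_of_real (?w \<omega>) = (\<lambda>z. iexp (\<eta> * (\<Sum>i<j. (c i + d * z i) * z (Suc i))) * complex_of_real (c j + d * z j))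
      (\<lambda>i\<in>{..j}. m i \<omega>)" for \<omega>
    by (rule past_iexp_psum[of "\<lambda>y. c j + d * y" j j \<eta> c d]; simp)+
  have past2: "(\<lambda>z. iexp (\<eta> * (\<Sum>i<j. (c i + d * z i) * z (Suc i))) * complex_of_real ((c j + d * z j)\<^sup>2))
      \<in> borel_measurable (PiM {..j} (\<lambda>_. borel :: real measure))"
    "?E \<omega> * complex_of_real ((?w \<omega>)\<^sup>2) = (\<lambda>z. iexp (\<eta> * (\<Sum>i<j. (c i + d * z i) * z (Suc i))) * complex_of_real ((c j + d * z j)\<^sup>2))
      (\<lambda>i\<in>{..j}. m i \<omega>)" for \<omega>
    by (rule past_iexp_psum[of "\<lambda>y. (c j + d * y)\<^sup>2" j j \<eta> c d]; simp)+
  have g1: "integrable M (\<lambda>\<omega>. complex_of_real (m (Suc j) \<omega>))"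
    and g2: "integrable M (\<lambda>\<omega>. complex_of_real ((m (Suc j) \<omega>)\<^sup>2))"
    using integrable_noise integrable_noise_sq by (simp_all del: of_real_power)
  have A1: "integrable M (\<lambda>\<omega>. ?E \<omega> * complex_of_real (?w \<omega>) * complex_of_real (m (Suc j) \<omega>))"
    by (rule integrable_past_future[where g = "complex_of_real", OF past1(1) _ past1(2) lessI int1 g1]) simp
  have "expectation (\<lambda>\<omega>. ?E \<omega> * complex_of_real (?w \<omega>) * complex_of_real (m (Suc j) \<omega>))
      = expectation (\<lambda>\<omega>. ?E \<omega> * complex_of_real (?w \<omega>)) * expectation (\<lambda>\<omega>. complex_of_real (m (Suc j) \<omega>))"
    by (rule expectation_past_future[where g = "complex_of_real", OF past1(1) _ past1(2) lessI int1 g1]) simp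
  then have E1: "expectation (\<lambda>\<omega>. ?E \<omega> * complex_of_real (?w \<omega>) * complex_of_real (m (Suc j) \<omega>)) = 0"
    by (simp add: mean)
  have A2: "integrable M (\<lambda>\<omega>. ?E \<omega> * complex_of_real ((?w \<omega>)\<^sup>2) * complex_of_real ((m (Suc j) \<omega>)\<^sup>2))"
    by (rule integrable_past_future[where g = "\<lambda>y. complex_of_real (y\<^sup>2)", OF past2(1) _ past2(2) lessI int2 g2]) simp
  have "expectation (\<lambda>\<omega>. ?E \<omega> * complex_of_real ((?w \<omega>)\<^sup>2) * complex_of_real ((m (Suc j) \<omega>)\<^sup>2))
      = expectation (\<lambda>\<omega>. ?E \<omega> * complex_of_real ((?w \<omega>)\<^sup>2)) * expectation (\<lambda>\<omega>. complex_of_real ((m (Suc j) \<omega>)\<^sup>2))"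
    by (rule expectation_past_future[where g = "\<lambda>y. complex_of_real (y\<^sup>2)", OF past2(1) _ past2(2) lessI int2 g2]) simp
  also have "expectation (\<lambda>\<omega>. complex_of_real ((m (Suc j) \<omega>)\<^sup>2)) = complex_of_real s2"
    unfolding integral_complex_of_real var ..
  finally have E2: "expectation (\<lambda>\<omega>. ?E \<omega> * complex_of_real ((?w \<omega>)\<^sup>2) * complex_of_real ((m (Suc j) \<omega>)\<^sup>2))
      = expectation (\<lambda>\<omega>. ?E \<omega> * complex_of_real ((?w \<omega>)\<^sup>2)) * s2" .
  have T: "?T y = 1 + \<i> * y - complex_of_real (y\<^sup>2) / 2" for y :: real
    by (simp add: eval_nat_numeral power2_eq_square algebra_simps)
  have split: "iexp (\<eta> * psum c d (Suc j) \<omega>) = ?E \<omega>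
      + \<i> * \<eta> * (?E \<omega> * complex_of_real (?w \<omega>) * complex_of_real (m (Suc j) \<omega>))
      - \<eta>\<^sup>2 / 2 * (?E \<omega> * complex_of_real ((?w \<omega>)\<^sup>2) * complex_of_real ((m (Suc j) \<omega>)\<^sup>2)) + ?R \<omega>" for \<omega>
  proof -
    have "iexp (\<eta> * psum c d (Suc j) \<omega>) = ?E \<omega> * iexp (\<eta> * ?x \<omega>)"
      by (simp add: psum_def algebra_simps flip: exp_add)
    also have "\<dots> = ?E \<omega> * ?T (\<eta> * ?x \<omega>) + ?R \<omega>" by (simp add: algebra_simps)
    also have "?E \<omega> * ?T (\<eta> * ?x \<omega>) = ?E \<omega>
      + \<i> * \<eta> * (?E \<omega> * complex_of_real (?w \<omega>) * complex_of_real (m (Suc j) \<omega>))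
      - \<eta>\<^sup>2 / 2 * (?E \<omega> * complex_of_real ((?w \<omega>)\<^sup>2) * complex_of_real ((m (Suc j) \<omega>)\<^sup>2))"
      unfolding T summand_def by (simp add: algebra_simps power2_eq_square)
    finally show ?thesis .
  qed
  define R where "R = ?R"
  define F1 where "F1 = (\<lambda>\<omega>. ?E \<omega> * complex_of_real (?w \<omega>) * complex_of_real (m (Suc j) \<omega>))"
  define F2 where "F2 = (\<lambda>\<omega>. ?E \<omega> * complex_of_real ((?w \<omega>)\<^sup>2) * complex_of_real ((m (Suc j) \<omega>)\<^sup>2))"
  define e0 where "e0 = expectation ?E"
  define e2 where "e2 = expectation (\<lambda>\<omega>. ?E \<omega> * complex_of_real ((?w \<omega>)\<^sup>2))"
  define b where "b = \<eta>\<^sup>2 / 2 * s2"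
  have cube: "\<bar>\<eta>\<bar> ^ 3 = \<eta>\<^sup>2 * \<bar>\<eta>\<bar>"
    by (simp add: power3_eq_cube power2_eq_square)
  have "0 \<le> b" using s2_nonneg by (simp add: b_def)
  have ints: "integrable M F1" "integrable M F2" "integrable M R"
    using A1 A2 R_int by (simp_all only: F1_def F2_def R_def)
  have exps: "expectation F1 = 0" "expectation F2 = e2 * s2"
    using E1 E2 by (simp_all only: F1_def F2_def e2_def)
  have R_le: "cmod (expectation R) \<le> \<bar>\<eta>\<bar> ^ 3 * K ^ 3 * H\<^sup>2"
    unfolding R_def by (rule R_exp)
  have e2_le: "cmod (e2 - e0 * v) \<le> \<bar>\<eta>\<bar> * (K ^ 3 * (1 + H) * H\<^sup>2)"
    unfolding e2_def e0_def v_def by (rule iexp_psum_weight_sq)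
  have "expectation (\<lambda>\<omega>. iexp (\<eta> * psum c d (Suc j) \<omega>))
      = expectation (\<lambda>\<omega>. ?E \<omega> + \<i> * \<eta> * F1 \<omega> - \<eta>\<^sup>2 / 2 * F2 \<omega> + R \<omega>)"
    unfolding split R_def F1_def F2_def ..
  also have "\<dots> = e0 + \<i> * \<eta> * expectation F1 - \<eta>\<^sup>2 / 2 * expectation F2 + expectation R"
    using ints E_int by (simp add: e0_def)
  also have "\<dots> = e0 - \<eta>\<^sup>2 / 2 * (e2 * s2) + expectation R"
    unfolding exps by simp
  also have "\<eta>\<^sup>2 / 2 * (e2 * s2) = b * e2" by (simp add: b_def)
  finally have e1: "expectation (\<lambda>\<omega>. iexp (\<eta> * psum c d (Suc j) \<omega>)) = e0 - b * e2 + expectation R" .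
  have eq: "complex_of_real (1 - \<eta>\<^sup>2 * s2 * v / 2) = 1 - complex_of_real b * complex_of_real v"
    by (simp add: b_def)
  have "expectation (\<lambda>\<omega>. iexp (\<eta> * psum c d (Suc j) \<omega>)) - complex_of_real (1 - \<eta>\<^sup>2 * s2 * v / 2) * e0
      = expectation R - complex_of_real b * (e2 - e0 * v)"
    unfolding e1 eq by (simp add: algebra_simps)
  also have "cmod \<dots> \<le> cmod (expectation R) + cmod (complex_of_real b * (e2 - e0 * v))"
    by (rule norm_triangle_ineq4)
  also have "cmod (complex_of_real b * (e2 - e0 * v)) = b * cmod (e2 - e0 * v)"
    using \<open>0 \<le> b\<close> by (simp add: norm_mult)
  also have "cmod (expectation R) + b * cmod (e2 - e0 * v)
      \<le> \<bar>\<eta>\<bar> ^ 3 * K ^ 3 * H\<^sup>2 + b * (\<bar>\<eta>\<bar> * (K ^ 3 * (1 + H) * H\<^sup>2))"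
    by (rule add_mono[OF R_le mult_left_mono[OF e2_le \<open>0 \<le> b\<close>]])
  also have "\<dots> = \<bar>\<eta>\<bar> ^ 3 * (K ^ 3 * H\<^sup>2 + s2 * (K ^ 3 * (1 + H) * H\<^sup>2) / 2)"
    unfolding cube b_def by (simp add: algebra_simps)
  also have "\<dots> \<le> \<bar>\<eta>\<bar> ^ 3 * (K ^ 3 * H\<^sup>2 + s2 * (K ^ 3 * (1 + H) * H\<^sup>2))"
    using s2_nonneg K_nonneg H_ge_1 by (intro mult_left_mono add_left_mono) auto
  finally show ?thesis unfolding v_def e0_def .
qed

end

end

section \<open>A central limit theorem for the weighted sums\<close>

lemma exp_minus_approx:
  fixes x :: real
  assumes "0 \<le> x"
  shows "\<bar>1 - x - exp (- x)\<bar> \<le> x\<^sup>2"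
proof -
  have "exp (- x) \<le> inverse (1 + x)"
    unfolding exp_minus using exp_ge_add_one_self[of x] assms by (intro le_imp_inverse_le) auto
  also have "\<dots> \<le> 1 - x + x\<^sup>2"
  proof -
    have "1 \<le> (1 + x) * (1 - x + x\<^sup>2)"
      using assms by (simp add: algebra_simps power2_eq_square)
    then show ?thesis using assms by (simp add: inverse_eq_divide divide_le_eq mult.commute)
  qed
  finally show ?thesis using exp_ge_add_one_self[of "- x"] by (auto simp: abs_le_iff)
qed

context noise
begin

context
  fixes c :: "nat \<Rightarrow> real" and d K :: real
  assumes cK: "\<And>i. \<bar>c i\<bar> \<le> K" and dK: "\<bar>d\<bar> \<le> K"
begin

text \<open>
  Iterating the one-step estimate compares the characteristic function with the Gaussian one.  All
  factors have modulus at most \<open>1\<close>, so the errors of the \<open>J\<close> steps merely add up.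
\<close>

lemma char_psum_approx:
  "cmod (expectation (\<lambda>\<omega>. iexp (\<eta> * psum c d J \<omega>))
      - exp (- (\<eta>\<^sup>2 * (s2 * (\<Sum>j<J. (c j)\<^sup>2 + d\<^sup>2 * s2)) / 2)))
    \<le> J * (\<bar>\<eta>\<bar> ^ 3 * (K ^ 3 * H\<^sup>2 + s2 * (K ^ 3 * (1 + H) * H\<^sup>2)) + \<eta> ^ 4 * (s2 * K\<^sup>2 * H)\<^sup>2)"
proof (induction J)
  case 0
  show ?case by (simp add: psum_def prob_space)
next
  case (Suc J)
  let ?B = "\<bar>\<eta>\<bar> ^ 3 * (K ^ 3 * H\<^sup>2 + s2 * (K ^ 3 * (1 + H) * H\<^sup>2))"
  define \<phi> where "\<phi> = (\<lambda>j. expectation (\<lambda>\<omega>. iexp (\<eta> * psum c d j \<omega>)))"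
  define \<Theta> where "\<Theta> = (\<lambda>J. \<eta>\<^sup>2 * (s2 * (\<Sum>j<J. (c j)\<^sup>2 + d\<^sup>2 * s2)) / 2)"
  define \<theta> where "\<theta> = \<eta>\<^sup>2 * s2 * ((c J)\<^sup>2 + d\<^sup>2 * s2) / 2"
  have \<Theta>: "\<Theta> (Suc J) = \<theta> + \<Theta> J" by (simp add: \<Theta>_def \<theta>_def algebra_simps)
  have "0 \<le> \<theta>" using s2_nonneg by (simp add: \<theta>_def)
  have "\<eta>\<^sup>2 * s2 * ((c J)\<^sup>2 + d\<^sup>2 * s2) \<le> \<eta>\<^sup>2 * s2 * (K\<^sup>2 * H)"
    using expectation_weight_sq(3)[of c K d J, OF cK dK] s2_nonneg by (intro mult_left_mono) auto
  then have "\<theta> \<le> \<eta>\<^sup>2 * (s2 * K\<^sup>2 * H)"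
    using \<open>0 \<le> \<theta>\<close> unfolding \<theta>_def by (simp add: mult.assoc)
  then have "\<theta>\<^sup>2 \<le> (\<eta>\<^sup>2 * (s2 * K\<^sup>2 * H))\<^sup>2" using \<open>0 \<le> \<theta>\<close> by (rule power_mono)
  then have \<theta>2: "\<theta>\<^sup>2 \<le> \<eta> ^ 4 * (s2 * K\<^sup>2 * H)\<^sup>2" by (simp add: power_mult_distrib)
  have \<phi>1: "cmod (\<phi> J) \<le> 1"
    unfolding \<phi>_def by (rule order_trans[OF integral_norm_bound]) (simp add: prob_space)
  have "\<phi> (Suc J) - exp (- \<Theta> (Suc J))
      = (\<phi> (Suc J) - (1 - \<theta>) * \<phi> J) + complex_of_real (1 - \<theta> - exp (- \<theta>)) * \<phi> J
        + complex_of_real (exp (- \<theta>)) * (\<phi> J - exp (- \<Theta> J))"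
    unfolding \<Theta> by (simp add: algebra_simps exp_add exp_diff exp_minus field_simps)
  also have "cmod \<dots> \<le> cmod (\<phi> (Suc J) - (1 - \<theta>) * \<phi> J) + cmod (complex_of_real (1 - \<theta> - exp (- \<theta>)) * \<phi> J)
        + cmod (complex_of_real (exp (- \<theta>)) * (\<phi> J - exp (- \<Theta> J)))"
    by (intro norm_triangle_le add_mono norm_triangle_ineq) auto
  also have "\<dots> \<le> ?B + \<eta> ^ 4 * (s2 * K\<^sup>2 * H)\<^sup>2 + J * (?B + \<eta> ^ 4 * (s2 * K\<^sup>2 * H)\<^sup>2)"
  proof (intro add_mono)
    show "cmod (\<phi> (Suc J) - (1 - \<theta>) * \<phi> J) \<le> ?B"
      unfolding \<phi>_def \<theta>_def by (rule char_psum_step[OF cK dK])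
    have "cmod (complex_of_real (1 - \<theta> - exp (- \<theta>)) * \<phi> J) \<le> \<theta>\<^sup>2 * 1"
      unfolding norm_mult norm_of_real
      by (intro mult_mono exp_minus_approx \<phi>1) (use \<open>0 \<le> \<theta>\<close> in auto)
    then show "cmod (complex_of_real (1 - \<theta> - exp (- \<theta>)) * \<phi> J) \<le> \<eta> ^ 4 * (s2 * K\<^sup>2 * H)\<^sup>2"
      using \<theta>2 by simp
    have "cmod (complex_of_real (exp (- \<theta>)) * (\<phi> J - exp (- \<Theta> J))) \<le> 1 * cmod (\<phi> J - exp (- \<Theta> J))"
      unfolding norm_mult norm_of_real using \<open>0 \<le> \<theta>\<close> by (intro mult_right_mono) auto
    also have "\<dots> \<le> J * (?B + \<eta> ^ 4 * (s2 * K\<^sup>2 * H)\<^sup>2)"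
      using Suc.IH unfolding \<phi>_def \<Theta>_def by simp
    finally show "cmod (complex_of_real (exp (- \<theta>)) * (\<phi> J - exp (- \<Theta> J))) \<le> J * (?B + \<eta> ^ 4 * (s2 * K\<^sup>2 * H)\<^sup>2)" .
  qed
  also have "\<dots> = Suc J * (?B + \<eta> ^ 4 * (s2 * K\<^sup>2 * H)\<^sup>2)"
    by (simp add: distrib_right)
  finally show ?case unfolding \<phi>_def \<Theta>_def .
qed

text \<open>
  Martingale differences are orthogonal.  The cross term is integrable since both factors of
  \<open>S\<^sub>J (c J + d m\<^sub>J)\<close> are square integrable, the first one by induction.
\<close>

lemma psum_second_moment:
  "integrable M (\<lambda>\<omega>. (psum c d J \<omega>)\<^sup>2) \<and> expectation (\<lambda>\<omega>. (psum c d J \<omega>)\<^sup>2) \<le> J * (K\<^sup>2 * H\<^sup>2)"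
proof (induction J)
  case 0
  show ?case by (simp add: psum_def)
next
  case (Suc J)
  then have int: "integrable M (\<lambda>\<omega>. (psum c d J \<omega>)\<^sup>2)"
    and IH: "expectation (\<lambda>\<omega>. (psum c d J \<omega>)\<^sup>2) \<le> J * (K\<^sup>2 * H\<^sup>2)" by auto
  let ?w = "\<lambda>\<omega>. c J + d * m J \<omega>"
  have x_bound: "norm ((summand c d J \<omega>)\<^sup>2) \<le> K\<^sup>2 * ((1 + \<bar>m J \<omega>\<bar>) ^ 3 * (1 + \<bar>m (Suc J) \<omega>\<bar>) ^ 3)" for \<omega>
  proof -
    have "norm ((summand c d J \<omega>)\<^sup>2) \<le> (K * ((1 + \<bar>m J \<omega>\<bar>) * (1 + \<bar>m (Suc J) \<omega>\<bar>)))\<^sup>2"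
      using power_mono[OF summand_bound[of c K d J \<omega>, OF cK dK], of 2] by simp
    also have "\<dots> = K\<^sup>2 * ((1 + \<bar>m J \<omega>\<bar>)\<^sup>2 * (1 + \<bar>m (Suc J) \<omega>\<bar>)\<^sup>2)" by (simp add: power_mult_distrib)
    also have "\<dots> \<le> K\<^sup>2 * ((1 + \<bar>m J \<omega>\<bar>) ^ 3 * (1 + \<bar>m (Suc J) \<omega>\<bar>) ^ 3)"
      by (intro mult_left_mono mult_mono power_increasing) auto
    finally show ?thesis .
  qed
  have x_int: "integrable M (\<lambda>\<omega>. (summand c d J \<omega>)\<^sup>2)"
    by (rule integrable_dominated2[OF _ x_bound]) auto
  have x_exp: "norm (expectation (\<lambda>\<omega>. (summand c d J \<omega>)\<^sup>2)) \<le> K\<^sup>2 * H\<^sup>2"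
    by (rule expectation_dominated2[OF _ x_bound]) auto
  have Pw_int: "integrable M (\<lambda>\<omega>. psum c d J \<omega> * ?w \<omega>)"
  proof (rule Bochner_Integration.integrable_bound)
    show "integrable M (\<lambda>\<omega>. (psum c d J \<omega>)\<^sup>2 + (?w \<omega>)\<^sup>2)"
      using int expectation_weight_sq(1)[of c K d J, OF cK dK] by simp
    show "AE \<omega> in M. norm (psum c d J \<omega> * ?w \<omega>) \<le> norm ((psum c d J \<omega>)\<^sup>2 + (?w \<omega>)\<^sup>2)"
    proof (rule AE_I2)
      fix \<omega>
      have "2 * \<bar>psum c d J \<omega>\<bar> * \<bar>?w \<omega>\<bar> \<le> (psum c d J \<omega>)\<^sup>2 + (?w \<omega>)\<^sup>2"
        using sum_squares_bound[of "\<bar>psum c d J \<omega>\<bar>" "\<bar>?w \<omega>\<bar>"] by simp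
      moreover have "0 \<le> \<bar>psum c d J \<omega>\<bar> * \<bar>?w \<omega>\<bar>" by simp
      ultimately show "norm (psum c d J \<omega> * ?w \<omega>) \<le> norm ((psum c d J \<omega>)\<^sup>2 + (?w \<omega>)\<^sup>2)"
        unfolding real_norm_def abs_mult by linarith
    qed
  qed measurable
  have past: "(\<lambda>z. (\<Sum>i<J. (c i + d * z i) * z (Suc i)) * (c J + d * z J)) \<in> borel_measurable (PiM {..J} (\<lambda>_. borel :: real measure))"
    by (intro borel_measurable_sum borel_measurable_times borel_measurable_add borel_measurable_const
        measurable_component_singleton) auto
  have past': "psum c d J \<omega> * ?w \<omega>
      = (\<lambda>z. (\<Sum>i<J. (c i + d * z i) * z (Suc i)) * (c J + d * z J)) (\<lambda>l\<in>{..J}. m l \<omega>)" for \<omega>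
    by (simp add: psum_def summand_def)
  have cross_int: "integrable M (\<lambda>\<omega>. psum c d J \<omega> * ?w \<omega> * m (Suc J) \<omega>)"
    by (rule integrable_past_future[where g = "\<lambda>y. y", OF past _ past' lessI Pw_int integrable_noise]) simp
  have "expectation (\<lambda>\<omega>. psum c d J \<omega> * ?w \<omega> * m (Suc J) \<omega>) = expectation (\<lambda>\<omega>. psum c d J \<omega> * ?w \<omega>) * expectation (m (Suc J))"
    by (rule expectation_past_future[where g = "\<lambda>y. y", OF past _ past' lessI Pw_int integrable_noise]) simp
  then have cross: "expectation (\<lambda>\<omega>. psum c d J \<omega> * ?w \<omega> * m (Suc J) \<omega>) = 0" by (simp add: mean)
  have eq: "(\<lambda>\<omega>. (psum c d (Suc J) \<omega>)\<^sup>2)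
      = (\<lambda>\<omega>. (psum c d J \<omega>)\<^sup>2 + 2 * (psum c d J \<omega> * ?w \<omega> * m (Suc J) \<omega>) + (summand c d J \<omega>)\<^sup>2)"
    by (simp add: psum_def summand_def power2_sum algebra_simps)
  have "integrable M (\<lambda>\<omega>. (psum c d (Suc J) \<omega>)\<^sup>2)"
    unfolding eq using int cross_int x_int by simp
  moreover have "expectation (\<lambda>\<omega>. (psum c d (Suc J) \<omega>)\<^sup>2)
      = expectation (\<lambda>\<omega>. (psum c d J \<omega>)\<^sup>2) + expectation (\<lambda>\<omega>. (summand c d J \<omega>)\<^sup>2)"
    unfolding eq using int cross_int x_int cross by simp
  moreover have "\<dots> \<le> J * (K\<^sup>2 * H\<^sup>2) + K\<^sup>2 * H\<^sup>2"
    using IH x_exp by (intro add_mono) auto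
  ultimately show ?case by (simp add: algebra_simps)
qed

end

lemma bounded_in_prob_psum:
  assumes "\<And>n i. \<bar>c n i\<bar> \<le> K" "\<bar>d\<bar> \<le> K" "\<And>n. J n \<le> n"
  shows "bounded_in_prob M (\<lambda>n \<omega>. psum (c n) d (J n) \<omega> / sqrt (real n))"
proof (rule bounded_in_prob_L2)
  fix n
  have *: "integrable M (\<lambda>\<omega>. (psum (c n) d (J n) \<omega>)\<^sup>2)"
    "expectation (\<lambda>\<omega>. (psum (c n) d (J n) \<omega>)\<^sup>2) \<le> J n * (K\<^sup>2 * H\<^sup>2)"
    using psum_second_moment[of "c n" K d "J n"] assms by auto
  have eq: "(psum (c n) d (J n) \<omega> / sqrt (real n))\<^sup>2 = (psum (c n) d (J n) \<omega>)\<^sup>2 / n" for \<omega>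
    by (simp add: power_divide)
  show "integrable M (\<lambda>\<omega>. (psum (c n) d (J n) \<omega> / sqrt (real n))\<^sup>2)"
    unfolding eq using * by simp
  have "expectation (\<lambda>\<omega>. (psum (c n) d (J n) \<omega> / sqrt (real n))\<^sup>2) \<le> n * (K\<^sup>2 * H\<^sup>2) / n"
    unfolding eq using order_trans[OF *(2) mult_right_mono[of "real (J n)" n "K\<^sup>2 * H\<^sup>2"]] assms(3)[of n]
      divide_right_mono[of "expectation (\<lambda>\<omega>. (psum (c n) d (J n) \<omega>)\<^sup>2)" "n * (K\<^sup>2 * H\<^sup>2)" n]
    by simp
  also have "\<dots> \<le> K\<^sup>2 * H\<^sup>2" by simp
  finally show "expectation (\<lambda>\<omega>. (psum (c n) d (J n) \<omega> / sqrt (real n))\<^sup>2) \<le> K\<^sup>2 * H\<^sup>2" .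
qed measurable

text \<open>
  The central limit theorem for the triangular array of these sums, in terms of characteristic
  functions: with \<open>\<eta> = t / \<surd>n\<close> the accumulated error is \<open>O(1 / \<surd>n)\<close>.
\<close>

lemma char_psum_tendsto:
  assumes "\<And>n i. \<bar>c n i\<bar> \<le> K" "\<bar>d\<bar> \<le> K" "\<And>n. J n \<le> n"
    and V: "(\<lambda>n. s2 * (\<Sum>j<J n. (c n j)\<^sup>2 + d\<^sup>2 * s2) / n) \<longlonglongrightarrow> \<tau>\<^sup>2"
  shows "(\<lambda>n. char (distr M borel (\<lambda>\<omega>. psum (c n) d (J n) \<omega> / sqrt (real n))) t)
    \<longlonglongrightarrow> complex_of_real (exp (- ((t * \<tau>)\<^sup>2) / 2))"
proof -
  define A B where "A = K ^ 3 * H\<^sup>2 + s2 * (K ^ 3 * (1 + H) * H\<^sup>2)" and "B = (s2 * K\<^sup>2 * H)\<^sup>2"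
  define v where "v = (\<lambda>n. s2 * (\<Sum>j<J n. (c n j)\<^sup>2 + d\<^sup>2 * s2))"
  let ?e = "\<lambda>n. \<bar>t\<bar> ^ 3 * A / sqrt (real n) + t ^ 4 * B / n"
  have "0 \<le> K" using assms(2) by linarith
  then have "0 \<le> A" "0 \<le> B" using s2_nonneg H_ge_1 by (auto simp: A_def B_def)
  have chr: "char (distr M borel (\<lambda>\<omega>. psum (c n) d (J n) \<omega> / sqrt (real n))) t
      = expectation (\<lambda>\<omega>. iexp ((t / sqrt (real n)) * psum (c n) d (J n) \<omega>))" for n
    unfolding char_def by (subst integral_distr) auto
  have "norm (char (distr M borel (\<lambda>\<omega>. psum (c n) d (J n) \<omega> / sqrt (real n))) t
      - complex_of_real (exp (- (t\<^sup>2 * (v n / n) / 2)))) \<le> ?e n" if "1 \<le> n" for n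
  proof -
    let ?\<eta> = "t / sqrt (real n)"
    have s: "sqrt (real n) ^ 4 = n * real n" "sqrt (real n) ^ 3 = n * sqrt n" "(sqrt (real n))\<^sup>2 = n"
      by (simp_all add: eval_nat_numeral)
    have "?\<eta>\<^sup>2 = t\<^sup>2 / n" by (simp add: power_divide)
    then have "cmod (expectation (\<lambda>\<omega>. iexp (?\<eta> * psum (c n) d (J n) \<omega>)) - complex_of_real (exp (- (t\<^sup>2 * (v n / n) / 2))))
      \<le> J n * (\<bar>?\<eta>\<bar> ^ 3 * A + ?\<eta> ^ 4 * B)"
      using char_psum_approx[of "c n" K d ?\<eta> "J n", OF assms(1,2)] unfolding A_def B_def v_def
      by simp
    also have "\<dots> \<le> n * (\<bar>?\<eta>\<bar> ^ 3 * A + ?\<eta> ^ 4 * B)"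
      using assms(3) \<open>0 \<le> A\<close> \<open>0 \<le> B\<close> by (intro mult_right_mono) auto
    also have "\<dots> = ?e n"
      using that by (simp add: power_divide s field_simps)
    finally show ?thesis unfolding chr .
  qed
  then have "\<forall>\<^sub>F n in sequentially. norm (char (distr M borel (\<lambda>\<omega>. psum (c n) d (J n) \<omega> / sqrt (real n))) t
      - complex_of_real (exp (- (t\<^sup>2 * (v n / n) / 2)))) \<le> ?e n"
    by (auto simp: eventually_sequentially)
  moreover have "?e \<longlonglongrightarrow> 0"
    by (intro tendsto_add_zero tendsto_divide_0[OF tendsto_const] filterlim_at_top_imp_at_infinity
        filterlim_compose[OF sqrt_at_top] filterlim_real_sequentially)
  ultimately have "(\<lambda>n. char (distr M borel (\<lambda>\<omega>. psum (c n) d (J n) \<omega> / sqrt (real n))) t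
      - complex_of_real (exp (- (t\<^sup>2 * (v n / n) / 2)))) \<longlonglongrightarrow> 0"
    by (rule Lim_null_comparison)
  note null = this
  have lim: "(\<lambda>n. complex_of_real (exp (- (t\<^sup>2 * (v n / n) / 2)))) \<longlonglongrightarrow> complex_of_real (exp (- (t\<^sup>2 * \<tau>\<^sup>2 / 2)))"
    using V unfolding v_def by (intro tendsto_intros) simp_all
  show ?thesis using tendsto_add[OF null lim] by (simp add: power_mult_distrib)
qed

lemma psum_weak_limit:
  fixes g :: "real \<Rightarrow> real"
  assumes "\<And>n i. \<bar>c n i\<bar> \<le> K" "\<bar>d\<bar> \<le> K" "\<And>n. J n \<le> n"
    and V: "(\<lambda>n. s2 * (\<Sum>j<J n. (c n j)\<^sup>2 + d\<^sup>2 * s2) / n) \<longlonglongrightarrow> \<tau>\<^sup>2"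
    and N: "prob_space N" "distributed N lborel Z std_normal_density"
    and g: "continuous_on UNIV g" "bounded (range g)"
  shows "(\<lambda>n. expectation (\<lambda>\<omega>. g (psum (c n) d (J n) \<omega> / sqrt (real n)))) \<longlonglongrightarrow> integral\<^sup>L N (\<lambda>\<omega>. g (\<tau> * Z \<omega>))"
proof -
  interpret N: prob_space N by fact
  have Z [measurable]: "Z \<in> borel_measurable N"
    using distributed_measurable[OF N(2)] by simp
  have [measurable]: "g \<in> borel_measurable borel"
    using g(1) by (rule borel_measurable_continuous_onI)
  have Zlaw: "distr N borel Z = std_normal_distribution"
    using distributed_distr_eq_density[OF N(2)] by (simp cong: distr_cong)
  have chr: "char (distr N borel (\<lambda>\<omega>. \<tau> * Z \<omega>)) t = complex_of_real (exp (- ((t * \<tau>)\<^sup>2) / 2))" for t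
  proof -
    have "char (distr N borel (\<lambda>\<omega>. \<tau> * Z \<omega>)) t = integral\<^sup>L N (\<lambda>\<omega>. iexp ((t * \<tau>) * Z \<omega>))"
      unfolding char_def by (subst integral_distr) (auto simp: mult.assoc)
    also have "\<dots> = char (distr N borel Z) (t * \<tau>)"
      unfolding char_def by (subst integral_distr) auto
    finally show ?thesis by (simp add: Zlaw char_std_normal_distribution)
  qed
  have "weak_conv_m (\<lambda>n. distr M borel (\<lambda>\<omega>. psum (c n) d (J n) \<omega> / sqrt (real n))) (distr N borel (\<lambda>\<omega>. \<tau> * Z \<omega>))"
  proof (rule levy_continuity)
    show "(\<lambda>n. char (distr M borel (\<lambda>\<omega>. psum (c n) d (J n) \<omega> / sqrt (real n))) t)
        \<longlonglongrightarrow> char (distr N borel (\<lambda>\<omega>. \<tau> * Z \<omega>)) t" for t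
      unfolding chr by (rule char_psum_tendsto[OF assms(1-3) V])
  qed simp_all
  moreover obtain B where "\<And>x. norm (g x) \<le> B" using g(2) unfolding bounded_iff by auto
  ultimately have "(\<lambda>n. integral\<^sup>L (distr M borel (\<lambda>\<omega>. psum (c n) d (J n) \<omega> / sqrt (real n))) g)
      \<longlonglongrightarrow> integral\<^sup>L (distr N borel (\<lambda>\<omega>. \<tau> * Z \<omega>)) g"
    using g(1) by (intro weak_conv_imp_integral_bdd_continuous_conv) (auto simp: continuous_on_eq_continuous_at)
  then show ?thesis by (simp add: integral_distr)
qed

end

section \<open>The normal equations of the least squares estimator\<close>

text \<open>
  A minimiser of a sum of squares has residuals orthogonal to every direction \<open>h\<close> of variation:
  the step \<open>t = B / A\<close>, with \<open>A = \<Sum> h\<^sup>2\<close> and \<open>B = \<Sum> r h\<close>, would lower the sum by \<open>B\<^sup>2 / A\<close>.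
\<close>

lemma least_squares_orthogonal:
  fixes r h :: "'i \<Rightarrow> real"
  assumes "finite I" and min: "\<And>t. (\<Sum>i\<in>I. (r i)\<^sup>2) \<le> (\<Sum>i\<in>I. (r i - t * h i)\<^sup>2)"
  shows "(\<Sum>i\<in>I. r i * h i) = 0"
proof (cases "(\<Sum>i\<in>I. (h i)\<^sup>2) = 0")
  case True
  then have "\<forall>i\<in>I. h i = 0"
    using \<open>finite I\<close> by (subst (asm) sum_nonneg_eq_0_iff) auto
  then show ?thesis by simp
next
  case False
  define A where "A = (\<Sum>i\<in>I. (h i)\<^sup>2)"
  define B where "B = (\<Sum>i\<in>I. r i * h i)"
  have "0 < A" using False sum_nonneg[of I "\<lambda>i. (h i)\<^sup>2"] by (simp add: A_def order_less_le)
  have "(\<Sum>i\<in>I. (r i - t * h i)\<^sup>2) = (\<Sum>i\<in>I. (r i)\<^sup>2) - 2 * t * B + t\<^sup>2 * A" for t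
    by (simp add: A_def B_def power2_diff sum.distrib sum_subtractf sum_distrib_left power_mult_distrib mult_ac)
  from this[of "B / A"] have "(\<Sum>i\<in>I. (r i - B / A * h i)\<^sup>2) = (\<Sum>i\<in>I. (r i)\<^sup>2) - B\<^sup>2 / A"
    using \<open>0 < A\<close> by (simp add: power2_eq_square field_simps)
  then have "B\<^sup>2 / A \<le> 0" using min[of "B / A"] by simp
  then have "B = 0" using \<open>0 < A\<close> by (simp add: divide_le_0_iff)
  then show ?thesis by (simp add: B_def)
qed

text \<open>
  For \<open>k = 1\<close> both regressors vanish, so the parameters enter only through the terms from \<open>k = 2\<close> on,
  which are renumbered from \<open>0\<close>.
\<close>

lemma cls_Q_Suc:
  assumes "s 0 = 0"
  shows "cls_Q \<mu> (Suc l) (\<lambda>k\<in>{1..Suc l}. s k) a b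
    = (s 1 - \<mu>)\<^sup>2 + (\<Sum>i<l. (s (Suc (Suc i)) - a * s (Suc i) - b * s i - \<mu>)\<^sup>2)"
proof -
  let ?x = "\<lambda>k\<in>{1..Suc l}. s k"
  have at: "sample_at ?x (int k) = s k" if "k \<le> Suc l" for k
    using that assms by (cases "k = 0") (auto simp: sample_at_def)
  have neg: "sample_at ?x k = 0" if "k \<le> 0" for k using that by (simp add: sample_at_def)
  have "cls_Q \<mu> (Suc l) ?x a b = (\<Sum>k<Suc l. (sample_at ?x (int (Suc k)) - a * sample_at ?x (int (Suc k) - 1)
      - b * sample_at ?x (int (Suc k) - 2) - \<mu>)\<^sup>2)"
    unfolding cls_Q_def One_nat_def sum.atLeast1_atMost_eq ..
  also have "\<dots> = (s 1 - \<mu>)\<^sup>2 + (\<Sum>k<l. (sample_at ?x (int (Suc (Suc k))) - a * sample_at ?x (int (Suc k))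
      - b * sample_at ?x (int k) - \<mu>)\<^sup>2)"
    using at[of 1] neg by (subst sum.lessThan_Suc_shift) simp
  also have "(\<Sum>k<l. (sample_at ?x (int (Suc (Suc k))) - a * sample_at ?x (int (Suc k))
      - b * sample_at ?x (int k) - \<mu>)\<^sup>2) = (\<Sum>i<l. (s (Suc (Suc i)) - a * s (Suc i) - b * s i - \<mu>)\<^sup>2)"
  proof (intro sum.cong refl)
    fix i assume "i \<in> {..<l}"
    then have "Suc (Suc i) \<le> Suc l" "Suc i \<le> Suc l" "i \<le> Suc l" by auto
    then show "(sample_at ?x (int (Suc (Suc i))) - a * sample_at ?x (int (Suc i))
      - b * sample_at ?x (int i) - \<mu>)\<^sup>2 = (s (Suc (Suc i)) - a * s (Suc i) - b * s i - \<mu>)\<^sup>2"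
      by (simp only: at)
  qed
  finally show ?thesis .
qed

text \<open>
  In terms of \<open>v = \<beta>\<close> and \<open>w = \<alpha> - 1 + \<beta>\<close> the \<open>i\<close>-th residual is
  \<open>(e (i + 1) - \<mu>) - w s (i + 1) + v e i\<close>: the strongly correlated regressors \<open>s (i + 1)\<close>, \<open>s i\<close> are
  replaced by the level \<open>s (i + 1)\<close> and the increment \<open>e i\<close>.  The two conclusions are Cramer's rule for
  the normal equations, kept free of division because the Gram determinant may vanish.
\<close>

lemma cls_solution:
  fixes s :: "nat \<Rightarrow> real"
  assumes est: "is_CLS_estimator \<mu> (Suc l) \<alpha>h \<beta>h" and "s 0 = 0"
    and x: "x = (\<lambda>k\<in>{1..Suc l}. s k)" and e: "\<And>i. e i = s (Suc i) - s i"
  defines "p \<equiv> \<Sum>i<l. (s (Suc i))\<^sup>2" and "q \<equiv> \<Sum>i<l. (e i)\<^sup>2" and "r \<equiv> \<Sum>i<l. s (Suc i) * e i"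
    and "a \<equiv> \<Sum>i<l. (e (Suc i) - \<mu>) * s (Suc i)" and "b \<equiv> \<Sum>i<l. e i * (e (Suc i) - \<mu>)"
  shows "\<beta>h x * (p * q - r\<^sup>2) = a * r - b * p"
    and "(\<alpha>h x - 1 + \<beta>h x) * (p * q - r\<^sup>2) = a * q - b * r"
proof -
  define v where "v = \<beta>h x"
  define w where "w = \<alpha>h x - 1 + \<beta>h x"
  define \<rho> where "\<rho> = (\<lambda>i. (e (Suc i) - \<mu>) - w * s (Suc i) + v * e i)"
  have Q: "cls_Q \<mu> (Suc l) x (1 + w' - v') v'
      = (s 1 - \<mu>)\<^sup>2 + (\<Sum>i<l. ((e (Suc i) - \<mu>) - w' * s (Suc i) + v' * e i)\<^sup>2)" for w' v'
    unfolding x cls_Q_Suc[where s=s, OF \<open>s 0 = 0\<close>]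
    by (intro arg_cong2[where f="(+)"] sum.cong refl) (simp add: e algebra_simps)
  have "x \<in> space (PiM {1..Suc l} (\<lambda>_. borel :: real measure))"
    by (simp add: x space_PiM)
  then have "cls_Q \<mu> (Suc l) x (\<alpha>h x) (\<beta>h x) = (INF p. cls_Q \<mu> (Suc l) x (fst p) (snd p))"
    using est by (simp add: is_CLS_estimator_def)
  also have "\<dots> \<le> cls_Q \<mu> (Suc l) x a' b'" for a' b'
  proof -
    have "0 \<le> cls_Q \<mu> (Suc l) x a b" for a b
      unfolding cls_Q_def by (intro sum_nonneg zero_le_power2)
    then have "bdd_below (range (\<lambda>p. cls_Q \<mu> (Suc l) x (fst p) (snd p)))"
      by (intro bdd_belowI[of _ 0]) blast
    from cINF_lower[OF this, of "(a', b')"] show ?thesis by simp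
  qed
  finally have "cls_Q \<mu> (Suc l) x (1 + w - v) v \<le> cls_Q \<mu> (Suc l) x (1 + w' - v') v'" for w' v'
    by (simp add: w_def v_def)
  then have min: "(\<Sum>i<l. (\<rho> i)\<^sup>2) \<le> (\<Sum>i<l. ((e (Suc i) - \<mu>) - w' * s (Suc i) + v' * e i)\<^sup>2)" for w' v'
    unfolding Q \<rho>_def by simp
  have "(\<Sum>i<l. \<rho> i * s (Suc i)) = 0"
  proof (rule least_squares_orthogonal)
    show "(\<Sum>i<l. (\<rho> i)\<^sup>2) \<le> (\<Sum>i<l. (\<rho> i - t * s (Suc i))\<^sup>2)" for t
      using min[of "w + t" v] by (simp add: \<rho>_def algebra_simps)
  qed simp
  then have 1: "a - w * p + v * r = 0"
    by (simp add: \<rho>_def a_def p_def r_def algebra_simps sum.distrib sum_subtractf sum_distrib_left power2_eq_square)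
  have "(\<Sum>i<l. \<rho> i * e i) = 0"
  proof (rule least_squares_orthogonal)
    show "(\<Sum>i<l. (\<rho> i)\<^sup>2) \<le> (\<Sum>i<l. (\<rho> i - t * e i)\<^sup>2)" for t
      using min[of w "v - t"] by (simp add: \<rho>_def algebra_simps)
  qed simp
  then have 2: "b - w * r + v * q = 0"
    by (simp add: \<rho>_def b_def q_def r_def algebra_simps sum.distrib sum_subtractf sum_distrib_left power2_eq_square)
  have ab: "a = w * p - v * r" "b = w * r - v * q" using 1 2 by simp_all
  show "\<beta>h x * (p * q - r\<^sup>2) = a * r - b * p"
    unfolding v_def[symmetric] ab by (simp add: algebra_simps power2_eq_square)
  show "(\<alpha>h x - 1 + \<beta>h x) * (p * q - r\<^sup>2) = a * q - b * r"
    unfolding w_def[symmetric] ab by (simp add: algebra_simps power2_eq_square)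
qed

text \<open>
  Cramer's rule after dividing every sum by its order of magnitude; \<open>s\<close> stands for \<open>\<surd>n\<close>.  The
  level sums have order \<open>n\<^sup>3\<close>, the increment sums \<open>n\<close>, the mixed ones \<open>n\<^sup>2\<close>, and the sums \<open>A\<close>, \<open>B\<close>
  involving the noise \<open>n \<surd>n\<close> and \<open>\<surd>n\<close>.
\<close>

lemma scaled_solution:
  fixes s :: real
  assumes "0 < s"
  shows "x * (P * Q - R\<^sup>2) = A * R - B * P \<Longrightarrow>
      d = (P / (s\<^sup>2) ^ 3) * (Q / s\<^sup>2) - (R / (s\<^sup>2)\<^sup>2) * (R / (s\<^sup>2)\<^sup>2) \<Longrightarrow> d \<noteq> 0 \<Longrightarrow>
      s * x = A / (s\<^sup>2 * s) * (R / (s\<^sup>2)\<^sup>2 / d) - B / s * (P / (s\<^sup>2) ^ 3 / d)"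
    and "x * (P * Q - R\<^sup>2) = A * Q - B * R \<Longrightarrow>
      d = (P / (s\<^sup>2) ^ 3) * (Q / s\<^sup>2) - (R / (s\<^sup>2)\<^sup>2) * (R / (s\<^sup>2)\<^sup>2) \<Longrightarrow> d \<noteq> 0 \<Longrightarrow>
      s * x = A / (s\<^sup>2 * s) * (Q / s\<^sup>2 / d * (1 / s\<^sup>2)) - B / s * (R / (s\<^sup>2)\<^sup>2 / d * (1 / s\<^sup>2))"
proof -
  assume d: "d = (P / (s\<^sup>2) ^ 3) * (Q / s\<^sup>2) - (R / (s\<^sup>2)\<^sup>2) * (R / (s\<^sup>2)\<^sup>2)" "d \<noteq> 0"
  have D: "P * Q - R\<^sup>2 = d * s ^ 8"
    using \<open>0 < s\<close> unfolding d(1) by (simp add: left_diff_distrib eval_nat_numeral)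
  {
    assume "x * (P * Q - R\<^sup>2) = A * R - B * P"
    then have "A * R - B * P = x * d * s ^ 8" using D by simp
    moreover have "A / (s\<^sup>2 * s) * (R / (s\<^sup>2)\<^sup>2 / d) - B / s * (P / (s\<^sup>2) ^ 3 / d) = (A * R - B * P) / (s ^ 7 * d)"
      using \<open>0 < s\<close> d(2) by (simp add: diff_divide_distrib eval_nat_numeral mult_ac)
    ultimately show "s * x = A / (s\<^sup>2 * s) * (R / (s\<^sup>2)\<^sup>2 / d) - B / s * (P / (s\<^sup>2) ^ 3 / d)"
      using \<open>0 < s\<close> d(2) by (simp add: eval_nat_numeral)
  }
  {
    assume "x * (P * Q - R\<^sup>2) = A * Q - B * R"
    then have "A * Q - B * R = x * d * s ^ 8" using D by simp
    moreover have "A / (s\<^sup>2 * s) * (Q / s\<^sup>2 / d * (1 / s\<^sup>2)) - B / s * (R / (s\<^sup>2)\<^sup>2 / d * (1 / s\<^sup>2)) = (A * Q - B * R) / (s ^ 7 * d)"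
      using \<open>0 < s\<close> d(2) by (simp add: diff_divide_distrib eval_nat_numeral mult_ac)
    ultimately show "s * x = A / (s\<^sup>2 * s) * (Q / s\<^sup>2 / d * (1 / s\<^sup>2)) - B / s * (R / (s\<^sup>2)\<^sup>2 / d * (1 / s\<^sup>2))"
      using \<open>0 < s\<close> d(2) by (simp add: eval_nat_numeral)
  }
qed

section \<open>Least squares for a random walk with drift\<close>

lemma filterlim_pred: "filterlim (\<lambda>n::nat. n - 1) sequentially sequentially"
  by (rule filterlim_at_top_mono[OF filterlim_minus_const_nat_at_top[of 1]]) auto

lemma pred_ratio: "(\<lambda>n. real (n - 1) / n) \<longlonglongrightarrow> 1"
  by real_asymp

lemma sum_Suc_squares: "(\<Sum>i<l. (real (Suc i))\<^sup>2) = real l * (real l + 1) * (2 * real l + 1) / 6"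
  by (induction l) (simp_all add: power2_eq_square field_simps)

text \<open>
  A random walk \<open>S\<close> with increments \<open>m i + \<mu>\<close> of positive mean.  The law of large numbers for the
  squared increments is a hypothesis of its own: it depends on the squares, on which the third moment
  bound of \<open>noise\<close> gives no second moment.
\<close>

locale drift_walk = noise M m s2 H for M :: "'a measure" and m s2 H +
  fixes \<mu> :: real
  assumes mu_pos: "0 < \<mu>"
    and square_law: "conv_prob M (\<lambda>n \<omega>. (\<Sum>i<n. (m i \<omega> + \<mu>)\<^sup>2) / real n) (\<mu>\<^sup>2 + s2)"
begin

definition T :: "nat \<Rightarrow> 'a \<Rightarrow> real" where "T k \<omega> = (\<Sum>i<k. m i \<omega>)"

definition S :: "nat \<Rightarrow> 'a \<Rightarrow> real" where "S k \<omega> = (\<Sum>i<k. m i \<omega> + \<mu>)"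

text \<open>
  The entries of the normal equations for a sample of size \<open>n\<close>; \<open>S\<close>, \<open>E\<close> and \<open>M\<close> in the names stand for the
  level \<open>S (i + 1)\<close>, the increment \<open>m i + \<mu>\<close> and the noise \<open>m (i + 1)\<close>.  The upper index \<open>n - 1\<close>
  appears because the first observation carries no information on the parameters.
\<close>

definition SS :: "nat \<Rightarrow> 'a \<Rightarrow> real" where
  "SS n \<omega> = (\<Sum>i<n - 1. (S (Suc i) \<omega>)\<^sup>2)"

definition EE :: "nat \<Rightarrow> 'a \<Rightarrow> real" where
  "EE n \<omega> = (\<Sum>i<n - 1. (m i \<omega> + \<mu>)\<^sup>2)"

definition SE :: "nat \<Rightarrow> 'a \<Rightarrow> real" where
  "SE n \<omega> = (\<Sum>i<n - 1. S (Suc i) \<omega> * (m i \<omega> + \<mu>))"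

definition MS :: "nat \<Rightarrow> 'a \<Rightarrow> real" where
  "MS n \<omega> = (\<Sum>i<n - 1. m (Suc i) \<omega> * S (Suc i) \<omega>)"

definition EM :: "nat \<Rightarrow> 'a \<Rightarrow> real" where
  "EM n \<omega> = (\<Sum>i<n - 1. (m i \<omega> + \<mu>) * m (Suc i) \<omega>)"

lemma sums_measurable [measurable]:
  "T n \<in> borel_measurable M" "S n \<in> borel_measurable M" "SS n \<in> borel_measurable M"
  "EE n \<in> borel_measurable M" "SE n \<in> borel_measurable M" "MS n \<in> borel_measurable M" "EM n \<in> borel_measurable M"
  unfolding T_def S_def SS_def EE_def SE_def MS_def EM_def by measurable

lemma S_eq: "S k \<omega> = k * \<mu> + T k \<omega>"
  by (simp add: S_def T_def sum.distrib)

lemma T_second_moment: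
  "integrable M (\<lambda>\<omega>. (T n \<omega>)\<^sup>2)" "expectation (\<lambda>\<omega>. (T n \<omega>)\<^sup>2) \<le> n * s2"
  unfolding T_def
  using centered_sum_second_moment[OF indep integrable_noise_sq mean, of s2 n] by (simp_all add: var)

lemma T_law: "conv_prob M (\<lambda>n \<omega>. T n \<omega> / n) 0"
proof (rule conv_prob_L2)
  fix n
  show "integrable M (\<lambda>\<omega>. (T n \<omega> / n)\<^sup>2)"
    using T_second_moment by (simp add: power_divide)
  show "expectation (\<lambda>\<omega>. (T n \<omega> / n)\<^sup>2) \<le> s2 / n"
    using divide_right_mono[OF T_second_moment(2), of "(real n)\<^sup>2" n]
    by (cases "n = 0") (simp_all add: power_divide power2_eq_square)
  show "(\<lambda>n. s2 / real n) \<longlonglongrightarrow> 0" by real_asymp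
qed measurable

lemma S_law: "conv_prob M (\<lambda>n \<omega>. S (n - 1) \<omega> / n) \<mu>"
proof -
  have 1: "conv_prob M (\<lambda>n \<omega>. T (n - 1) \<omega> / real (n - 1)) 0"
    by (rule conv_prob_subseq[OF T_law filterlim_pred])
  have 2: "conv_prob M (\<lambda>n \<omega>. T (n - 1) \<omega> / real (n - 1) * (real (n - 1) / n)) (0 * 1)"
    by (rule conv_prob_mult[OF _ _ 1 conv_prob_const[OF pred_ratio]]) measurable
  have 3: "(\<lambda>n. real (n - 1) / n * \<mu>) \<longlonglongrightarrow> 1 * \<mu>"
    by (intro tendsto_mult pred_ratio tendsto_const)
  have "conv_prob M (\<lambda>n \<omega>. real (n - 1) / n * \<mu> + T (n - 1) \<omega> / real (n - 1) * (real (n - 1) / n)) (1 * \<mu> + 0 * 1)"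
    by (rule conv_prob_add[OF _ _ conv_prob_const[OF 3] 2]) measurable
  moreover have "real (n - 1) / n * \<mu> + T (n - 1) \<omega> / real (n - 1) * (real (n - 1) / n) = S (n - 1) \<omega> / n" for n \<omega>
    by (cases "n - 1 = 0") (simp_all add: S_eq T_def add_divide_distrib)
  ultimately show ?thesis by (simp only: mult_1_left mult_zero_left add_0_right)
qed

lemma EE_law: "conv_prob M (\<lambda>n \<omega>. EE n \<omega> / n) (\<mu>\<^sup>2 + s2)"
proof -
  have 1: "conv_prob M (\<lambda>n \<omega>. EE n \<omega> / real (n - 1)) (\<mu>\<^sup>2 + s2)"
    unfolding EE_def by (rule conv_prob_subseq[OF square_law filterlim_pred])
  have "conv_prob M (\<lambda>n \<omega>. EE n \<omega> / real (n - 1) * (real (n - 1) / n)) ((\<mu>\<^sup>2 + s2) * 1)"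
    by (rule conv_prob_mult[OF _ _ 1 conv_prob_const[OF pred_ratio]]) measurable
  moreover have "EE n \<omega> / real (n - 1) * (real (n - 1) / n) = EE n \<omega> / n" for n \<omega>
    by (cases "n - 1 = 0") (simp_all add: EE_def)
  ultimately show ?thesis by (simp only: mult_1_right)
qed

text \<open>
  Telescoping: \<open>S (i + 1)\<^sup>2 - S i\<^sup>2 = 2 S (i + 1) e\<^sub>i - e\<^sub>i\<^sup>2\<close> for the increment \<open>e\<^sub>i\<close>.
\<close>

lemma SE_eq: "SE n \<omega> = ((S (n - 1) \<omega>)\<^sup>2 + EE n \<omega>) / 2"
proof -
  have "2 * (\<Sum>i<l. S (Suc i) \<omega> * (m i \<omega> + \<mu>)) = (S l \<omega>)\<^sup>2 + (\<Sum>i<l. (m i \<omega> + \<mu>)\<^sup>2)" for l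
  proof (induction l)
    case (Suc l)
    have "S (Suc l) \<omega> = S l \<omega> + (m l \<omega> + \<mu>)" by (simp add: S_def)
    then show ?case using Suc by (simp add: power2_eq_square algebra_simps)
  qed (simp add: S_def)
  then have "2 * SE n \<omega> = (S (n - 1) \<omega>)\<^sup>2 + EE n \<omega>" unfolding SE_def EE_def .
  then show ?thesis by simp
qed

lemma SE_law: "conv_prob M (\<lambda>n \<omega>. SE n \<omega> / real n ^ 2) (\<mu>\<^sup>2 / 2)"
proof -
  have 1: "conv_prob M (\<lambda>n \<omega>. (S (n - 1) \<omega> / n) * (S (n - 1) \<omega> / n)) (\<mu> * \<mu>)"
    by (rule conv_prob_mult[OF _ _ S_law S_law]) measurable
  have "(\<lambda>n. 1 / real n) \<longlonglongrightarrow> 0" by real_asymp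
  note 2 = conv_prob_const[OF this]
  have 3: "conv_prob M (\<lambda>n \<omega>. (EE n \<omega> / n) * (1 / n)) ((\<mu>\<^sup>2 + s2) * 0)"
    by (rule conv_prob_mult[OF _ _ EE_law 2]) measurable
  have 4: "conv_prob M (\<lambda>n \<omega>. (S (n - 1) \<omega> / n) * (S (n - 1) \<omega> / n) + (EE n \<omega> / n) * (1 / n))
      (\<mu> * \<mu> + (\<mu>\<^sup>2 + s2) * 0)"
    by (rule conv_prob_add[OF _ _ 1 3]) measurable
  have "conv_prob M (\<lambda>n \<omega>. ((S (n - 1) \<omega> / n) * (S (n - 1) \<omega> / n) + (EE n \<omega> / n) * (1 / n)) * (1 / 2))
      ((\<mu> * \<mu> + (\<mu>\<^sup>2 + s2) * 0) * (1 / 2))"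
    by (rule conv_prob_mult[OF _ _ 4 conv_prob_const[OF tendsto_const]]) measurable
  moreover have "((S (n - 1) \<omega> / n) * (S (n - 1) \<omega> / n) + (EE n \<omega> / n) * (1 / n)) * (1 / 2) = SE n \<omega> / real n ^ 2" for n \<omega>
    by (simp add: SE_eq power2_eq_square add_divide_distrib)
  moreover have "(\<mu> * \<mu> + (\<mu>\<^sup>2 + s2) * 0) * (1 / 2) = \<mu>\<^sup>2 / 2" by (simp add: power2_eq_square)
  ultimately show ?thesis by (simp only:)
qed

text \<open>
  The drift dominates: \<open>S k = k \<mu> + T k\<close> with \<open>T k\<close> of order \<open>\<surd>k\<close>, so the sum of squares is
  \<open>\<mu>\<^sup>2 \<Sum> k\<^sup>2\<close> up to an error whose mean is \<open>O(n\<^sup>2 \<surd>n)\<close>.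
\<close>

lemma SS_law: "conv_prob M (\<lambda>n \<omega>. SS n \<omega> / real n ^ 3) (\<mu>\<^sup>2 / 3)"
proof -
  define c where "c = (\<lambda>n. (\<Sum>i<n - 1. \<mu>\<^sup>2 * (real (Suc i))\<^sup>2))"
  have c: "c n = \<mu>\<^sup>2 * ((real n - 1) * n * (2 * real n - 1) / 6)" if "1 \<le> n" for n
  proof -
    obtain l where n: "n = Suc l" using \<open>1 \<le> n\<close> by (cases n) auto
    have "c n = \<mu>\<^sup>2 * (\<Sum>i<l. (real (Suc i))\<^sup>2)"
      by (simp only: c_def n diff_Suc_1 sum_distrib_left)
    then show ?thesis unfolding sum_Suc_squares by (simp add: n algebra_simps)
  qed
  have "(\<lambda>n. \<mu>\<^sup>2 * ((real n - 1) * n * (2 * real n - 1) / 6) / real n ^ 3) \<longlonglongrightarrow> \<mu>\<^sup>2 / 3"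
    by real_asymp
  then have "(\<lambda>n. c n / real n ^ 3) \<longlonglongrightarrow> \<mu>\<^sup>2 / 3"
    by (rule Lim_transform_eventually) (auto simp: eventually_sequentially c intro!: exI[of _ 1])
  moreover have "conv_prob M (\<lambda>n \<omega>. (SS n \<omega> - c n) / real n ^ 3) 0"
  proof (rule conv_prob_AE_le)
    let ?Y = "\<lambda>n \<omega>. (\<Sum>i<n - 1. \<mu> * ((real n)\<^sup>2 / sqrt n) + (\<mu> * sqrt n + 1) * (T (Suc i) \<omega>)\<^sup>2) / real n ^ 3"
    have nonneg: "0 \<le> ?Y n \<omega>" for n \<omega>
      using mu_pos by (intro divide_nonneg_nonneg sum_nonneg) auto
    have int: "integrable M (?Y n)" for n
      using T_second_moment(1) by simp
    show "conv_prob M ?Y 0"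
    proof (rule conv_prob_L1[OF int])
      fix n
      have "expectation (\<lambda>\<omega>. \<bar>?Y n \<omega>\<bar>) = expectation (?Y n)" by (simp only: abs_of_nonneg[OF nonneg])
      also have "\<dots> = (\<Sum>i<n - 1. \<mu> * ((real n)\<^sup>2 / sqrt n) + (\<mu> * sqrt n + 1) * expectation (\<lambda>\<omega>. (T (Suc i) \<omega>)\<^sup>2)) / real n ^ 3"
        using T_second_moment(1) by (simp add: prob_space)
      also have "\<dots> \<le> (\<Sum>i<n - 1. \<mu> * ((real n)\<^sup>2 / sqrt n) + (\<mu> * sqrt n + 1) * (n * s2)) / real n ^ 3"
      proof (intro divide_right_mono sum_mono add_left_mono mult_left_mono)
        fix i assume "i \<in> {..<n - 1}"
        then have "real (Suc i) * s2 \<le> n * s2" using s2_nonneg by (intro mult_right_mono) auto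
        then show "expectation (\<lambda>\<omega>. (T (Suc i) \<omega>)\<^sup>2) \<le> n * s2"
          using T_second_moment(2)[of "Suc i"] by linarith
      qed (use mu_pos in auto)
      also have "\<dots> = real (n - 1) * (\<mu> * ((real n)\<^sup>2 / sqrt n) + (\<mu> * sqrt n + 1) * (n * s2)) / real n ^ 3"
        by simp
      finally show "expectation (\<lambda>\<omega>. \<bar>?Y n \<omega>\<bar>) \<le> real (n - 1) * (\<mu> * ((real n)\<^sup>2 / sqrt n) + (\<mu> * sqrt n + 1) * (n * s2)) / real n ^ 3" .
      show "(\<lambda>n. real (n - 1) * (\<mu> * ((real n)\<^sup>2 / sqrt n) + (\<mu> * sqrt n + 1) * (n * s2)) / real n ^ 3) \<longlonglongrightarrow> 0"
        by real_asymp
    qed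
    have bound: "\<bar>SS n \<omega> - c n\<bar> \<le> (\<Sum>i<n - 1. \<mu> * ((real n)\<^sup>2 / sqrt n) + (\<mu> * sqrt n + 1) * (T (Suc i) \<omega>)\<^sup>2)" for n \<omega>
    proof -
      have "SS n \<omega> - c n = (\<Sum>i<n - 1. 2 * \<mu> * (real (Suc i) * T (Suc i) \<omega>) + (T (Suc i) \<omega>)\<^sup>2)"
        unfolding SS_def c_def sum_subtractf[symmetric] S_eq
        by (intro sum.cong refl) (simp add: power2_sum power_mult_distrib)
      also have "\<bar>\<dots>\<bar> \<le> (\<Sum>i<n - 1. \<bar>2 * \<mu> * (real (Suc i) * T (Suc i) \<omega>) + (T (Suc i) \<omega>)\<^sup>2\<bar>)"
        by (rule sum_abs)
      also have "\<dots> \<le> (\<Sum>i<n - 1. \<mu> * ((real n)\<^sup>2 / sqrt n) + (\<mu> * sqrt n + 1) * (T (Suc i) \<omega>)\<^sup>2)"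
      proof (rule sum_mono)
        fix i assume "i \<in> {..<n - 1}"
        then have i: "real (Suc i) \<le> n" "0 < n" by auto
        define x where "x = T (Suc i) \<omega>"
        have s: "sqrt (sqrt n) * sqrt (sqrt n) = sqrt n" by simp
        \<comment> \<open>The factor \<open>n ^ (1/4)\<close> balances \<open>n\<^sup>2\<close> against \<open>E (T k)\<^sup>2 \<le> n s2\<close> in \<open>2 y z \<le> y\<^sup>2 + z\<^sup>2\<close>.\<close>
        have "2 * (n / sqrt (sqrt n)) * (sqrt (sqrt n) * \<bar>x\<bar>) \<le> (n / sqrt (sqrt n))\<^sup>2 + (sqrt (sqrt n) * \<bar>x\<bar>)\<^sup>2"
          by (rule sum_squares_bound)
        then have *: "2 * (n * \<bar>x\<bar>) \<le> (real n)\<^sup>2 / sqrt n + sqrt n * x\<^sup>2"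
          using i by (simp add: power_mult_distrib power_divide)
        have "\<bar>2 * \<mu> * (real (Suc i) * x) + x\<^sup>2\<bar> \<le> \<bar>2 * \<mu> * (real (Suc i) * x)\<bar> + x\<^sup>2"
          using abs_triangle_ineq[of "2 * \<mu> * (real (Suc i) * x)" "x\<^sup>2"] by simp
        also have "\<bar>2 * \<mu> * (real (Suc i) * x)\<bar> = \<mu> * (2 * (real (Suc i) * \<bar>x\<bar>))"
          using mu_pos by (simp add: abs_mult)
        also have "\<dots> \<le> \<mu> * ((real n)\<^sup>2 / sqrt n + sqrt n * x\<^sup>2)"
          using i mu_pos * mult_right_mono[OF i(1), of "\<bar>x\<bar>"] by (intro mult_left_mono) auto
        finally show "\<bar>2 * \<mu> * (real (Suc i) * T (Suc i) \<omega>) + (T (Suc i) \<omega>)\<^sup>2\<bar>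
            \<le> \<mu> * ((real n)\<^sup>2 / sqrt n) + (\<mu> * sqrt n + 1) * (T (Suc i) \<omega>)\<^sup>2"
          unfolding x_def[symmetric] by (simp add: algebra_simps)
      qed
      finally show ?thesis .
    qed
    show "\<forall>\<^sub>F n in sequentially. AE \<omega> in M. \<bar>(SS n \<omega> - c n) / real n ^ 3 - 0\<bar> \<le> \<bar>?Y n \<omega>\<bar>"
    proof (intro always_eventually allI AE_I2)
      fix n \<omega>
      have "\<bar>(SS n \<omega> - c n) / real n ^ 3 - 0\<bar> = \<bar>SS n \<omega> - c n\<bar> / real n ^ 3" by (simp add: abs_divide)
      also have "\<dots> \<le> ?Y n \<omega>" using bound by (intro divide_right_mono) auto
      also have "\<dots> \<le> \<bar>?Y n \<omega>\<bar>" by (rule abs_ge_self)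
      finally show "\<bar>(SS n \<omega> - c n) / real n ^ 3 - 0\<bar> \<le> \<bar>?Y n \<omega>\<bar>" .
    qed
  qed measurable
  ultimately have "conv_prob M (\<lambda>n \<omega>. (SS n \<omega> - c n) / real n ^ 3 + c n / real n ^ 3) (0 + \<mu>\<^sup>2 / 3)"
    by (intro conv_prob_add[OF _ _ _ conv_prob_const]) measurable
  then show ?thesis by (simp add: diff_divide_distrib)
qed

text \<open>
  The weights \<open>\<mu> (i + 1) / n\<close> coming from the drift of the level.  They are cut off beyond the range of
  summation so as to be bounded uniformly in \<open>i\<close>.
\<close>

definition ramp :: "nat \<Rightarrow> nat \<Rightarrow> real" where
  "ramp n i = (if i < n then \<mu> * real (Suc i) / n else 0)"

lemma ramp_bound: "\<bar>ramp n i\<bar> \<le> \<mu>"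
  using mu_pos by (auto simp: ramp_def divide_le_eq)

text \<open>
  The part of the sum \<open>MS\<close> that comes from the fluctuation \<open>T\<close> of the level.
\<close>

definition MT :: "nat \<Rightarrow> 'a \<Rightarrow> real" where
  "MT n \<omega> = (\<Sum>i<n - 1. m (Suc i) \<omega> * T (Suc i) \<omega>)"

lemma MT_measurable [measurable]: "MT n \<in> borel_measurable M"
  unfolding MT_def by measurable

lemma MS_eq: "MS n \<omega> / (n * sqrt n) = psum (ramp n) 0 (n - 1) \<omega> / sqrt n + MT n \<omega> / (n * sqrt n)"
proof (cases "n = 0")
  case False
  have "MS n \<omega> = n * psum (ramp n) 0 (n - 1) \<omega> + MT n \<omega>"
    unfolding MS_def MT_def psum_def summand_def sum_distrib_left sum.distrib[symmetric] using False
    by (intro sum.cong refl) (simp add: ramp_def S_eq field_simps)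
  then show ?thesis using False by (simp add: field_simps)
qed simp

lemma EM_eq: "EM n \<omega> = psum (\<lambda>_. \<mu>) 1 (n - 1) \<omega>"
  by (simp add: EM_def psum_def summand_def add.commute)

text \<open>
  Telescoping again, \<open>T (i + 1)\<^sup>2 - T i\<^sup>2 = 2 m\<^sub>i T i + m\<^sub>i\<^sup>2\<close>, shows that this sum has order \<open>n\<close> only,
  against \<open>n \<surd>n\<close> for the contribution of the drift.
\<close>

lemma MT_L1:
  shows "integrable M (MT n)" and "expectation (\<lambda>\<omega>. \<bar>MT n \<omega>\<bar>) \<le> n * s2"
proof -
  have "2 * (\<Sum>i<l. m (Suc i) \<omega> * T (Suc i) \<omega>) = (T (Suc l) \<omega>)\<^sup>2 - (\<Sum>i<Suc l. (m i \<omega>)\<^sup>2)" for l \<omega>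
    by (induction l) (simp_all add: T_def power2_eq_square algebra_simps)
  note telescope = this
  have "2 * MT n \<omega> = (T n \<omega>)\<^sup>2 - (\<Sum>i<n. (m i \<omega>)\<^sup>2)" for \<omega>
    using telescope[of \<omega> "n - 1"] by (cases n) (simp_all only: MT_def diff_Suc_1, simp add: T_def)
  then have eq: "MT n \<omega> = ((T n \<omega>)\<^sup>2 - (\<Sum>i<n. (m i \<omega>)\<^sup>2)) / 2" for \<omega>
    by (metis nonzero_mult_div_cancel_left zero_neq_numeral)
  have bound: "\<bar>MT n \<omega>\<bar> \<le> ((T n \<omega>)\<^sup>2 + (\<Sum>i<n. (m i \<omega>)\<^sup>2)) / 2" for \<omega>
    unfolding eq using sum_nonneg[of "{..<n}" "\<lambda>i. (m i \<omega>)\<^sup>2"] zero_le_power2[of "T n \<omega>"] by (auto simp: abs_le_iff)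
  show int: "integrable M (MT n)"
    unfolding eq[abs_def] using T_second_moment(1) integrable_noise_sq by simp
  have "expectation (\<lambda>\<omega>. \<bar>MT n \<omega>\<bar>) \<le> expectation (\<lambda>\<omega>. ((T n \<omega>)\<^sup>2 + (\<Sum>i<n. (m i \<omega>)\<^sup>2)) / 2)"
    by (rule integral_mono) (use int T_second_moment(1) integrable_noise_sq bound in auto)
  also have "\<dots> = (expectation (\<lambda>\<omega>. (T n \<omega>)\<^sup>2) + n * s2) / 2"
    using T_second_moment(1) integrable_noise_sq by (simp add: var mult.commute)
  also have "\<dots> \<le> n * s2" using T_second_moment(2)[of n] by (simp add: mult.commute)
  finally show "expectation (\<lambda>\<omega>. \<bar>MT n \<omega>\<bar>) \<le> n * s2" .
qed

lemma MT_scaled_L1: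
  shows "integrable M (\<lambda>\<omega>. MT n \<omega> / (n * sqrt n))"
    and "expectation (\<lambda>\<omega>. \<bar>MT n \<omega> / (n * sqrt n)\<bar>) \<le> s2 / sqrt n"
proof -
  show "integrable M (\<lambda>\<omega>. MT n \<omega> / (n * sqrt n))" using MT_L1(1) by simp
  have "expectation (\<lambda>\<omega>. \<bar>MT n \<omega> / (n * sqrt n)\<bar>) = expectation (\<lambda>\<omega>. \<bar>MT n \<omega>\<bar>) / (n * sqrt n)"
    by (simp add: abs_divide abs_mult)
  also have "\<dots> \<le> n * s2 / (n * sqrt n)"
    by (intro divide_right_mono MT_L1) auto
  also have "\<dots> = s2 / sqrt n" by simp
  finally show "expectation (\<lambda>\<omega>. \<bar>MT n \<omega> / (n * sqrt n)\<bar>) \<le> s2 / sqrt n" .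
qed

lemma MT_law: "conv_prob M (\<lambda>n \<omega>. MT n \<omega> / (n * sqrt n)) 0"
  by (rule conv_prob_L1[OF MT_scaled_L1]) real_asymp

lemma MS_bounded: "bounded_in_prob M (\<lambda>n \<omega>. MS n \<omega> / (n * sqrt n))"
  unfolding MS_eq
proof (rule bounded_in_prob_add)
  show "bounded_in_prob M (\<lambda>n \<omega>. psum (ramp n) 0 (n - 1) \<omega> / sqrt n)"
    by (rule bounded_in_prob_psum[where K=\<mu>]) (use ramp_bound mu_pos in auto)
  show "bounded_in_prob M (\<lambda>n \<omega>. MT n \<omega> / (n * sqrt n))"
  proof (rule bounded_in_prob_L1[OF MT_scaled_L1(1)])
    fix n :: nat
    have "s2 / sqrt n \<le> s2"
      using s2_nonneg by (cases "n = 0") (auto simp: divide_le_eq intro: mult_left_mono[of 1 _ s2, simplified])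
    then show "expectation (\<lambda>\<omega>. \<bar>MT n \<omega> / (n * sqrt n)\<bar>) \<le> s2"
      using MT_scaled_L1(2)[of n] by linarith
  qed
qed measurable

lemma EM_bounded: "bounded_in_prob M (\<lambda>n \<omega>. EM n \<omega> / sqrt n)"
  unfolding EM_eq by (rule bounded_in_prob_psum[where K="max \<mu> 1"]) (use mu_pos in auto)

text \<open>
  \<open>Lin\<close> is the leading term of \<open>\<surd>n \<beta>\<close>.  Its coefficients \<open>6\<close> and \<open>4\<close> over \<open>D = \<mu>\<^sup>2 + 4 s2\<close> are the
  limits \<open>\<mu>\<^sup>2 / 2\<close> and \<open>\<mu>\<^sup>2 / 3\<close> of the normalised sums \<open>SE\<close> and \<open>SS\<close>, divided by the limit
  \<open>\<mu>\<^sup>2 D / 12\<close> of the normalised Gram determinant.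
\<close>

definition lin_coeff :: "nat \<Rightarrow> nat \<Rightarrow> real" where
  "lin_coeff n i = (6 * ramp n i - 4 * \<mu>) / (\<mu>\<^sup>2 + 4 * s2)"

definition Lin :: "nat \<Rightarrow> 'a \<Rightarrow> real" where
  "Lin n \<omega> = psum (lin_coeff n) (- 4 / (\<mu>\<^sup>2 + 4 * s2)) (n - 1) \<omega> / sqrt n"

lemma Lin_measurable [measurable]: "Lin n \<in> borel_measurable M"
  unfolding Lin_def by measurable

lemma D_pos: "0 < \<mu>\<^sup>2 + 4 * s2"
  using mu_pos s2_nonneg by (intro add_pos_nonneg) auto

lemma Lin_eq: "Lin n \<omega> = 6 / (\<mu>\<^sup>2 + 4 * s2) * (psum (ramp n) 0 (n - 1) \<omega> / sqrt n)
    - 4 / (\<mu>\<^sup>2 + 4 * s2) * (EM n \<omega> / sqrt n)"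
proof -
  have "psum (lin_coeff n) (- 4 / (\<mu>\<^sup>2 + 4 * s2)) (n - 1) \<omega> = 6 / (\<mu>\<^sup>2 + 4 * s2) * psum (ramp n) 0 (n - 1) \<omega>
    - 4 / (\<mu>\<^sup>2 + 4 * s2) * EM n \<omega>"
    unfolding EM_eq psum_def sum_distrib_left sum_subtractf[symmetric] summand_def lin_coeff_def
    by (intro sum.cong refl) (simp add: diff_divide_distrib add_divide_distrib algebra_simps)
  then show ?thesis by (simp add: Lin_def diff_divide_distrib)
qed

lemma lin_coeff_bound:
  "\<bar>lin_coeff n i\<bar> \<le> (10 * \<mu> + 4) / (\<mu>\<^sup>2 + 4 * s2)" "\<bar>- 4 / (\<mu>\<^sup>2 + 4 * s2)\<bar> \<le> (10 * \<mu> + 4) / (\<mu>\<^sup>2 + 4 * s2)"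
  using ramp_bound[of n i] mu_pos D_pos
  by (auto simp: lin_coeff_def abs_divide intro!: divide_right_mono)

text \<open>
  A Riemann sum: the deterministic weights are \<open>(\<mu> / D) (6 t - 4)\<close> at \<open>t = (j + 1) / n\<close>, and
  \<open>\<integral> (6 t - 4)\<^sup>2 dt = 4\<close> over the unit interval.  The limit \<open>s2 (4 \<mu>\<^sup>2 + 16 s2) / D\<^sup>2\<close> simplifies to
  \<open>4 s2 / D\<close>.
\<close>

lemma lin_variance:
  "(\<lambda>n. s2 * (\<Sum>j<n - 1. (lin_coeff n j)\<^sup>2 + (- 4 / (\<mu>\<^sup>2 + 4 * s2))\<^sup>2 * s2) / real n)
    \<longlonglongrightarrow> 4 * s2 / (\<mu>\<^sup>2 + 4 * s2)"
proof -
  define D where "D = \<mu>\<^sup>2 + 4 * s2"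
  have "0 < D" using D_pos by (simp add: D_def)
  have sum: "(\<Sum>j<l. (6 * (real (Suc j) / x) - 4)\<^sup>2) = 36 / x\<^sup>2 * (real l * (real l + 1) * (2 * real l + 1) / 6)
      - 48 / x * (real l * (real l + 1) / 2) + 16 * real l" if "x \<noteq> 0" for l and x :: real
  proof -
    have linear: "(\<Sum>i<l. real (Suc i)) = real l * (real l + 1) / 2"
      by (induction l) (simp_all add: field_simps)
    have "(\<Sum>j<l. (6 * (real (Suc j) / x) - 4)\<^sup>2) = (\<Sum>j<l. 36 / x\<^sup>2 * (real (Suc j))\<^sup>2 - 48 / x * real (Suc j) + 16)"
    proof (intro sum.cong refl)
      have "(6 * (y / x) - 4)\<^sup>2 = 36 / x\<^sup>2 * y\<^sup>2 - 48 / x * y + 16" for y :: real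
        using that by (simp add: power2_eq_square field_simps)
      then show "(6 * (real (Suc j) / x) - 4)\<^sup>2 = 36 / x\<^sup>2 * (real (Suc j))\<^sup>2 - 48 / x * real (Suc j) + 16" for j .
    qed
    also have "\<dots> = 36 / x\<^sup>2 * (\<Sum>i<l. (real (Suc i))\<^sup>2) - 48 / x * (\<Sum>i<l. real (Suc i)) + 16 * real l"
      by (simp only: sum.distrib sum_subtractf sum_distrib_left) simp
    finally show ?thesis unfolding sum_Suc_squares linear .
  qed
  define f where "f = (\<lambda>x. s2 * (\<mu>\<^sup>2 / D\<^sup>2 * (36 / x\<^sup>2 * ((x - 1) * ((x - 1) + 1) * (2 * (x - 1) + 1) / 6)
      - 48 / x * ((x - 1) * ((x - 1) + 1) / 2) + 16 * (x - 1)) + (x - 1) * (16 / D\<^sup>2 * s2)) / x)"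
  have eq: "s2 * (\<Sum>j<n - 1. (lin_coeff n j)\<^sup>2 + (- 4 / D)\<^sup>2 * s2) / real n = f (real n)" if "1 \<le> n" for n
  proof -
    have "(\<Sum>j<n - 1. (lin_coeff n j)\<^sup>2 + (- 4 / D)\<^sup>2 * s2)
        = (\<Sum>j<n - 1. \<mu>\<^sup>2 / D\<^sup>2 * (6 * (real (Suc j) / n) - 4)\<^sup>2 + 16 / D\<^sup>2 * s2)"
    proof (intro sum.cong refl)
      fix j assume "j \<in> {..<n - 1}"
      then have "j < n" by auto
      moreover have "(6 * (\<mu> * y / x) - 4 * \<mu>) / D = \<mu> / D * (6 * (y / x) - 4)" for x y :: real
        by (simp add: algebra_simps diff_divide_distrib)
      ultimately have "lin_coeff n j = \<mu> / D * (6 * (real (Suc j) / n) - 4)"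
        unfolding lin_coeff_def ramp_def D_def[symmetric] by (simp only: if_True)
      then show "(lin_coeff n j)\<^sup>2 + (- 4 / D)\<^sup>2 * s2 = \<mu>\<^sup>2 / D\<^sup>2 * (6 * (real (Suc j) / n) - 4)\<^sup>2 + 16 / D\<^sup>2 * s2"
        by (simp add: power_mult_distrib power_divide)
    qed
    also have "\<dots> = \<mu>\<^sup>2 / D\<^sup>2 * (\<Sum>j<n - 1. (6 * (real (Suc j) / n) - 4)\<^sup>2) + real (n - 1) * (16 / D\<^sup>2 * s2)"
      by (simp add: sum.distrib sum_distrib_left)
    finally have *: "(\<Sum>j<n - 1. (lin_coeff n j)\<^sup>2 + (- 4 / D)\<^sup>2 * s2)
      = \<mu>\<^sup>2 / D\<^sup>2 * (\<Sum>j<n - 1. (6 * (real (Suc j) / n) - 4)\<^sup>2) + real (n - 1) * (16 / D\<^sup>2 * s2)" .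
    have n: "real n \<noteq> 0" "real (n - 1) = real n - 1" using that by (auto simp: of_nat_diff)
    show ?thesis unfolding * sum[OF n(1)] n(2) f_def ..
  qed
  have "(\<lambda>n. f (real n)) \<longlonglongrightarrow> s2 * (\<mu>\<^sup>2 / D\<^sup>2 * 4 + 16 / D\<^sup>2 * s2)"
    unfolding f_def by real_asymp
  also have "s2 * (\<mu>\<^sup>2 / D\<^sup>2 * 4 + 16 / D\<^sup>2 * s2) = s2 * (4 * (\<mu>\<^sup>2 + 4 * s2) / D\<^sup>2)"
    by (simp add: add_divide_distrib algebra_simps)
  also have "\<dots> = 4 * s2 / D"
    unfolding D_def[symmetric] using \<open>0 < D\<close> by (simp add: power2_eq_square)
  finally have "(\<lambda>n. s2 * (\<Sum>j<n - 1. (lin_coeff n j)\<^sup>2 + (- 4 / D)\<^sup>2 * s2) / real n) \<longlonglongrightarrow> 4 * s2 / D"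
    by (rule Lim_transform_eventually)
       (unfold eventually_sequentially, intro exI[of _ 1] allI impI, rule eq[symmetric])
  then show ?thesis unfolding D_def .
qed

lemma Lin_weak_limit:
  fixes g :: "real \<Rightarrow> real"
  assumes "\<tau>\<^sup>2 = 4 * s2 / (\<mu>\<^sup>2 + 4 * s2)"
    and "prob_space N" "distributed N lborel Z std_normal_density"
    and "continuous_on UNIV g" "bounded (range g)"
  shows "(\<lambda>n. expectation (\<lambda>\<omega>. g (Lin n \<omega>))) \<longlonglongrightarrow> integral\<^sup>L N (\<lambda>\<omega>. g (\<tau> * Z \<omega>))"
  unfolding Lin_def
  by (rule psum_weak_limit[OF lin_coeff_bound]) (use assms lin_variance in auto)

lemma Lin_bounded: "bounded_in_prob M Lin"
  unfolding Lin_def[abs_def] by (rule bounded_in_prob_psum[OF lin_coeff_bound]) auto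

text \<open>
  The determinant of the Gram matrix of level and increment, divided by its order \<open>n\<^sup>4\<close>.
\<close>

definition gram_det :: "nat \<Rightarrow> 'a \<Rightarrow> real" where
  "gram_det n \<omega> = (SS n \<omega> / real n ^ 3) * (EE n \<omega> / n) - (SE n \<omega> / real n ^ 2) * (SE n \<omega> / real n ^ 2)"

lemma gram_det_measurable [measurable]: "gram_det n \<in> borel_measurable M"
  unfolding gram_det_def by measurable

text \<open>
  The limit is positive because level and increment have different profiles, \<open>\<mu> t\<close> against a
  constant with noise, so they are not asymptotically collinear.
\<close>

lemma gram_det_law: "conv_prob M gram_det (\<mu>\<^sup>2 * (\<mu>\<^sup>2 + 4 * s2) / 12)"
proof -
  have 1: "conv_prob M (\<lambda>n \<omega>. (SS n \<omega> / real n ^ 3) * (EE n \<omega> / n)) (\<mu>\<^sup>2 / 3 * (\<mu>\<^sup>2 + s2))"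
    by (rule conv_prob_mult[OF _ _ SS_law EE_law]) measurable
  have 2: "conv_prob M (\<lambda>n \<omega>. (SE n \<omega> / real n ^ 2) * (SE n \<omega> / real n ^ 2)) (\<mu>\<^sup>2 / 2 * (\<mu>\<^sup>2 / 2))"
    by (rule conv_prob_mult[OF _ _ SE_law SE_law]) measurable
  have "conv_prob M gram_det (\<mu>\<^sup>2 / 3 * (\<mu>\<^sup>2 + s2) - \<mu>\<^sup>2 / 2 * (\<mu>\<^sup>2 / 2))"
    unfolding gram_det_def[abs_def] by (rule conv_prob_diff[OF _ _ 1 2]) measurable
  also have "\<mu>\<^sup>2 / 3 * (\<mu>\<^sup>2 + s2) - \<mu>\<^sup>2 / 2 * (\<mu>\<^sup>2 / 2) = \<mu>\<^sup>2 * (\<mu>\<^sup>2 + 4 * s2) / 12"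
    by (simp add: field_simps)
  finally show ?thesis .
qed

lemma gram_det_limit_nonzero: "\<mu>\<^sup>2 * (\<mu>\<^sup>2 + 4 * s2) / 12 \<noteq> 0"
  using mu_pos D_pos by simp

lemma ratio_laws:
  shows "conv_prob M (\<lambda>n \<omega>. SE n \<omega> / real n ^ 2 / gram_det n \<omega> - 6 / (\<mu>\<^sup>2 + 4 * s2)) 0"
    and "conv_prob M (\<lambda>n \<omega>. SS n \<omega> / real n ^ 3 / gram_det n \<omega> - 4 / (\<mu>\<^sup>2 + 4 * s2)) 0"
    and "conv_prob M (\<lambda>n \<omega>. EE n \<omega> / n / gram_det n \<omega> * (1 / n)) 0"
    and "conv_prob M (\<lambda>n \<omega>. SE n \<omega> / real n ^ 2 / gram_det n \<omega> * (1 / n)) 0"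
proof -
  let ?d = "\<mu>\<^sup>2 * (\<mu>\<^sup>2 + 4 * s2) / 12"
  have 1: "conv_prob M (\<lambda>n \<omega>. SE n \<omega> / real n ^ 2 / gram_det n \<omega>) (\<mu>\<^sup>2 / 2 / ?d)"
    by (rule conv_prob_divide[OF _ _ SE_law gram_det_law gram_det_limit_nonzero]) measurable
  have 2: "conv_prob M (\<lambda>n \<omega>. SS n \<omega> / real n ^ 3 / gram_det n \<omega>) (\<mu>\<^sup>2 / 3 / ?d)"
    by (rule conv_prob_divide[OF _ _ SS_law gram_det_law gram_det_limit_nonzero]) measurable
  have 3: "conv_prob M (\<lambda>n \<omega>. EE n \<omega> / n / gram_det n \<omega>) ((\<mu>\<^sup>2 + s2) / ?d)"
    by (rule conv_prob_divide[OF _ _ EE_law gram_det_law gram_det_limit_nonzero]) measurable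
  have "(\<lambda>n. 1 / real n) \<longlonglongrightarrow> 0" by real_asymp
  note inv = conv_prob_const[OF this]
  have e1: "\<mu>\<^sup>2 / 2 / ?d - 6 / (\<mu>\<^sup>2 + 4 * s2) = 0" and e2: "\<mu>\<^sup>2 / 3 / ?d - 4 / (\<mu>\<^sup>2 + 4 * s2) = 0"
    using mu_pos by simp_all
  show "conv_prob M (\<lambda>n \<omega>. SE n \<omega> / real n ^ 2 / gram_det n \<omega> - 6 / (\<mu>\<^sup>2 + 4 * s2)) 0"
    unfolding e1[symmetric] by (rule conv_prob_diff[OF _ _ 1 conv_prob_const[OF tendsto_const]]) measurable
  show "conv_prob M (\<lambda>n \<omega>. SS n \<omega> / real n ^ 3 / gram_det n \<omega> - 4 / (\<mu>\<^sup>2 + 4 * s2)) 0"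
    unfolding e2[symmetric] by (rule conv_prob_diff[OF _ _ 2 conv_prob_const[OF tendsto_const]]) measurable
  have "conv_prob M (\<lambda>n \<omega>. EE n \<omega> / n / gram_det n \<omega> * (1 / n)) ((\<mu>\<^sup>2 + s2) / ?d * 0)"
    by (rule conv_prob_mult[OF _ _ 3 inv]) measurable
  then show "conv_prob M (\<lambda>n \<omega>. EE n \<omega> / n / gram_det n \<omega> * (1 / n)) 0" by (simp only: mult_zero_right)
  have "conv_prob M (\<lambda>n \<omega>. SE n \<omega> / real n ^ 2 / gram_det n \<omega> * (1 / n)) (\<mu>\<^sup>2 / 2 / ?d * 0)"
    by (rule conv_prob_mult[OF _ _ 1 inv]) measurable
  then show "conv_prob M (\<lambda>n \<omega>. SE n \<omega> / real n ^ 2 / gram_det n \<omega> * (1 / n)) 0" by (simp only: mult_zero_right)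
qed

text \<open>
  In Cramer's rule the noise sums are bounded in probability, so the normalised Gram entries may be
  replaced by their limits; the remaining term \<open>MT\<close> is negligible.
\<close>

lemma second_coefficient_expansion:
  assumes [measurable]: "\<And>n. (\<lambda>\<omega>. sqrt (real n) * \<beta> n \<omega>) \<in> borel_measurable M"
    and eq: "\<And>n. 1 \<le> n \<Longrightarrow> AE \<omega> in M. \<beta> n \<omega> * (SS n \<omega> * EE n \<omega> - (SE n \<omega>)\<^sup>2) = MS n \<omega> * SE n \<omega> - EM n \<omega> * SS n \<omega>"
  shows "conv_prob M (\<lambda>n \<omega>. sqrt (real n) * \<beta> n \<omega> - Lin n \<omega>) 0"
proof (rule conv_prob_of_equation[where D=gram_det, OF _ _ _ _ gram_det_law gram_det_limit_nonzero])
  let ?D = "\<mu>\<^sup>2 + 4 * s2"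
  let ?a = "\<lambda>n \<omega>. MS n \<omega> / (n * sqrt n)" and ?b = "\<lambda>n \<omega>. EM n \<omega> / sqrt n"
  let ?r = "\<lambda>n \<omega>. SE n \<omega> / real n ^ 2 / gram_det n \<omega> - 6 / ?D"
  let ?p = "\<lambda>n \<omega>. SS n \<omega> / real n ^ 3 / gram_det n \<omega> - 4 / ?D"
  let ?U = "\<lambda>n \<omega>. ?a n \<omega> * ?r n \<omega> - ?b n \<omega> * ?p n \<omega> + 6 / ?D * (MT n \<omega> / (n * sqrt n))"
  have 1: "conv_prob M (\<lambda>n \<omega>. ?a n \<omega> * ?r n \<omega>) 0"
    by (rule conv_prob_bounded_mult[OF _ _ MS_bounded ratio_laws(1)]) measurable
  have 2: "conv_prob M (\<lambda>n \<omega>. ?b n \<omega> * ?p n \<omega>) 0"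
    by (rule conv_prob_bounded_mult[OF _ _ EM_bounded ratio_laws(2)]) measurable
  have 3: "conv_prob M (\<lambda>n \<omega>. 6 / ?D * (MT n \<omega> / (n * sqrt n))) (6 / ?D * 0)"
    by (rule conv_prob_mult[OF _ _ conv_prob_const[OF tendsto_const] MT_law]) measurable
  have 4: "conv_prob M (\<lambda>n \<omega>. ?a n \<omega> * ?r n \<omega> - ?b n \<omega> * ?p n \<omega>) (0 - 0)"
    by (rule conv_prob_diff[OF _ _ 1 2]) measurable
  have "conv_prob M ?U (0 - 0 + 6 / ?D * 0)"
    by (rule conv_prob_add[OF _ _ 4 3]) measurable
  then show "conv_prob M ?U 0" by (simp only: mult_zero_right add_0_right diff_0_right)
  show "?U n \<in> borel_measurable M" for n by measurable
  have "AE \<omega> in M. gram_det n \<omega> \<noteq> 0 \<longrightarrow> sqrt (real n) * \<beta> n \<omega> - Lin n \<omega> = ?U n \<omega>" if "1 \<le> n" for n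
    using eq[OF that]
  proof eventually_elim
    case (elim \<omega>)
    show ?case
    proof
      assume d: "gram_det n \<omega> \<noteq> 0"
      have "sqrt n * \<beta> n \<omega> = ?a n \<omega> * (SE n \<omega> / real n ^ 2 / gram_det n \<omega>) - ?b n \<omega> * (SS n \<omega> / real n ^ 3 / gram_det n \<omega>)"
        using scaled_solution(1)[OF _ elim, of "sqrt n" "gram_det n \<omega>"] that d by (simp add: gram_det_def power2_eq_square)
      moreover have "Lin n \<omega> = 6 / ?D * (?a n \<omega> - MT n \<omega> / (n * sqrt n)) - 4 / ?D * ?b n \<omega>"
        unfolding Lin_eq MS_eq by simp
      ultimately show "sqrt (real n) * \<beta> n \<omega> - Lin n \<omega> = ?U n \<omega>"
        by (simp only: algebra_simps)
    qed
  qed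
  then show "\<forall>\<^sub>F n in sequentially. AE \<omega> in M. gram_det n \<omega> \<noteq> 0 \<longrightarrow> sqrt (real n) * \<beta> n \<omega> - Lin n \<omega> = ?U n \<omega>"
    unfolding eventually_sequentially by blast
qed measurable

text \<open>
  The coefficient \<open>\<gamma> = \<alpha> - 1 + \<beta>\<close> belongs to the level, a regressor of order \<open>n\<close>, and is
  therefore estimated with an error of order \<open>1 / (n \<surd>n)\<close> instead of \<open>1 / \<surd>n\<close>.
\<close>

lemma coefficient_sum_negligible:
  assumes [measurable]: "\<And>n. (\<lambda>\<omega>. sqrt (real n) * \<gamma> n \<omega>) \<in> borel_measurable M"
    and eq: "\<And>n. 1 \<le> n \<Longrightarrow> AE \<omega> in M. \<gamma> n \<omega> * (SS n \<omega> * EE n \<omega> - (SE n \<omega>)\<^sup>2) = MS n \<omega> * EE n \<omega> - EM n \<omega> * SE n \<omega>"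
  shows "conv_prob M (\<lambda>n \<omega>. sqrt (real n) * \<gamma> n \<omega>) 0"
proof (rule conv_prob_of_equation[where D=gram_det, OF _ _ _ _ gram_det_law gram_det_limit_nonzero])
  let ?a = "\<lambda>n \<omega>. MS n \<omega> / (n * sqrt n)" and ?b = "\<lambda>n \<omega>. EM n \<omega> / sqrt n"
  let ?q = "\<lambda>n \<omega>. EE n \<omega> / n / gram_det n \<omega> * (1 / n)"
  let ?r = "\<lambda>n \<omega>. SE n \<omega> / real n ^ 2 / gram_det n \<omega> * (1 / n)"
  let ?U = "\<lambda>n \<omega>. ?a n \<omega> * ?q n \<omega> - ?b n \<omega> * ?r n \<omega>"
  have 1: "conv_prob M (\<lambda>n \<omega>. ?a n \<omega> * ?q n \<omega>) 0"
    by (rule conv_prob_bounded_mult[OF _ _ MS_bounded ratio_laws(3)]) measurable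
  have 2: "conv_prob M (\<lambda>n \<omega>. ?b n \<omega> * ?r n \<omega>) 0"
    by (rule conv_prob_bounded_mult[OF _ _ EM_bounded ratio_laws(4)]) measurable
  have "conv_prob M ?U (0 - 0)"
    by (rule conv_prob_diff[OF _ _ 1 2]) measurable
  then show "conv_prob M ?U 0" by (simp only: diff_0_right)
  show "?U n \<in> borel_measurable M" for n by measurable
  have "AE \<omega> in M. gram_det n \<omega> \<noteq> 0 \<longrightarrow> sqrt (real n) * \<gamma> n \<omega> = ?U n \<omega>" if "1 \<le> n" for n
    using eq[OF that]
  proof eventually_elim
    case (elim \<omega>)
    show ?case
      using scaled_solution(2)[OF _ elim, of "sqrt n" "gram_det n \<omega>"] that by (simp add: gram_det_def power2_eq_square)
  qed
  then show "\<forall>\<^sub>F n in sequentially. AE \<omega> in M. gram_det n \<omega> \<noteq> 0 \<longrightarrow> sqrt (real n) * \<gamma> n \<omega> = ?U n \<omega>"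
    unfolding eventually_sequentially by blast
qed measurable

end

section \<open>The INAR(2) process with parameter (1, 0)\<close>

lemma (in prob_space) iid_bernoulli_degenerate:
  assumes "iid_bernoulli M p Y" "p \<in> {0, 1}" "1 \<le> j"
  shows "AE \<omega> in M. real (Y j \<omega>) = p"
proof -
  have meas: "Y j \<in> measurable M (count_space UNIV)"
    using assms by (auto simp: iid_bernoulli_def indep_vars_def)
  have "distr M (count_space UNIV) (Y j) = measure_pmf (map_pmf of_bool (bernoulli_pmf p))"
    using assms by (simp add: iid_bernoulli_def)
  moreover have "AE y in measure_pmf (map_pmf of_bool (bernoulli_pmf p)). real y = p"
    using assms(2) by (auto simp: AE_measure_pmf_iff set_pmf_iff)
  ultimately have "AE y in distr M (count_space UNIV) (Y j). real y = p" by (simp only:)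
  then show ?thesis using meas by (subst (asm) AE_distr_iff) auto
qed

text \<open>
  With parameters \<open>1\<close> and \<open>0\<close> the first thinning keeps every individual and the second one none,
  so the recursion is \<open>X\<^sub>k = X\<^sub>k\<^sub>-\<^sub>1 + \<epsilon>\<^sub>k\<close>.
\<close>

lemma (in prob_space) INAR2_1_0_random_walk:
  assumes X: "INAR2 M 1 0 \<epsilon> X"
    and X0: "AE \<omega> in M. X 0 \<omega> = 0" and X1: "AE \<omega> in M. X (-1) \<omega> = 0"
  shows "AE \<omega> in M. \<forall>k. X (int k) \<omega> = (\<Sum>i<k. \<epsilon> (Suc i) \<omega>)"
proof -
  obtain \<xi> \<eta> where bern: "\<And>k. 1 \<le> k \<Longrightarrow> iid_bernoulli M 1 (\<xi> k)" "\<And>k. 1 \<le> k \<Longrightarrow> iid_bernoulli M 0 (\<eta> k)"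
    and rec: "\<And>k. 1 \<le> k \<Longrightarrow> AE \<omega> in M. X (int k) \<omega> =
      (\<Sum>j=1..X (int k - 1) \<omega>. \<xi> k j \<omega>) + (\<Sum>j=1..X (int k - 2) \<omega>. \<eta> k j \<omega>) + \<epsilon> k \<omega>"
    using X unfolding INAR2_def by blast
  have "AE \<omega> in M. \<forall>k\<in>{1..}. \<forall>j\<in>{1..}. \<xi> k j \<omega> = 1"
    using iid_bernoulli_degenerate[OF bern(1)] by (simp add: AE_ball_countable)
  moreover have "AE \<omega> in M. \<forall>k\<in>{1..}. \<forall>j\<in>{1..}. \<eta> k j \<omega> = 0"
    using iid_bernoulli_degenerate[OF bern(2)] by (simp add: AE_ball_countable)
  moreover have "AE \<omega> in M. \<forall>k\<in>{1..}. X (int k) \<omega> =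
      (\<Sum>j=1..X (int k - 1) \<omega>. \<xi> k j \<omega>) + (\<Sum>j=1..X (int k - 2) \<omega>. \<eta> k j \<omega>) + \<epsilon> k \<omega>"
    using rec by (simp add: AE_ball_countable)
  ultimately show ?thesis using X0
  proof eventually_elim
    case (elim \<omega>)
    have step: "X (int (Suc k)) \<omega> = X (int k) \<omega> + \<epsilon> (Suc k) \<omega>" for k
    proof -
      have "X (int (Suc k)) \<omega> = (\<Sum>j=1..X (int (Suc k) - 1) \<omega>. \<xi> (Suc k) j \<omega>)
          + (\<Sum>j=1..X (int (Suc k) - 2) \<omega>. \<eta> (Suc k) j \<omega>) + \<epsilon> (Suc k) \<omega>"
        using elim(3) by (auto simp del: of_nat_Suc)
      also have "(\<Sum>j=1..X (int (Suc k) - 1) \<omega>. \<xi> (Suc k) j \<omega>) = (\<Sum>j=1..X (int (Suc k) - 1) \<omega>. 1)"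
        using elim(1) by (intro sum.cong) auto
      also have "(\<Sum>j=1..X (int (Suc k) - 2) \<omega>. \<eta> (Suc k) j \<omega>) = 0"
        using elim(2) by (intro sum.neutral) auto
      finally show ?thesis by simp
    qed
    show ?case
    proof
      fix k show "X (int k) \<omega> = (\<Sum>i<k. \<epsilon> (Suc i) \<omega>)"
        using elim(4) by (induction k) (simp_all add: step del: of_nat_Suc)
    qed
  qed
qed

text \<open>
  Here the fourth moment is used: it makes the squares of the innovations square integrable, so that
  Chebyshev's inequality gives their law of large numbers.
\<close>

lemma (in prob_space) drift_walk_of_iid:
  fixes \<epsilon> :: "nat \<Rightarrow> 'a \<Rightarrow> nat"
  assumes iid: "iid_nat M \<epsilon>"
    and fourth: "integrable M (\<lambda>\<omega>. real (\<epsilon> 1 \<omega>) ^ 4)"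
    and \<mu>: "\<mu> = expectation (\<lambda>\<omega>. real (\<epsilon> 1 \<omega>))"
    and s2: "s2 = expectation (\<lambda>\<omega>. (real (\<epsilon> 1 \<omega>) - \<mu>)\<^sup>2)"
    and pos: "0 < \<mu>"
  shows "drift_walk M (\<lambda>i \<omega>. real (\<epsilon> (Suc i) \<omega>) - \<mu>) s2
      (expectation (\<lambda>\<omega>. (1 + \<bar>real (\<epsilon> 1 \<omega>) - \<mu>\<bar>) ^ 3)) \<mu>"
proof -
  have meas [measurable]: "\<epsilon> (Suc i) \<in> measurable M (count_space UNIV)" for i
    using iid by (auto simp: iid_nat_def indep_vars_def)
  have [measurable]: "\<epsilon> 1 \<in> measurable M (count_space UNIV)" using meas[of 0] by simp
  have law: "distr M (count_space UNIV) (\<epsilon> (Suc i)) = distr M (count_space UNIV) (\<epsilon> 1)" for i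
    using iid unfolding iid_nat_def by (metis le_add1 plus_1_eq_Suc)
  have E: "expectation (\<lambda>\<omega>. g (\<epsilon> (Suc i) \<omega>)) = expectation (\<lambda>\<omega>. g (\<epsilon> 1 \<omega>))" for g :: "nat \<Rightarrow> real" and i
    using integral_distr[OF meas, of g i] integral_distr[OF meas, of g 0] law[of i] by simp
  have I: "integrable M (\<lambda>\<omega>. g (\<epsilon> (Suc i) \<omega>)) \<longleftrightarrow> integrable M (\<lambda>\<omega>. g (\<epsilon> 1 \<omega>))" for g :: "nat \<Rightarrow> real" and i
    using integrable_distr_eq[OF meas, of g i] integrable_distr_eq[OF meas, of g 0] law[of i] by simp
  have indep: "indep_vars (\<lambda>_. borel) (\<lambda>i \<omega>. g (\<epsilon> (Suc i) \<omega>)) UNIV" for g :: "nat \<Rightarrow> real"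
  proof -
    have "indep_vars (\<lambda>j. PiM {Suc j} (\<lambda>_. count_space UNIV)) (\<lambda>j \<omega>. \<lambda>i\<in>{Suc j}. \<epsilon> i \<omega>) UNIV"
      using iid by (intro indep_vars_restrict[where I="{1..}"]) (auto simp: iid_nat_def disjoint_family_on_def)
    then have "indep_vars (\<lambda>_. borel) (\<lambda>j \<omega>. (\<lambda>z. g (z (Suc j))) (\<lambda>i\<in>{Suc j}. \<epsilon> i \<omega>)) UNIV"
      by (rule indep_vars_compose2) measurable
    then show ?thesis by simp
  qed
  have two: "(x + y)\<^sup>2 \<le> 2 * (x\<^sup>2 + y\<^sup>2)" for x y :: real
    using sum_squares_bound[of x y] by (simp add: power2_sum)
  have dom: "(1 + \<mu> + real k) ^ 4 \<le> 8 * ((1 + \<mu>) ^ 4 + real k ^ 4)" for k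
  proof -
    have "(1 + \<mu> + real k) ^ 4 = ((1 + \<mu> + real k)\<^sup>2)\<^sup>2" by simp
    also have "\<dots> \<le> (2 * ((1 + \<mu>)\<^sup>2 + (real k)\<^sup>2))\<^sup>2" by (intro power_mono two) auto
    also have "\<dots> = 4 * ((1 + \<mu>)\<^sup>2 + (real k)\<^sup>2)\<^sup>2" unfolding power_mult_distrib by simp
    also have "\<dots> \<le> 4 * (2 * (((1 + \<mu>)\<^sup>2)\<^sup>2 + ((real k)\<^sup>2)\<^sup>2))" by (intro mult_left_mono two) auto
    finally show ?thesis by simp
  qed
  have int: "integrable M (\<lambda>\<omega>. g (\<epsilon> 1 \<omega>))" if g: "\<And>k. \<bar>g k\<bar> \<le> (1 + \<mu> + real k) ^ 4" for g :: "nat \<Rightarrow> real"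
  proof (rule Bochner_Integration.integrable_bound)
    show "integrable M (\<lambda>\<omega>. 8 * ((1 + \<mu>) ^ 4 + real (\<epsilon> 1 \<omega>) ^ 4))" using fourth by simp
    show "AE \<omega> in M. norm (g (\<epsilon> 1 \<omega>)) \<le> norm (8 * ((1 + \<mu>) ^ 4 + real (\<epsilon> 1 \<omega>) ^ 4))"
      using order_trans[OF g dom] by simp
  qed measurable
  have small: "x ^ j \<le> (1 + \<mu> + real k) ^ 4" if "0 \<le> x" "x \<le> 1 + \<mu> + real k" "j \<le> 4" for x :: real and k j
  proof -
    have "x ^ j \<le> (1 + \<mu> + real k) ^ j" using that by (intro power_mono)
    also have "\<dots> \<le> (1 + \<mu> + real k) ^ 4" using that pos by (intro power_increasing) auto
    finally show ?thesis .
  qed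
  have int1: "integrable M (\<lambda>\<omega>. real (\<epsilon> 1 \<omega>))"
    by (rule int) (use small[of "real k" k 1 for k] pos in auto)
  have int2: "integrable M (\<lambda>\<omega>. (real (\<epsilon> 1 \<omega>))\<^sup>2)"
    by (rule int) (use small[of "real k" k 2 for k] pos in auto)
  have int3: "integrable M (\<lambda>\<omega>. (1 + \<bar>real (\<epsilon> 1 \<omega>) - \<mu>\<bar>) ^ 3)"
  proof (rule int)
    fix k
    have "(1 + \<bar>real k - \<mu>\<bar>) ^ 3 \<le> (1 + \<mu> + real k) ^ 4"
      using pos by (intro small) auto
    then show "\<bar>(1 + \<bar>real k - \<mu>\<bar>) ^ 3\<bar> \<le> (1 + \<mu> + real k) ^ 4" by simp
  qed
  define v where "v = expectation (\<lambda>\<omega>. (real (\<epsilon> 1 \<omega>))\<^sup>2)"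
  have v: "v = \<mu>\<^sup>2 + s2"
  proof -
    have "s2 = expectation (\<lambda>\<omega>. (real (\<epsilon> 1 \<omega>))\<^sup>2 - 2 * \<mu> * real (\<epsilon> 1 \<omega>) + \<mu>\<^sup>2)"
      unfolding s2 by (simp add: power2_diff algebra_simps)
    also have "\<dots> = v - 2 * \<mu> * \<mu> + \<mu>\<^sup>2"
      using int1 int2 by (simp add: v_def prob_space \<mu>)
    finally show ?thesis by (simp add: power2_eq_square)
  qed
  let ?y = "\<lambda>i \<omega>. (real (\<epsilon> (Suc i) \<omega>))\<^sup>2 - v"
  define C where "C = expectation (\<lambda>\<omega>. ((real (\<epsilon> 1 \<omega>))\<^sup>2 - v)\<^sup>2)"
  have y_int: "integrable M (\<lambda>\<omega>. (?y i \<omega>)\<^sup>2)" for i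
  proof -
    have "integrable M (\<lambda>\<omega>. real (\<epsilon> 1 \<omega>) ^ 4 - 2 * v * (real (\<epsilon> 1 \<omega>))\<^sup>2 + v\<^sup>2)"
      using fourth int2 by simp
    then have "integrable M (\<lambda>\<omega>. ((real (\<epsilon> 1 \<omega>))\<^sup>2 - v)\<^sup>2)"
      by (simp add: power2_diff algebra_simps)
    then show ?thesis by (rule I[of "\<lambda>k. ((real k)\<^sup>2 - v)\<^sup>2", THEN iffD2])
  qed
  have y_mean: "expectation (?y i) = 0" for i
    unfolding E[of "\<lambda>k. (real k)\<^sup>2 - v"] using int2 by (simp add: v_def prob_space)
  have y_var: "expectation (\<lambda>\<omega>. (?y i \<omega>)\<^sup>2) \<le> C" for i
    unfolding E[of "\<lambda>k. ((real k)\<^sup>2 - v)\<^sup>2"] C_def by (rule order_refl)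
  note Y = centered_sum_second_moment[OF indep[of "\<lambda>k. (real k)\<^sup>2 - v"] y_int y_mean y_var]
  have Y_law: "conv_prob M (\<lambda>n \<omega>. (\<Sum>i<n. ?y i \<omega>) / real n) 0"
  proof (rule conv_prob_L2)
    fix n
    show "integrable M (\<lambda>\<omega>. ((\<Sum>i<n. ?y i \<omega>) / real n)\<^sup>2)"
      using Y(1) by (simp add: power_divide)
    show "expectation (\<lambda>\<omega>. ((\<Sum>i<n. ?y i \<omega>) / real n)\<^sup>2) \<le> C / n"
      using divide_right_mono[OF Y(2), of "(real n)\<^sup>2" n]
      by (cases "n = 0") (simp_all add: power_divide power2_eq_square)
    show "(\<lambda>n. C / real n) \<longlonglongrightarrow> 0" by real_asymp
  qed measurable
  show ?thesis
  proof (unfold_locales)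
    show "indep_vars (\<lambda>_. borel) (\<lambda>i \<omega>. real (\<epsilon> (Suc i) \<omega>) - \<mu>) UNIV"
      by (rule indep)
    fix i
    show "expectation (\<lambda>\<omega>. real (\<epsilon> (Suc i) \<omega>) - \<mu>) = 0"
      unfolding E[of "\<lambda>k. real k - \<mu>"] using int1 by (simp add: prob_space \<mu>)
    show "expectation (\<lambda>\<omega>. (real (\<epsilon> (Suc i) \<omega>) - \<mu>)\<^sup>2) = s2"
      unfolding E[of "\<lambda>k. (real k - \<mu>)\<^sup>2"] s2 ..
    show "integrable M (\<lambda>\<omega>. (1 + \<bar>real (\<epsilon> (Suc i) \<omega>) - \<mu>\<bar>) ^ 3)"
      by (rule I[of "\<lambda>k. (1 + \<bar>real k - \<mu>\<bar>) ^ 3", THEN iffD2, OF int3])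
    show "expectation (\<lambda>\<omega>. (1 + \<bar>real (\<epsilon> (Suc i) \<omega>) - \<mu>\<bar>) ^ 3) \<le> expectation (\<lambda>\<omega>. (1 + \<bar>real (\<epsilon> 1 \<omega>) - \<mu>\<bar>) ^ 3)"
      unfolding E[of "\<lambda>k. (1 + \<bar>real k - \<mu>\<bar>) ^ 3"] by (rule order_refl)
  next
    show "0 < \<mu>" by (rule pos)
    show "conv_prob M (\<lambda>n \<omega>. (\<Sum>i<n. (real (\<epsilon> (Suc i) \<omega>) - \<mu> + \<mu>)\<^sup>2) / real n) (\<mu>\<^sup>2 + s2)"
    proof (rule conv_prob_AE_le[OF _ Y_law])
      have "(\<Sum>i<n. (real (\<epsilon> (Suc i) \<omega>) - \<mu> + \<mu>)\<^sup>2) / real n - (\<mu>\<^sup>2 + s2) = (\<Sum>i<n. ?y i \<omega>) / real n"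
        if "1 \<le> n" for n \<omega>
        using that by (simp add: sum_subtractf diff_divide_distrib v)
      then show "\<forall>\<^sub>F n in sequentially. AE \<omega> in M. \<bar>(\<Sum>i<n. (real (\<epsilon> (Suc i) \<omega>) - \<mu> + \<mu>)\<^sup>2) / real n - (\<mu>\<^sup>2 + s2)\<bar>
          \<le> \<bar>(\<Sum>i<n. ?y i \<omega>) / real n\<bar>"
        unfolding eventually_sequentially by (intro exI[of _ 1]) auto
    qed measurable
  qed
qed

section \<open>The limit law\<close>

lemma distr_scaled_normal_vector:
  fixes e :: "real ^ 'd" and \<kappa> :: real
  assumes N: "prob_space N" and Z: "distributed N lborel Z std_normal_density"
  defines "\<nu> \<equiv> distr N borel (\<lambda>\<omega>. (\<kappa> * Z \<omega>) *\<^sub>R e)"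
  shows "is_normal_law \<nu>" and "mean_vector \<nu> = 0"
    and "covariance_matrix \<nu> = (\<chi> i j. \<kappa>\<^sup>2 * (e $ i * e $ j))"
proof -
  interpret N: prob_space N by fact
  have [measurable]: "Z \<in> borel_measurable N"
    using distributed_measurable[OF Z] by simp
  have [measurable]: "(\<lambda>x. x $ i) \<in> borel_measurable (borel :: (real ^ 'd) measure)" for i
    by (intro borel_measurable_continuous_onI continuous_intros)
  have int: "(\<integral>x. f x \<partial>\<nu>) = (\<integral>\<omega>. f ((\<kappa> * Z \<omega>) *\<^sub>R e) \<partial>N)" if [measurable]: "f \<in> borel_measurable borel"
    for f :: "real ^ 'd \<Rightarrow> real"
    unfolding \<nu>_def by (rule integral_distr) measurable
  have EZ: "N.expectation Z = 0" by (rule N.standard_normal_distributed_expectation[OF Z])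
  have EZ2: "N.expectation (\<lambda>\<omega>. (Z \<omega>)\<^sup>2) = 1"
    using N.standard_normal_distributed_variance[OF Z] by (simp add: EZ)
  show mean: "mean_vector \<nu> = 0"
    by (simp add: mean_vector_def int EZ vec_eq_iff mult.assoc)
  have "(\<integral>\<omega>. (\<kappa> * Z \<omega>) * e $ i * ((\<kappa> * Z \<omega>) * e $ j) \<partial>N) = (\<integral>\<omega>. \<kappa>\<^sup>2 * (e $ i * e $ j) * (Z \<omega>)\<^sup>2 \<partial>N)" for i j
    by (simp add: power2_eq_square mult_ac)
  then show "covariance_matrix \<nu> = (\<chi> i j. \<kappa>\<^sup>2 * (e $ i * e $ j))"
    unfolding covariance_matrix_def mean by (simp add: int EZ2)
  show "is_normal_law \<nu>"
    unfolding is_normal_law_def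
  proof (intro conjI allI)
    show "sets \<nu> = sets borel" by (simp add: \<nu>_def)
    fix u :: "real ^ 'd"
    define t where "t = \<kappa> * (u \<bullet> e)"
    have eq: "distr \<nu> borel (\<lambda>x. u \<bullet> x) = distr N borel (\<lambda>\<omega>. t * Z \<omega>)"
      unfolding \<nu>_def by (subst distr_distr) (auto simp: t_def o_def mult_ac)
    have "distr \<nu> borel (\<lambda>x. u \<bullet> x) = univariate_normal 0 \<bar>t\<bar>"
    proof (cases "t = 0")
      case True
      then show ?thesis unfolding eq univariate_normal_def
        by (simp add: N.distr_const)
    next
      case False
      have "distributed N lborel (\<lambda>\<omega>. 0 + t * Z \<omega>) (normal_density (0 + t * 0) (\<bar>t\<bar> * 1))"
        by (rule N.normal_density_affine[OF Z]) (use False in auto)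
      then have "distr N lborel (\<lambda>\<omega>. t * Z \<omega>) = density lborel (\<lambda>x. ennreal (normal_density 0 \<bar>t\<bar> x))"
        by (simp add: distributed_distr_eq_density)
      then show ?thesis unfolding eq univariate_normal_def
        using False by (simp cong: distr_cong)
    qed
    then show "\<exists>m s. 0 \<le> s \<and> distr \<nu> borel (\<lambda>x. u \<bullet> x) = univariate_normal m s"
      by (metis abs_ge_zero)
  qed
qed

lemma vector_2_eq: "(vector [x, y] :: real ^ 2) = x *\<^sub>R vector [1, 0] + y *\<^sub>R vector [0, 1]"
  by (simp add: vec_eq_iff forall_2)

text \<open>
  The estimation error splits as \<open>\<surd>n (\<alpha> - 1, \<beta>) = \<surd>n (\<alpha> - 1 + \<beta>) (1, 0) + \<surd>n \<beta> (-1, 1)\<close>.  The first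
  part vanishes in probability and the second one is asymptotically \<open>Lin (-1, 1)\<close>, which is why the
  limit is carried by a line.
\<close>

theorem theorem1p1:
  fixes M :: "'a measure" and N :: "'b measure"
    and \<epsilon> :: "nat \<Rightarrow> 'a \<Rightarrow> nat" and X :: "int \<Rightarrow> 'a \<Rightarrow> nat"
    and \<mu> \<sigma> :: real
    and \<alpha>h \<beta>h :: "nat \<Rightarrow> (nat \<Rightarrow> real) \<Rightarrow> real"
    and XX :: "nat \<Rightarrow> 'a \<Rightarrow> nat \<Rightarrow> real"
    and Z :: "'b \<Rightarrow> real"
  assumes "prob_space M"
    and "INAR2 M 1 0 \<epsilon> X"
    and "AE \<omega> in M. X 0 \<omega> = 0" and "AE \<omega> in M. X (-1) \<omega> = 0"
    and "integrable M (\<lambda>\<omega>. (real (\<epsilon> 1 \<omega>))\<^sup>2)"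
    and "integrable M (\<lambda>\<omega>. real (\<epsilon> 1 \<omega>) ^ 4)"
    and "\<mu> = (\<integral>\<omega>. real (\<epsilon> 1 \<omega>) \<partial>M)"
    and "\<sigma> \<ge> 0" and "\<sigma>\<^sup>2 = (\<integral>\<omega>. (real (\<epsilon> 1 \<omega>) - \<mu>)\<^sup>2 \<partial>M)"
    and "\<mu> > 0"
    and "\<And>n. n \<ge> 1 \<Longrightarrow> is_CLS_estimator \<mu> n (\<alpha>h n) (\<beta>h n)"
    and "\<And>n \<omega>. XX n \<omega> = (\<lambda>k\<in>{1..n}. real (X (int k) \<omega>))"
    and "prob_space N" and "distributed N lborel Z std_normal_density"
  shows "converges_in_distribution M
           (\<lambda>n \<omega>. vector [sqrt (real n) * (\<alpha>h n (XX n \<omega>) - 1), sqrt (real n) * \<beta>h n (XX n \<omega>)] :: real ^ 2)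
           N (\<lambda>\<omega>. (2 * \<sigma> / sqrt (\<mu>\<^sup>2 + 4 * \<sigma>\<^sup>2) * Z \<omega>) *\<^sub>R vector [-1, 1])
    \<and> (let \<nu> = distr N borel (\<lambda>\<omega>. (2 * \<sigma> / sqrt (\<mu>\<^sup>2 + 4 * \<sigma>\<^sup>2) * Z \<omega>) *\<^sub>R (vector [-1, 1] :: real ^ 2))
       in is_normal_law \<nu> \<and> mean_vector \<nu> = 0 \<and>
          covariance_matrix \<nu> =
            (4 * \<sigma>\<^sup>2 / (\<mu>\<^sup>2 + 4 * \<sigma>\<^sup>2)) *\<^sub>R vector [vector [1, -1], vector [-1, 1]])"
proof -
  interpret prob_space M by fact
  have iid: "iid_nat M \<epsilon>" using assms(2) by (simp add: INAR2_def)
  define m where "m = (\<lambda>i \<omega>. real (\<epsilon> (Suc i) \<omega>) - \<mu>)"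
  interpret W: drift_walk M m "\<sigma>\<^sup>2" "expectation (\<lambda>\<omega>. (1 + \<bar>real (\<epsilon> 1 \<omega>) - \<mu>\<bar>) ^ 3)" \<mu>
    unfolding m_def using drift_walk_of_iid[OF iid assms(6,7,9,10)] .
  define \<tau> where "\<tau> = 2 * \<sigma> / sqrt (\<mu>\<^sup>2 + 4 * \<sigma>\<^sup>2)"
  have \<tau>2: "\<tau>\<^sup>2 = 4 * \<sigma>\<^sup>2 / (\<mu>\<^sup>2 + 4 * \<sigma>\<^sup>2)"
    using W.D_pos by (simp add: \<tau>_def power_divide power_mult_distrib)
  define e where "e = (vector [-1, 1] :: real ^ 2)"
  define a b where "a = (\<lambda>n \<omega>. \<alpha>h n (XX n \<omega>))" and "b = (\<lambda>n \<omega>. \<beta>h n (XX n \<omega>))"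
  have X_meas [measurable]: "X (int k) \<in> measurable M (count_space UNIV)" for k
    using assms(2) by (simp add: INAR2_def)
  have XX_meas: "XX n \<in> measurable M (PiM {1..n} (\<lambda>_. borel))" for n
    unfolding assms(12)[abs_def] by measurable
  have est_meas: "a n \<in> borel_measurable M" "b n \<in> borel_measurable M" if "1 \<le> n" for n
  proof -
    have "(\<lambda>x. (\<alpha>h n x, \<beta>h n x)) \<in> borel_measurable (PiM {1..n} (\<lambda>_. borel))"
      using assms(11)[OF that] by (simp add: is_CLS_estimator_def)
    from measurable_compose[OF XX_meas this]
    have "(\<lambda>\<omega>. (a n \<omega>, b n \<omega>)) \<in> borel_measurable M" by (simp add: a_def b_def)
    then have "(\<lambda>\<omega>. (a n \<omega>, b n \<omega>)) \<in> measurable M (borel \<Otimes>\<^sub>M borel)" by (simp add: borel_prod)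
    from measurable_compose[OF this measurable_fst] measurable_compose[OF this measurable_snd]
    show "a n \<in> borel_measurable M" "b n \<in> borel_measurable M" by simp_all
  qed
  have a_meas [measurable]: "(\<lambda>\<omega>. sqrt (real n) * (a n \<omega> - 1)) \<in> borel_measurable M"
    and b_meas [measurable]: "(\<lambda>\<omega>. sqrt (real n) * b n \<omega>) \<in> borel_measurable M" for n
    using est_meas[of n] by (cases "n = 0"; simp)+
  have sum_meas [measurable]: "(\<lambda>\<omega>. sqrt (real n) * (a n \<omega> - 1 + b n \<omega>)) \<in> borel_measurable M" for n
    using borel_measurable_add[OF a_meas[of n] b_meas[of n]] by (simp add: distrib_left)
  have walk: "AE \<omega> in M. \<forall>k. real (X (int k) \<omega>) = W.S k \<omega>"
  proof -
    have "W.S k \<omega> = (\<Sum>i<k. real (\<epsilon> (Suc i) \<omega>))" for k \<omega>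
      unfolding W.S_def unfolding m_def by simp
    with INAR2_1_0_random_walk[OF assms(2-4)] show ?thesis
      by (auto elim!: AE_mp)
  qed
  have normal: "AE \<omega> in M.
      b n \<omega> * (W.SS n \<omega> * W.EE n \<omega> - (W.SE n \<omega>)\<^sup>2) = W.MS n \<omega> * W.SE n \<omega> - W.EM n \<omega> * W.SS n \<omega> \<and>
      (a n \<omega> - 1 + b n \<omega>) * (W.SS n \<omega> * W.EE n \<omega> - (W.SE n \<omega>)\<^sup>2) = W.MS n \<omega> * W.EE n \<omega> - W.EM n \<omega> * W.SE n \<omega>"
    if "1 \<le> n" for n
    using walk
  proof eventually_elim
    case (elim \<omega>)
    obtain l where l: "n = Suc l" using \<open>1 \<le> n\<close> by (cases n) auto
    have est: "is_CLS_estimator \<mu> (Suc l) (\<alpha>h n) (\<beta>h n)" using assms(11)[OF that] by (simp add: l)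
    have S0: "W.S 0 \<omega> = 0" by (simp add: W.S_def)
    have x: "XX n \<omega> = (\<lambda>k\<in>{1..Suc l}. W.S k \<omega>)"
      unfolding assms(12) using elim by (simp add: l)
    have inc: "m i \<omega> + \<mu> = W.S (Suc i) \<omega> - W.S i \<omega>" for i by (simp add: W.S_def)
    from cls_solution[where s = "\<lambda>k. W.S k \<omega>" and e = "\<lambda>i. m i \<omega> + \<mu>", OF est S0 x inc]
    show ?case
      by (simp add: a_def b_def W.SS_def W.EE_def W.SE_def W.MS_def W.EM_def l)
  qed
  have b_lim: "conv_prob M (\<lambda>n \<omega>. sqrt (real n) * b n \<omega> - W.Lin n \<omega>) 0"
    by (rule W.second_coefficient_expansion[OF b_meas]) (use normal in auto)
  have sum_lim: "conv_prob M (\<lambda>n \<omega>. sqrt (real n) * (a n \<omega> - 1 + b n \<omega>)) 0"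
    by (rule W.coefficient_sum_negligible[OF sum_meas]) (use normal in auto)
  define Y where "Y = (\<lambda>n \<omega>. vector [sqrt (real n) * (a n \<omega> - 1), sqrt (real n) * b n \<omega>] :: real ^ 2)"
  have Y_meas [measurable]: "Y n \<in> borel_measurable M" for n
    unfolding Y_def vector_2_eq[of "sqrt (real n) * _"] by measurable
  have Z_meas [measurable]: "Z \<in> borel_measurable N"
    using distributed_measurable[OF assms(14)] by simp
  have close: "conv_prob M (\<lambda>n \<omega>. norm (Y n \<omega> - W.Lin n \<omega> *\<^sub>R e)) 0"
  proof (rule conv_prob_AE_le)
    let ?Z = "\<lambda>n \<omega>. \<bar>sqrt (real n) * (a n \<omega> - 1 + b n \<omega>)\<bar> + 2 * \<bar>sqrt (real n) * b n \<omega> - W.Lin n \<omega>\<bar>"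
    show "?Z n \<in> borel_measurable M" for n by measurable
    have "isCont (\<lambda>p. \<bar>fst p\<bar> + 2 * \<bar>snd p\<bar> :: real) (0, 0)" by (intro continuous_intros)
    then have "conv_prob M ?Z (\<bar>0\<bar> + 2 * \<bar>0\<bar>)"
      by (rule conv_prob_map2[where g = "\<lambda>x y. \<bar>x\<bar> + 2 * \<bar>y\<bar>", OF _ _ sum_lim b_lim, rotated -1]) measurable
    then show "conv_prob M ?Z 0" by simp
    have "norm (Y n \<omega> - W.Lin n \<omega> *\<^sub>R e) \<le> ?Z n \<omega>" for n \<omega>
    proof -
      have "norm (Y n \<omega> - W.Lin n \<omega> *\<^sub>R e) \<le> (\<Sum>i\<in>UNIV. \<bar>(Y n \<omega> - W.Lin n \<omega> *\<^sub>R e) $ i\<bar>)"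
        by (rule norm_le_l1_cart)
      also have "\<dots> = \<bar>sqrt (real n) * (a n \<omega> - 1) + W.Lin n \<omega>\<bar> + \<bar>sqrt (real n) * b n \<omega> - W.Lin n \<omega>\<bar>"
        by (simp add: sum_2 Y_def e_def)
      also have "sqrt (real n) * (a n \<omega> - 1) + W.Lin n \<omega>
          = sqrt (real n) * (a n \<omega> - 1 + b n \<omega>) - (sqrt (real n) * b n \<omega> - W.Lin n \<omega>)"
        by (simp add: algebra_simps)
      also have "\<bar>x - y\<bar> + \<bar>y\<bar> \<le> \<bar>x\<bar> + 2 * \<bar>y\<bar>" for x y :: real by linarith
      finally show ?thesis .
    qed
    then show "\<forall>\<^sub>F n in sequentially. AE \<omega> in M. \<bar>norm (Y n \<omega> - W.Lin n \<omega> *\<^sub>R e) - 0\<bar> \<le> \<bar>?Z n \<omega>\<bar>"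
      unfolding diff_0_right abs_norm_cancel
      by (intro always_eventually allI AE_I2) (rule order_trans[OF _ abs_ge_self])
  qed
  have "converges_in_distribution M Y N (\<lambda>\<omega>. (\<tau> * Z \<omega>) *\<^sub>R e)"
    unfolding converges_in_distribution_def
  proof (intro conjI allI impI)
    fix f :: "real ^ 2 \<Rightarrow> real"
    assume f: "continuous_on UNIV f" "bounded (range f)"
    have g: "continuous_on UNIV (\<lambda>y. f (y *\<^sub>R e))"
      by (intro continuous_on_compose2[OF f(1)] continuous_intros) auto
    have "bounded (range (\<lambda>y. f (y *\<^sub>R e)))"
      by (rule bounded_subset[OF f(2)]) auto
    from W.Lin_weak_limit[OF \<tau>2 assms(13,14) g this]
    have "(\<lambda>n. expectation (\<lambda>\<omega>. f (W.Lin n \<omega> *\<^sub>R e))) \<longlonglongrightarrow> (\<integral>\<omega>. f ((\<tau> * Z \<omega>) *\<^sub>R e) \<partial>N)" .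
    then show "(\<lambda>n. expectation (\<lambda>\<omega>. f (Y n \<omega>))) \<longlonglongrightarrow> (\<integral>\<omega>. f ((\<tau> * Z \<omega>) *\<^sub>R e) \<partial>N)"
      by (rule Slutsky[OF Y_meas W.Lin_measurable W.Lin_bounded close f])
  qed measurable
  moreover have "covariance_matrix (distr N borel (\<lambda>\<omega>. (\<tau> * Z \<omega>) *\<^sub>R e))
      = (4 * \<sigma>\<^sup>2 / (\<mu>\<^sup>2 + 4 * \<sigma>\<^sup>2)) *\<^sub>R vector [vector [1, -1], vector [-1, 1]]"
    unfolding distr_scaled_normal_vector(3)[OF assms(13,14)] \<tau>2
    by (simp add: vec_eq_iff forall_2 e_def)
  ultimately show ?thesis
    using distr_scaled_normal_vector(1,2)[OF assms(13,14), of \<tau> e]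
    unfolding Let_def Y_def a_def b_def \<tau>_def e_def by (intro conjI)
qed

end
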